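(* Let $D$ be a finite-dimensional central division algebra over a field $k$. Then any chain coalgebra of type $D$ is isomorphic to a subcoalgebra of $D[[x]]^\circ$, the finite dual of the power series ring with coefficients in $D$.
   Context: Central means that the center of $D$ is $k$. Coalgebras are coassociative and counital over $k$. A chain coalgebra is a coalgebra $C$ whose right coideals (right subcomodules of $C$) are linearly ordered by inclusion (equivalently, whose left coideals are). Its coradical $C_0$ is the socle of $C$ as a left module over the convolution algebra $C^*=\mathrm{Hom}_k(C,k)$; $C$ is of type $D$ if $(C_0)^*\simeq D$ as $k$-algebras. $D[[x]]$ is the power series ring over $D$ in one variable $x$ commuting with the elements of $D$. For a $k$-algebra $A$, the finite dual $A^\circ$ is the coalgebra of all $f\in\mathrm{Hom}_k(A,k)$ whose kernel contains a two-sided ideal of finite codimension. *)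

theory Defs
  imports
    "HOL-Library.Poly_Mapping"
    "HOL-Library.Function_Algebras"
    "HOL-Computational_Algebra.Formal_Power_Series"
begin

section \<open>Linear algebra on carriers\<close>

text \<open>
  Algebras live on whole types. Coalgebras live on subspaces of an ambient vector space, because
  finite duals, subcoalgebras and coradicals are proper subsets of the types they live in.
\<close>

definition linear_on ::
    "('k \<Rightarrow> 'v::ab_group_add \<Rightarrow> 'v) \<Rightarrow> ('k \<Rightarrow> 'w::ab_group_add \<Rightarrow> 'w) \<Rightarrow> 'v set \<Rightarrow> ('v \<Rightarrow> 'w) \<Rightarrow> bool" where
  "linear_on s1 s2 V f \<longleftrightarrow>
     (\<forall>x\<in>V. \<forall>y\<in>V. f (x + y) = f x + f y) \<and> (\<forall>a. \<forall>x\<in>V. f (s1 a x) = s2 a (f x))"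

definition fun_scale :: "'k::times \<Rightarrow> ('a \<Rightarrow> 'k) \<Rightarrow> 'a \<Rightarrow> 'k" where
  "fun_scale a f = (\<lambda>x. a * f x)"

definition free_scale :: "'k::semiring_0 \<Rightarrow> ('b \<Rightarrow>\<^sub>0 'k) \<Rightarrow> 'b \<Rightarrow>\<^sub>0 'k" where
  "free_scale a t = Poly_Mapping.map ((*) a) t"

text \<open>The linear extension of \<open>F\<close> from the basis to the free vector space.\<close>

definition lin_ext :: "('k::zero \<Rightarrow> 'v::comm_monoid_add \<Rightarrow> 'v) \<Rightarrow> ('b \<Rightarrow> 'v) \<Rightarrow> ('b \<Rightarrow>\<^sub>0 'k) \<Rightarrow> 'v" where
  "lin_ext s F t = (\<Sum>p\<in>Poly_Mapping.keys t. s (Poly_Mapping.lookup t p) (F p))"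


section \<open>Tensor squares and cubes\<close>

text \<open>
  For a subspace \<open>V\<close>, the space \<open>V \<otimes> V\<close> is the free vector space on \<open>V \<times> V\<close> modulo the span of the
  bilinearity relations, and \<open>V \<otimes> V \<otimes> V\<close> the free vector space on triples modulo the trilinearity
  relations. Tensors are handled through representatives in the free vector space, and two
  representatives are equal as tensors iff they are related by \<open>tensor2_eq\<close> (resp. \<open>tensor3_eq\<close>).
  The argument \<open>\<iota>\<close> of \<open>slot_rels\<close> inserts a vector into one tensor factor, the others being fixed.
\<close>

definition slot_rels ::
    "('k::field \<Rightarrow> 'v::ab_group_add \<Rightarrow> 'v) \<Rightarrow> 'v set \<Rightarrow> ('v \<Rightarrow> 'b) \<Rightarrow> ('b \<Rightarrow>\<^sub>0 'k) set" where
  "slot_rels s V \<iota> =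
     {Poly_Mapping.single (\<iota> (x + y)) 1 - Poly_Mapping.single (\<iota> x) 1 - Poly_Mapping.single (\<iota> y) 1
        | x y. x \<in> V \<and> y \<in> V} \<union>
     {Poly_Mapping.single (\<iota> (s a x)) 1 - free_scale a (Poly_Mapping.single (\<iota> x) 1)
        | a x. x \<in> V}"

definition tensor2_eq ::
    "('k::field \<Rightarrow> 'v::ab_group_add \<Rightarrow> 'v) \<Rightarrow> 'v set \<Rightarrow> ('v \<times> 'v \<Rightarrow>\<^sub>0 'k) \<Rightarrow> ('v \<times> 'v \<Rightarrow>\<^sub>0 'k) \<Rightarrow> bool" where
  "tensor2_eq s V t u \<longleftrightarrow>
     t - u \<in> module.span free_scale
       (\<Union>y\<in>V. slot_rels s V (\<lambda>x. (x, y)) \<union> slot_rels s V (\<lambda>x. (y, x)))"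

definition tensor3_eq ::
    "('k::field \<Rightarrow> 'v::ab_group_add \<Rightarrow> 'v) \<Rightarrow> 'v set \<Rightarrow>
     ('v \<times> 'v \<times> 'v \<Rightarrow>\<^sub>0 'k) \<Rightarrow> ('v \<times> 'v \<times> 'v \<Rightarrow>\<^sub>0 'k) \<Rightarrow> bool" where
  "tensor3_eq s V t u \<longleftrightarrow>
     t - u \<in> module.span free_scale
       (\<Union>y\<in>V. \<Union>z\<in>V. slot_rels s V (\<lambda>x. (x, y, z)) \<union> slot_rels s V (\<lambda>x. (y, x, z))
                        \<union> slot_rels s V (\<lambda>x. (y, z, x)))"

definition tensor_map ::
    "('v \<Rightarrow> 'w) \<Rightarrow> ('v \<Rightarrow> 'w) \<Rightarrow> ('v \<times> 'v \<Rightarrow>\<^sub>0 'k::semiring_1) \<Rightarrow> 'w \<times> 'w \<Rightarrow>\<^sub>0 'k" where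
  "tensor_map f g = lin_ext free_scale (\<lambda>(x, y). Poly_Mapping.single (f x, g y) 1)"


section \<open>Coalgebras\<close>

text \<open>
  Only the values of \<open>comult\<close> and \<open>counit\<close> on \<open>carr\<close> matter, and only the class of \<open>comult C c\<close> in
  \<open>carr C \<otimes> carr C\<close>.
\<close>

record (overloaded) ('c, 'k) coalg =
  smul :: "'k \<Rightarrow> 'c \<Rightarrow> 'c"
  carr :: "'c set"
  comult :: "'c \<Rightarrow> ('c \<times> 'c \<Rightarrow>\<^sub>0 'k)"
  counit :: "'c \<Rightarrow> 'k"

abbreviation teq2 :: "('c::ab_group_add, 'k::field) coalg \<Rightarrow> ('c \<times> 'c \<Rightarrow>\<^sub>0 'k) \<Rightarrow> ('c \<times> 'c \<Rightarrow>\<^sub>0 'k) \<Rightarrow> bool" where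
  "teq2 C \<equiv> tensor2_eq (smul C) (carr C)"

definition comult_id ::
    "('c, 'k::semiring_1) coalg \<Rightarrow> ('c \<times> 'c \<Rightarrow>\<^sub>0 'k) \<Rightarrow> 'c \<times> 'c \<times> 'c \<Rightarrow>\<^sub>0 'k" where
  "comult_id C = lin_ext free_scale (\<lambda>(x, y).
     lin_ext free_scale (\<lambda>(p, q). Poly_Mapping.single (p, q, y) 1) (comult C x))"

definition id_comult ::
    "('c, 'k::semiring_1) coalg \<Rightarrow> ('c \<times> 'c \<Rightarrow>\<^sub>0 'k) \<Rightarrow> 'c \<times> 'c \<times> 'c \<Rightarrow>\<^sub>0 'k" where
  "id_comult C = lin_ext free_scale (\<lambda>(x, y).
     lin_ext free_scale (\<lambda>(p, q). Poly_Mapping.single (x, p, q) 1) (comult C y))"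

locale coalgebra =
  fixes C :: "('c::ab_group_add, 'k::field) coalg"
  assumes vector_space: "vector_space (smul C)"
    and subspace: "module.subspace (smul C) (carr C)"
    and comult_closed: "c \<in> carr C \<Longrightarrow> Poly_Mapping.keys (comult C c) \<subseteq> carr C \<times> carr C"
    and comult_add: "c \<in> carr C \<Longrightarrow> d \<in> carr C \<Longrightarrow>
      teq2 C (comult C (c + d)) (comult C c + comult C d)"
    and comult_smul: "c \<in> carr C \<Longrightarrow>
      teq2 C (comult C (smul C a c)) (free_scale a (comult C c))"
    and counit_linear: "linear_on (smul C) (*) (carr C) (counit C)"
    and coassoc: "c \<in> carr C \<Longrightarrow>
      tensor3_eq (smul C) (carr C) (comult_id C (comult C c)) (id_comult C (comult C c))"
    and counit_left: "c \<in> carr C \<Longrightarrow>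
      lin_ext (smul C) (\<lambda>(x, y). smul C (counit C x) y) (comult C c) = c"
    and counit_right: "c \<in> carr C \<Longrightarrow>
      lin_ext (smul C) (\<lambda>(x, y). smul C (counit C y) x) (comult C c) = c"

definition subcoalgebra :: "('c::ab_group_add, 'k::field) coalg \<Rightarrow> 'c set \<Rightarrow> bool" where
  "subcoalgebra C S \<longleftrightarrow> module.subspace (smul C) S \<and> S \<subseteq> carr C \<and>
     (\<forall>c\<in>S. \<exists>t. Poly_Mapping.keys t \<subseteq> S \<times> S \<and> teq2 C (comult C c) t)"

text \<open>
  The coalgebra structure on a subcoalgebra \<open>S\<close>. Since \<open>S \<otimes> S\<close> embeds into \<open>C \<otimes> C\<close> over a field, all
  choices of \<open>t\<close> represent the same element of \<open>S \<otimes> S\<close>.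
\<close>

definition restrict_coalg :: "('c::ab_group_add, 'k::field) coalg \<Rightarrow> 'c set \<Rightarrow> ('c, 'k) coalg" where
  "restrict_coalg C S = C\<lparr>carr := S,
     comult := (\<lambda>c. SOME t. Poly_Mapping.keys t \<subseteq> S \<times> S \<and> teq2 C (comult C c) t)\<rparr>"

definition coalg_iso ::
    "('c::ab_group_add, 'k::field) coalg \<Rightarrow> ('e::ab_group_add, 'k) coalg \<Rightarrow> ('c \<Rightarrow> 'e) \<Rightarrow> bool" where
  "coalg_iso C E \<phi> \<longleftrightarrow>
     bij_betw \<phi> (carr C) (carr E) \<and> linear_on (smul C) (smul E) (carr C) \<phi> \<and>
     (\<forall>c\<in>carr C. teq2 E (comult E (\<phi> c)) (tensor_map \<phi> \<phi> (comult C c))) \<and>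
     (\<forall>c\<in>carr C. counit E (\<phi> c) = counit C c)"

definition isomorphic_coalgs ::
    "('c::ab_group_add, 'k::field) coalg \<Rightarrow> ('e::ab_group_add, 'k) coalg \<Rightarrow> bool" where
  "isomorphic_coalgs C E \<longleftrightarrow> (\<exists>\<phi>. coalg_iso C E \<phi>)"

definition right_coideal :: "('c::ab_group_add, 'k::field) coalg \<Rightarrow> 'c set \<Rightarrow> bool" where
  "right_coideal C N \<longleftrightarrow> module.subspace (smul C) N \<and> N \<subseteq> carr C \<and>
     (\<forall>c\<in>N. \<exists>t. Poly_Mapping.keys t \<subseteq> N \<times> carr C \<and> teq2 C (comult C c) t)"

definition chain_coalgebra :: "('c::ab_group_add, 'k::field) coalg \<Rightarrow> bool" where
  "chain_coalgebra C \<longleftrightarrow> coalgebra C \<and>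
     (\<forall>M N. right_coideal C M \<and> right_coideal C N \<longrightarrow> M \<subseteq> N \<or> N \<subseteq> M)"


section \<open>The convolution algebra, the coradical and the type\<close>

text \<open>Functionals on the carrier are extended by zero, so that they are determined as functions.\<close>

definition dual_space :: "('c::ab_group_add, 'k::field) coalg \<Rightarrow> ('c \<Rightarrow> 'k) set" where
  "dual_space C = {f. linear_on (smul C) (*) (carr C) f \<and> (\<forall>c. c \<notin> carr C \<longrightarrow> f c = 0)}"

definition convolution ::
    "('c::ab_group_add, 'k::field) coalg \<Rightarrow> ('c \<Rightarrow> 'k) \<Rightarrow> ('c \<Rightarrow> 'k) \<Rightarrow> 'c \<Rightarrow> 'k" where
  "convolution C f g = (\<lambda>c. if c \<in> carr C then lin_ext (*) (\<lambda>(x, y). f x * g y) (comult C c) else 0)"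

definition dual_one :: "('c::ab_group_add, 'k::field) coalg \<Rightarrow> 'c \<Rightarrow> 'k" where
  "dual_one C = (\<lambda>c. if c \<in> carr C then counit C c else 0)"

text \<open>The left action of the convolution algebra on \<open>C\<close>: \<open>f \<rightharpoonup> c = \<Sum> f(c\<^sub>2) c\<^sub>1\<close>.\<close>

definition dual_act :: "('c::ab_group_add, 'k::field) coalg \<Rightarrow> ('c \<Rightarrow> 'k) \<Rightarrow> 'c \<Rightarrow> 'c" where
  "dual_act C f c = lin_ext (smul C) (\<lambda>(x, y). smul C (f y) x) (comult C c)"

definition dual_submodule :: "('c::ab_group_add, 'k::field) coalg \<Rightarrow> 'c set \<Rightarrow> bool" where
  "dual_submodule C N \<longleftrightarrow> module.subspace (smul C) N \<and> N \<subseteq> carr C \<and>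
     (\<forall>f\<in>dual_space C. \<forall>c\<in>N. dual_act C f c \<in> N)"

definition simple_dual_submodule :: "('c::ab_group_add, 'k::field) coalg \<Rightarrow> 'c set \<Rightarrow> bool" where
  "simple_dual_submodule C N \<longleftrightarrow> dual_submodule C N \<and> N \<noteq> {0} \<and>
     (\<forall>M. dual_submodule C M \<and> M \<subseteq> N \<longrightarrow> M = {0} \<or> M = N)"

definition coradical :: "('c::ab_group_add, 'k::field) coalg \<Rightarrow> 'c set" where
  "coradical C = module.span (smul C) (\<Union>{N. simple_dual_submodule C N})"

definition coradical_coalg :: "('c::ab_group_add, 'k::field) coalg \<Rightarrow> ('c, 'k) coalg" where
  "coradical_coalg C = restrict_coalg C (coradical C)"

definition dual_algebra_iso ::
    "('c::ab_group_add, 'k::field) coalg \<Rightarrow> ('k \<Rightarrow> 'd::ring_1 \<Rightarrow> 'd) \<Rightarrow> (('c \<Rightarrow> 'k) \<Rightarrow> 'd) \<Rightarrow> bool" where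
  "dual_algebra_iso C scale \<Phi> \<longleftrightarrow>
     bij_betw \<Phi> (dual_space C) UNIV \<and> linear_on fun_scale scale (dual_space C) \<Phi> \<and>
     (\<forall>f\<in>dual_space C. \<forall>g\<in>dual_space C. \<Phi> (convolution C f g) = \<Phi> f * \<Phi> g) \<and>
     \<Phi> (dual_one C) = 1"

definition coalgebra_of_type ::
    "('k::field \<Rightarrow> 'd::ring_1 \<Rightarrow> 'd) \<Rightarrow> ('c::ab_group_add, 'k) coalg \<Rightarrow> bool" where
  "coalgebra_of_type scale C \<longleftrightarrow> (\<exists>\<Phi>. dual_algebra_iso (coradical_coalg C) scale \<Phi>)"


section \<open>Algebras and the finite dual\<close>

locale k_algebra = vector_space scale
  for scale :: "'k::field \<Rightarrow> 'a::ring_1 \<Rightarrow> 'a" +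
  assumes scale_mult_left: "scale r x * y = scale r (x * y)"
    and scale_mult_right: "x * scale r y = scale r (x * y)"

locale findim_central_division_algebra = k_algebra scale
  for scale :: "'k::field \<Rightarrow> 'd::division_ring \<Rightarrow> 'd" +
  assumes finite_dimensional: "\<exists>B. finite B \<and> module.span scale B = UNIV"
    and central: "{z. \<forall>x. z * x = x * z} = range (\<lambda>r. scale r 1)"

definition two_sided_ideal :: "'a::ring_1 set \<Rightarrow> bool" where
  "two_sided_ideal I \<longleftrightarrow> 0 \<in> I \<and> (\<forall>x\<in>I. \<forall>y\<in>I. x + y \<in> I) \<and> (\<forall>a. \<forall>x\<in>I. a * x \<in> I \<and> x * a \<in> I)"

definition finite_codim :: "('k::field \<Rightarrow> 'a::ab_group_add \<Rightarrow> 'a) \<Rightarrow> 'a set \<Rightarrow> bool" where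
  "finite_codim scale I \<longleftrightarrow> (\<exists>B. finite B \<and> module.span scale (I \<union> B) = UNIV)"

definition finite_dual_carrier :: "('k::field \<Rightarrow> 'a::ring_1 \<Rightarrow> 'a) \<Rightarrow> ('a \<Rightarrow> 'k) set" where
  "finite_dual_carrier scale = {f. Vector_Spaces.linear scale (*) f \<and>
     (\<exists>I. two_sided_ideal I \<and> finite_codim scale I \<and> (\<forall>x\<in>I. f x = 0))}"

text \<open>
  The comultiplication of the finite dual is dual to multiplication: \<open>\<Delta> f = \<Sum> g\<^sub>i \<otimes> h\<^sub>i\<close> is the unique
  tensor over the finite dual with \<open>f (a b) = \<Sum> g\<^sub>i(a) h\<^sub>i(b)\<close> for all \<open>a, b\<close>; the choice below only
  selects a representative.
\<close>

definition finite_dual :: "('k::field \<Rightarrow> 'a::ring_1 \<Rightarrow> 'a) \<Rightarrow> ('a \<Rightarrow> 'k, 'k) coalg" where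
  "finite_dual scale =
     \<lparr>smul = fun_scale,
      carr = finite_dual_carrier scale,
      comult = (\<lambda>f. SOME t.
        Poly_Mapping.keys t \<subseteq> finite_dual_carrier scale \<times> finite_dual_carrier scale \<and>
        (\<forall>a b. f (a * b) = lin_ext (*) (\<lambda>(g, h). g a * h b) t)),
      counit = (\<lambda>f. f 1)\<rparr>"

text \<open>
  The ring \<open>D[[x]]\<close> is \<^typ>\<open>'d fps\<close>; in its Cauchy product the variable commutes with all
  coefficients, also for noncommutative \<open>D\<close>.
\<close>

definition fps_scale :: "('k \<Rightarrow> 'd \<Rightarrow> 'd) \<Rightarrow> 'k \<Rightarrow> 'd fps \<Rightarrow> 'd fps" where
  "fps_scale scale r p = Abs_fps (\<lambda>n. scale r (fps_nth p n))"

end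

theory Submission
  imports Defs
begin

text \<open>
  Let \<open>A\<close> be the convolution algebra of the chain coalgebra \<open>C\<close>, acting on \<open>C\<close> by
  \<open>f \<rightharpoonup> c = \<Sum> f(c\<^sub>2) c\<^sub>1\<close>, and let \<open>J\<close> be the ideal of the functionals that vanish on the coradical
  \<open>C\<^sub>0\<close>, so that \<open>A / J\<close> is isomorphic to \<open>D\<close>. A coalgebra embedding of \<open>C\<close> into the finite dual of
  \<open>D[[x]]\<close> amounts to an algebra map \<open>\<Psi>\<close> from \<open>D[[x]]\<close> to \<open>A\<close> such that every \<open>c\<close> in \<open>C\<close> is
  killed by \<open>\<Psi>(x\<^sup>n p)\<close> for all \<open>p\<close> and all large \<open>n\<close>, and such that the image of \<open>\<Psi>\<close> separates
  the points of \<open>C\<close>: send \<open>c\<close> to the functional \<open>p \<mapsto> \<Psi>(p)(c)\<close>.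

  The chain condition makes \<open>C\<^sub>0\<close> the only simple submodule of \<open>C\<close>. It also makes \<open>J\<close> topologically
  principal. If \<open>C\<close> is larger than \<open>C\<^sub>0\<close>, let \<open>C\<^sub>1\<close> be a smallest submodule beyond \<open>C\<^sub>0\<close>. A
  functional \<open>y\<close> in \<open>J\<close> that is nonzero on \<open>C\<^sub>1\<close> generates a dense right ideal of \<open>J\<close>
  (\<open>second_layer\<close>), and \<open>J c = y A c\<close> for every vector \<open>c\<close> (\<open>locally_principal\<close>).
  Since \<open>y\<close> kills \<open>C\<^sub>0\<close>, which lies in every nonzero submodule, \<open>y\<close> is nilpotent on the
  finite-dimensional submodules \<open>A c\<close> (\<open>nilpotent_at\<close>).

  What remains is to lift \<open>D\<close> to a subalgebra of \<open>A\<close> and to choose \<open>y\<close> in its centralizer. Both use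
  that \<open>D\<close> is central: every linear map \<open>D \<rightarrow> D\<close> is a sum of two-sided multiplications, and an
  identity among such sums holds in every \<open>D\<close>-bimodule (\<open>balanced_sum_eqI\<close>,
  \<open>functional_as_two_sided_multiplications\<close>). One consequence is a separability idempotent, with
  which a linear section of \<open>A \<rightarrow> D\<close> is improved by a quadratically convergent iteration to an
  algebra map \<open>\<delta>\<close> (\<open>newton_defect\<close>, \<open>lifting_exists\<close>). Another is that \<open>y\<close> is a combination
  \<open>\<Sum> \<delta>(k) E\<^sub>k\<close> with \<open>E\<^sub>k\<close> in \<open>J\<close> commuting with \<open>\<delta>(D)\<close>, and one of the \<open>E\<^sub>k\<close> is again
  nonzero on \<open>C\<^sub>1\<close>; it is the image of \<open>x\<close> (\<open>central_generator_exists\<close>). Expanding step by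
  step modulo \<open>J\<close> shows that \<open>A c\<close> is the sum of the \<open>\<delta>(D) x\<^sup>i c\<close> (\<open>power_series_generation\<close>),
  which gives separation of points.
\<close>

section \<open>Linear algebra over a field\<close>

lemma vector_space_field: "vector_space ((*) :: 'k::field \<Rightarrow> 'k \<Rightarrow> 'k)"
  by unfold_locales (auto simp: algebra_simps)

lemma vector_space_fun:
  assumes "vector_space (s :: 'k::field \<Rightarrow> 'v::ab_group_add \<Rightarrow> 'v)"
  shows "vector_space (\<lambda>r (f :: 'a \<Rightarrow> 'v) x. s r (f x))"
proof -
  interpret vector_space s by fact
  show ?thesis
    by unfold_locales (auto simp: fun_eq_iff scale_right_distrib scale_left_distrib)
qed

context vector_space
begin

lemma separating_functional:
  assumes "v \<notin> span S"
  obtains f where "Vector_Spaces.linear scale (*) f" "\<And>x. x \<in> span S \<Longrightarrow> f x = 0" "f v = 1"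
proof -
  interpret k: vector_space "(*) :: 'a \<Rightarrow> 'a \<Rightarrow> 'a" by (rule vector_space_field)
  interpret vector_space_pair scale "(*) :: 'a \<Rightarrow> 'a \<Rightarrow> 'a" by unfold_locales
  obtain B where B: "B \<subseteq> S" "independent B" "S \<subseteq> span B"
    using maximal_independent_subset by blast
  have sp: "span B = span S"
    by (meson B(1,3) span_minimal span_mono subset_antisym subspace_span)
  have v: "v \<notin> span B" using assms sp by simp
  have ind: "independent (insert v B)"
    using independent_insertI[OF v B(2)] .
  obtain g where g: "Vector_Spaces.linear scale (*) g"
      "\<forall>x\<in>insert v B. g x = (if x = v then 1 else 0)"
    using linear_independent_extend[OF ind, of "\<lambda>x. if x = v then 1 else 0"] by blast
  interpret g: Vector_Spaces.linear scale "(*)" g by (rule g(1))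
  have "v \<notin> B" using v span_base by blast
  then have "\<And>x. x \<in> B \<Longrightarrow> g x = 0" using g(2) by auto
  then have "\<And>x. x \<in> span B \<Longrightarrow> g x = 0" using g.eq_0_on_span by blast
  then show thesis using that g sp by simp
qed

text \<open>
  This replaces rank-nullity: a basis of \<open>M\<close> can be chosen through the kernel vector \<open>c\<close>, and then
  \<open>T\<close> maps the remaining basis vectors to a spanning set of \<open>T ` M\<close> that is too small to span \<open>M\<close>.
\<close>

lemma noninjective_not_onto:
  assumes M: "subspace M" "M \<subseteq> span B" "finite B"
    and T: "\<And>x y. T (x + y) = T x + T y" "\<And>a x. T (scale a x) = scale a (T x)"
    and c: "c \<in> M" "c \<noteq> 0" "T c = 0"
  shows "T ` M \<noteq> M"
proof
  assume eq: "T ` M = M"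
  interpret T: Vector_Spaces.linear scale scale T
    by unfold_locales (simp_all add: T)
  have "independent {c}" using c by simp
  then obtain E where E: "{c} \<subseteq> E" "E \<subseteq> M" "independent E" "M \<subseteq> span E"
    using maximal_independent_subset_extend[of "{c}" M] c by auto
  have fin: "finite E" using independent_span_bound[OF M(3) E(3)] E(2) M(2) by auto
  have "E = insert c (E - {c})" using E by auto
  then have "T ` E = insert 0 (T ` (E - {c}))" using c by (metis image_insert)
  then have "span (T ` E) = span (T ` (E - {c}))" by simp
  moreover have "E \<subseteq> T ` span E" using eq E by blast
  then have "E \<subseteq> span (T ` E)" using T.span_image by metis
  ultimately have "card E \<le> card (T ` (E - {c}))"
    using independent_span_bound[of "T ` (E - {c})" E] fin E(3) by auto
  also have "\<dots> \<le> card (E - {c})" using fin by (intro card_image_le) auto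
  also have "\<dots> < card E" using fin E(1) by (intro psubset_card_mono) auto
  finally show False by simp
qed

lemma dim_less_of_proper_subspace:
  assumes "subspace M" "subspace N" "M \<subset> N" "N \<subseteq> span B" "finite B"
  shows "dim M < dim N"
proof -
  obtain E where E: "E \<subseteq> M" "independent E" "M \<subseteq> span E"
    using maximal_independent_subset by blast
  obtain m where m: "m \<in> N" "m \<notin> M" using assms by blast
  have "span E = M" using span_subspace[OF E(1,3) assms(1)] .
  then have ind: "independent (insert m E)" using independent_insertI E m by simp
  have "insert m E \<subseteq> N" using E m assms(3) by auto
  then obtain F where F: "insert m E \<subseteq> F" "F \<subseteq> N" "independent F" "N \<subseteq> span F"
    using ind by (rule maximal_independent_subset_extend)
  have fin: "finite F" using independent_span_bound[OF assms(5) F(3)] F(2) assms(4) by auto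
  have "m \<notin> E" using m E by auto
  have "dim M = card E" using basis_card_eq_dim[OF E(1,3,2)] by simp
  also have "\<dots> < card F" using F fin \<open>m \<notin> E\<close> by (intro psubset_card_mono) auto
  also have "card F = dim N" using basis_card_eq_dim[OF F(2,4,3)] .
  finally show ?thesis .
qed

end

section \<open>Two-sided multiplications in a central division algebra\<close>

context findim_central_division_algebra
begin

lemma finite_basis_exists:
  obtains B where "finite B" "independent B" "span B = UNIV"
proof -
  obtain B0 where B0: "finite B0" "span B0 = UNIV" using finite_dimensional by blast
  obtain B where B: "B \<subseteq> B0" "independent B" "B0 \<subseteq> span B"
    using maximal_independent_subset by blast
  have "span B0 \<subseteq> span B" using span_minimal[OF B(3) subspace_span] .
  then have "span B = UNIV" using B0 by auto
  then show thesis using that[of B] B B0 finite_subset[of B B0] by simp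
qed

text \<open>
  The tensor product of \<open>D\<close> with its opposite algebra acts faithfully on \<open>D\<close>. In a shortest nontrivial
  relation normalise one coefficient to \<open>1\<close>; its commutator with any \<open>a\<close> is a shorter relation,
  so all coefficients are central, hence scalars, and \<open>x = 1\<close> contradicts the independence of \<open>F\<close>.
\<close>

lemma two_sided_independence:
  assumes "finite F" "independent F" "\<And>x. (\<Sum>u\<in>F. u * x * w u) = 0" "u \<in> F"
  shows "w u = 0"
  using assms
proof (induction F arbitrary: w u rule: finite_induct)
  case empty
  then show ?case by simp
next
  case (insert u0 F)
  have indF: "independent F" using insert.prems(1) independent_mono by blast
  show ?case
  proof (cases "w u0 = 0")
    case True
    then have "(\<Sum>u\<in>F. u * x * w u) = 0" for x
      using insert.prems(2)[of x] insert.hyps by simp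
    then show ?thesis using insert.IH[OF indF] True insert.prems(3) by blast
  next
    case False
    define v where "v u = w u * inverse (w u0)" for u
    have v0: "v u0 = 1" using False by (simp add: v_def)
    have sv: "(\<Sum>u\<in>insert u0 F. u * x * v u) = 0" for x
    proof -
      have "(\<Sum>u\<in>insert u0 F. u * x * v u) = (\<Sum>u\<in>insert u0 F. u * x * w u) * inverse (w u0)"
        by (simp add: v_def sum_distrib_right mult.assoc)
      then show ?thesis using insert.prems(2) by simp
    qed
    have comm: "a * v u = v u * a" if "u \<in> F" for a u
    proof -
      have "(\<Sum>u\<in>F. u * x * (a * v u - v u * a)) = 0" for x
      proof -
        have "(\<Sum>u\<in>F. u * x * (a * v u - v u * a))
            = (\<Sum>u\<in>insert u0 F. u * x * (a * v u - v u * a))"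
          using insert.hyps v0 by simp
        also have "\<dots> = (\<Sum>u\<in>insert u0 F. u * (x * a) * v u) - (\<Sum>u\<in>insert u0 F. u * x * v u) * a"
          unfolding sum_distrib_right sum_subtractf[symmetric]
          by (rule sum.cong) (auto simp: algebra_simps)
        finally show ?thesis using sv by simp
      qed
      from insert.IH[OF indF this that] show ?thesis by simp
    qed
    have "\<exists>r. v u = scale r 1" if "u \<in> insert u0 F" for u
    proof -
      have "v u * a = a * v u" for a using that comm v0 by auto
      then have "v u \<in> range (\<lambda>r. scale r 1)" using central by auto
      then show ?thesis by auto
    qed
    then obtain r where r: "\<And>u. u \<in> insert u0 F \<Longrightarrow> v u = scale (r u) 1" by metis
    have "(\<Sum>u\<in>insert u0 F. scale (r u) u) = (\<Sum>u\<in>insert u0 F. u * 1 * v u)"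
      using r by (intro sum.cong) (auto simp: scale_mult_right)
    then have "(\<Sum>u\<in>insert u0 F. scale (r u) u) = 0" using sv[of 1] by simp
    then have "r u0 = 0"
      using independentD[OF insert.prems(1), of "insert u0 F" r u0] insert.hyps by simp
    then show ?thesis using r[of u0] v0 by simp
  qed
qed

text \<open>
  Rewriting a tensor with its left factors in a basis \<open>B\<close>: a balanced biadditive map \<open>\<gamma>\<close> is the same
  thing as an additive map on the tensor product over the scalars.
\<close>

lemma balanced_sum_expand:
  fixes \<gamma> :: "'d \<Rightarrow> 'd \<Rightarrow> 'w::ab_group_add"
  assumes add_left: "\<And>a a' c. \<gamma> (a + a') c = \<gamma> a c + \<gamma> a' c"
    and add_right: "\<And>a c c'. \<gamma> a (c + c') = \<gamma> a c + \<gamma> a c'"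
    and balanced: "\<And>r a c. \<gamma> (scale r a) c = \<gamma> a (scale r c)"
    and B: "finite B" "independent B" "span B = UNIV"
  shows "(\<Sum>i\<in>I. \<gamma> (a i) (c i)) = (\<Sum>u\<in>B. \<gamma> u (\<Sum>i\<in>I. scale (representation B (a i) u) (c i)))"
proof -
  have sum_left: "\<gamma> (sum g X) e = (\<Sum>x\<in>X. \<gamma> (g x) e)" for g :: "'d \<Rightarrow> 'd" and X e
    using additive.sum[of "\<lambda>z. \<gamma> z e"] add_left by (simp add: additive_def)
  have sum_right: "\<gamma> e (sum g X) = (\<Sum>x\<in>X. \<gamma> e (g x))" for g :: "'e \<Rightarrow> 'd" and X e
    using additive.sum[of "\<lambda>z. \<gamma> e z"] add_right by (simp add: additive_def)
  have rep: "\<gamma> (a i) (c i) = (\<Sum>u\<in>B. \<gamma> u (scale (representation B (a i) u) (c i)))" for i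
  proof -
    have "a i = (\<Sum>u\<in>B. scale (representation B (a i) u) u)"
      using sum_representation_eq[OF B(2), of "a i" B] B by simp
    then have "\<gamma> (a i) (c i) = \<gamma> (\<Sum>u\<in>B. scale (representation B (a i) u) u) (c i)" by simp
    then show ?thesis unfolding sum_left balanced .
  qed
  show ?thesis unfolding sum_right rep by (rule sum.swap)
qed

text \<open>
  Faithfulness in the form in which it is used: an identity between two-sided multiplications of
  \<open>D\<close> lifts to the tensor product and so holds under every balanced map, in particular in every
  \<open>D\<close>-bimodule.
\<close>

lemma balanced_sum_eqI:
  fixes \<beta> :: "'d \<Rightarrow> 'd \<Rightarrow> 'w::ab_group_add"
  assumes add_left: "\<And>a a' c. \<beta> (a + a') c = \<beta> a c + \<beta> a' c"
    and add_right: "\<And>a c c'. \<beta> a (c + c') = \<beta> a c + \<beta> a c'"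
    and balanced: "\<And>r a c. \<beta> (scale r a) c = \<beta> a (scale r c)"
    and eq: "\<And>x. (\<Sum>i\<in>I. a i * x * c i) = (\<Sum>i\<in>I'. a' i * x * c' i)"
  shows "(\<Sum>i\<in>I. \<beta> (a i) (c i)) = (\<Sum>i\<in>I'. \<beta> (a' i) (c' i))"
proof -
  obtain B where B: "finite B" "independent B" "span B = UNIV" by (rule finite_basis_exists)
  define v where "v u = (\<Sum>i\<in>I. scale (representation B (a i) u) (c i))" for u
  define v' where "v' u = (\<Sum>i\<in>I'. scale (representation B (a' i) u) (c' i))" for u
  have "v u - v' u = 0" if "u \<in> B" for u
  proof (rule two_sided_independence[OF B(1,2) _ that])
    fix x
    have "(\<Sum>u\<in>B. u * x * (v u - v' u)) = (\<Sum>u\<in>B. u * x * v u) - (\<Sum>u\<in>B. u * x * v' u)"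
      by (simp add: right_diff_distrib sum_subtractf)
    also have "(\<Sum>u\<in>B. u * x * v u) = (\<Sum>i\<in>I. a i * x * c i)"
      unfolding v_def by (rule balanced_sum_expand[of "\<lambda>a c. a * x * c", symmetric, OF _ _ _ B])
        (auto simp: algebra_simps scale_mult_left scale_mult_right)
    also have "(\<Sum>u\<in>B. u * x * v' u) = (\<Sum>i\<in>I'. a' i * x * c' i)"
      unfolding v'_def by (rule balanced_sum_expand[of "\<lambda>a c. a * x * c", symmetric, OF _ _ _ B])
        (auto simp: algebra_simps scale_mult_left scale_mult_right)
    finally show "(\<Sum>u\<in>B. u * x * (v u - v' u)) = 0" using eq by simp
  qed
  then have "\<And>u. u \<in> B \<Longrightarrow> v u = v' u" by simp
  moreover have "(\<Sum>i\<in>I. \<beta> (a i) (c i)) = (\<Sum>u\<in>B. \<beta> u (v u))"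
    unfolding v_def by (rule balanced_sum_expand[OF add_left add_right balanced B])
  moreover have "(\<Sum>i\<in>I'. \<beta> (a' i) (c' i)) = (\<Sum>u\<in>B. \<beta> u (v' u))"
    unfolding v'_def by (rule balanced_sum_expand[OF add_left add_right balanced B])
  ultimately show ?thesis by simp
qed

text \<open>
  The maps \<open>x \<mapsto> u * x * v\<close> for basis elements \<open>u\<close>, \<open>v\<close> are independent, and their number
  is the dimension of the space of all linear maps \<open>D \<rightarrow> D\<close>. Hence they span it, and every linear map
  is a sum of two-sided multiplications; the map needed here is \<open>x \<mapsto> \<mu>(x) 1\<close>.
\<close>

lemma functional_as_two_sided_multiplications:
  assumes B: "finite B" "independent B" "span B = UNIV"
    and lin: "Vector_Spaces.linear scale (*) \<mu>"
  obtains b where "\<And>x. (\<Sum>u\<in>B. u * x * b u) = scale (\<mu> x) 1"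
proof -
  define fs where "fs = (\<lambda>r (f :: 'd \<Rightarrow> 'd) x. scale r (f x))"
  interpret F: vector_space fs
    unfolding fs_def by (rule vector_space_fun) (rule vector_space_axioms)
  \<comment> \<open>The family \<open>h\<close> consists of the two-sided multiplications, and \<open>t\<close> of the matrix units for \<open>B\<close>.\<close>
  define h where "h = (\<lambda>(u, v) (x :: 'd). u * x * v)"
  define t where "t = (\<lambda>(i, v) (x :: 'd). scale (representation B x i) v)"
  have rep: "(\<Sum>u\<in>B. scale (representation B x u) u) = x" for x
    using sum_representation_eq[OF B(2), of x B] B by simp
  have B0: "0 \<notin> B" using B(2) dependent_zero by blast
  have sum_fun: "(\<Sum>p\<in>A. fs (c p) (g p)) x = (\<Sum>p\<in>A. scale (c p) (g p x))"
    for A :: "'e set" and c g x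
    by (induction A rule: infinite_finite_induct) (auto simp: fs_def)
  have ht: "f \<in> F.span (t ` (B \<times> B))" if f: "Vector_Spaces.linear scale scale f" for f
  proof -
    interpret f: Vector_Spaces.linear scale scale f by (rule f)
    have "f = (\<Sum>p\<in>B \<times> B. fs (representation B (f (fst p)) (snd p)) (t p))"
    proof
      fix x
      have "f x = f (\<Sum>i\<in>B. scale (representation B x i) i)" by (simp add: rep)
      also have "\<dots> = (\<Sum>i\<in>B. scale (representation B x i) (f i))"
        by (simp only: f.sum f.scale)
      also have "\<dots> = (\<Sum>i\<in>B. scale (representation B x i) (\<Sum>v\<in>B. scale (representation B (f i) v) v))"
        by (simp only: rep)
      also have "\<dots> = (\<Sum>p\<in>B \<times> B. scale (representation B (f (fst p)) (snd p))
                         (scale (representation B x (fst p)) (snd p)))"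
        by (simp add: scale_sum_right sum.cartesian_product split_def mult.commute)
      finally show "f x = (\<Sum>p\<in>B \<times> B. fs (representation B (f (fst p)) (snd p)) (t p)) x"
        by (simp add: sum_fun t_def split_def)
    qed
    also have "\<dots> \<in> F.span (t ` (B \<times> B))"
      by (intro F.span_sum F.span_scale F.span_base) auto
    finally show ?thesis .
  qed
  have inj: "inj_on h (B \<times> B)"
  proof (rule inj_onI, clarify)
    fix u v u' v'
    assume uv: "u \<in> B" "v \<in> B" "u' \<in> B" "v' \<in> B" and eq: "h (u, v) = h (u', v')"
    have e: "u * x * v = u' * x * v'" for x using fun_cong[OF eq, of x] by (simp add: h_def)
    have "u = u'"
    proof (rule ccontr)
      assume ne: "u \<noteq> u'"
      have "independent {u, u'}" using independent_mono[OF B(2), of "{u, u'}"] uv by simp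
      from two_sided_independence[OF _ this, of "\<lambda>i. if i = u then v else - v'" u] e ne
      show False using uv B0 by auto
    qed
    moreover have "v = v'" using e[of 1] \<open>u = u'\<close> uv B0 by auto
    ultimately show "(u = u') \<and> (v = v')" by simp
  qed
  have indep: "F.independent (h ` (B \<times> B))"
  proof (rule F.independent_if_scalars_zero)
    show "finite (h ` (B \<times> B))" using B by simp
    fix c g assume z: "(\<Sum>f\<in>h ` (B \<times> B). fs (c f) f) = 0" and g: "g \<in> h ` (B \<times> B)"
    obtain u v where uv: "u \<in> B" "v \<in> B" "g = h (u, v)" using g by auto
    have "(\<Sum>u\<in>B. u * x * (\<Sum>v\<in>B. scale (c (h (u, v))) v)) = 0" for x
    proof -
      have "(\<Sum>u\<in>B. u * x * (\<Sum>v\<in>B. scale (c (h (u, v))) v))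
          = (\<Sum>p\<in>B \<times> B. scale (c (h p)) (h p x))"
        by (simp add: sum_distrib_left sum.cartesian_product split_def h_def scale_mult_right)
      also have "\<dots> = (\<Sum>p\<in>B \<times> B. fs (c (h p)) (h p)) x" by (simp add: sum_fun)
      also have "(\<Sum>p\<in>B \<times> B. fs (c (h p)) (h p)) = (\<Sum>f\<in>h ` (B \<times> B). fs (c f) f)"
        by (simp add: sum.reindex[OF inj])
      finally show ?thesis using z by simp
    qed
    from two_sided_independence[OF B(1,2) this uv(1)]
    have "(\<Sum>v\<in>B. scale (c (h (u, v))) v) = 0" .
    then show "c g = 0"
      using independentD[OF B(2,1), of "\<lambda>v. c (h (u, v))" v] uv by simp
  qed
  define g where "g x = scale (\<mu> x) (1 :: 'd)" for x
  interpret lam: Vector_Spaces.linear scale "(*)" \<mu> by (rule lin)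
  have ling: "Vector_Spaces.linear scale scale g"
    by unfold_locales (simp_all add: g_def lam.add lam.scale scale_left_distrib scale_right_distrib)
  have "g \<in> F.span (h ` (B \<times> B))"
  proof (rule ccontr)
    assume no: "g \<notin> F.span (h ` (B \<times> B))"
    then have ind: "F.independent (insert g (h ` (B \<times> B)))"
      using F.independent_insertI indep by blast
    have "h p \<in> F.span (t ` (B \<times> B))" for p
      by (rule ht, cases p, unfold_locales)
        (simp_all add: h_def algebra_simps scale_mult_left scale_mult_right
          scale_left_distrib scale_right_distrib)
    then have "insert g (h ` (B \<times> B)) \<subseteq> F.span (t ` (B \<times> B))" using ht[OF ling] by auto
    from F.independent_span_bound[OF _ ind this] B
    have "card (insert g (h ` (B \<times> B))) \<le> card (t ` (B \<times> B))" by simp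
    also have "\<dots> \<le> card (B \<times> B)" using B by (intro card_image_le) auto
    also have "\<dots> = card (h ` (B \<times> B))" by (simp add: card_image[OF inj])
    also have "\<dots> < card (insert g (h ` (B \<times> B)))"
      using no B F.span_base by (subst card_insert_disjoint) auto
    finally show False by simp
  qed
  then obtain c where c: "g = (\<Sum>f\<in>h ` (B \<times> B). fs (c f) f)"
    using F.span_finite[of "h ` (B \<times> B)"] B by auto
  show thesis
  proof
    fix x
    have "(\<Sum>u\<in>B. u * x * (\<Sum>v\<in>B. scale (c (h (u, v))) v))
        = (\<Sum>p\<in>B \<times> B. scale (c (h p)) (h p x))"
      by (simp add: sum_distrib_left sum.cartesian_product split_def h_def scale_mult_right)
    also have "\<dots> = (\<Sum>p\<in>B \<times> B. fs (c (h p)) (h p)) x" by (simp add: sum_fun)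
    also have "\<dots> = g x" by (simp add: c sum.reindex[OF inj])
    finally show "(\<Sum>u\<in>B. u * x * (\<Sum>v\<in>B. scale (c (h (u, v))) v)) = scale (\<mu> x) 1"
      by (simp add: g_def)
  qed
qed

text \<open>
  A tensor whose two-sided multiplication has scalar values commutes with \<open>D\<close>: multiplying it by
  \<open>a\<close> on the outer left or on the outer right gives the same multiplication map.
\<close>

lemma two_sided_multiplication_balanced:
  fixes \<beta> :: "'d \<Rightarrow> 'd \<Rightarrow> 'w::ab_group_add"
  assumes "\<And>a a' c. \<beta> (a + a') c = \<beta> a c + \<beta> a' c"
    and "\<And>a c c'. \<beta> a (c + c') = \<beta> a c + \<beta> a c'"
    and "\<And>r a c. \<beta> (scale r a) c = \<beta> a (scale r c)"
    and scalar: "\<And>x. (\<Sum>u\<in>B. u * x * b u) = scale (\<mu> x) 1"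
  shows "(\<Sum>u\<in>B. \<beta> (a * u) (b u)) = (\<Sum>u\<in>B. \<beta> u (b u * a))"
proof (rule balanced_sum_eqI[OF assms(1-3)])
  fix x
  have "(\<Sum>u\<in>B. a * u * x * b u) = a * (\<Sum>u\<in>B. u * x * b u)"
    by (simp add: sum_distrib_left mult.assoc)
  also have "\<dots> = (\<Sum>u\<in>B. u * x * b u) * a"
    by (simp add: scalar scale_mult_left scale_mult_right)
  finally show "(\<Sum>u\<in>B. a * u * x * b u) = (\<Sum>u\<in>B. u * x * (b u * a))"
    by (simp add: sum_distrib_right mult.assoc)
qed

text \<open>
  For a functional with \<open>\<mu> 1 = 1\<close> the tensor that represents \<open>x \<mapsto> \<mu>(x) 1\<close> is a separability
  idempotent. Centrality of \<open>D\<close> thus gives separability, also over an imperfect field.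
\<close>

lemma separability_idempotent:
  obtains B b \<mu> where "(\<Sum>u\<in>B. u * b u) = 1" "\<And>x. (\<Sum>u\<in>B. u * x * b u) = scale (\<mu> x) 1"
proof -
  obtain B where B: "finite B" "independent B" "span B = UNIV" by (rule finite_basis_exists)
  have "1 \<notin> span {}" by simp
  then obtain \<mu> where \<mu>: "Vector_Spaces.linear scale (*) \<mu>" "\<mu> 1 = 1"
    by (rule separating_functional) blast
  obtain b where b: "\<And>x. (\<Sum>u\<in>B. u * x * b u) = scale (\<mu> x) 1"
    using functional_as_two_sided_multiplications[OF B \<mu>(1)] by blast
  show thesis using that[of b B \<mu>] b b[of 1] \<mu>(2) by simp
qed

end

section \<open>Rings of additive operators\<close>

text \<open>
  The convolution algebra of a coalgebra depends on the coalgebra and cannot be made a type. It acts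
  faithfully on the coalgebra, and so it will be a subset of the ring of additive endomorphisms
  of the ambient group; ring identities can then be used in their type class form.
\<close>

typedef (overloaded) 'a endo = "{f :: 'a::ab_group_add \<Rightarrow> 'a. \<forall>x y. f (x + y) = f x + f y}"
  morphisms ap Endo
  by (rule exI[of _ id]) simp

lemma ap_Endo: "(\<And>x y. f (x + y) = f x + f y) \<Longrightarrow> ap (Endo f) = f"
  by (rule Endo_inverse) simp

lemma ap_add [simp]: "ap r (x + y) = ap r x + ap r y"
  using ap[of r] by simp

lemma ap_zero [simp]: "ap r 0 = 0"
  using ap_add[of r 0 0] by simp

lemma ap_uminus [simp]: "ap r (- x) = - ap r x"
  using ap_add[of r x "- x"] by (simp add: eq_neg_iff_add_eq_0 add.commute)

lemma ap_diff [simp]: "ap r (x - y) = ap r x - ap r y"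
  using ap_add[of r x "- y"] by simp

lemma ap_sum: "ap r (sum g A) = (\<Sum>i\<in>A. ap r (g i))"
  by (induction A rule: infinite_finite_induct) auto

lemma endo_eqI: "(\<And>x. ap r x = ap r' x) \<Longrightarrow> r = r'"
  by (metis ap_inject ext)

instantiation endo :: (ab_group_add) "{ring, monoid_mult}"
begin

definition "0 = Endo (\<lambda>x. 0)"
definition "1 = Endo (\<lambda>x. x)"
definition "r + r' = Endo (\<lambda>x. ap r x + ap r' x)"
definition "- r = Endo (\<lambda>x. - ap r x)"
definition "r - r' = Endo (\<lambda>x. ap r x - ap r' x)"
definition "r * r' = Endo (\<lambda>x. ap r (ap r' x))"

lemma endo_ap [simp]:
  "ap 0 x = 0" "ap 1 x = x" "ap (r + r') x = ap r x + ap r' x" "ap (- r) x = - ap r x"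
  "ap (r - r') x = ap r x - ap r' x" "ap (r * r') x = ap r (ap r' x)"
  by (simp_all add: zero_endo_def one_endo_def plus_endo_def uminus_endo_def minus_endo_def
      times_endo_def ap_Endo algebra_simps)

instance
  by standard (rule endo_eqI, simp add: algebra_simps)+

end

lemma ap_sum_left: "ap (sum r A) x = (\<Sum>i\<in>A. ap (r i) x)"
  by (induction A rule: infinite_finite_induct) auto

text \<open>
  One Newton step for the equation \<open>s(a) s(c) = s(a c)\<close>. The defect \<open>f\<close> is a Hochschild 2-cocycle up to
  terms that are quadratic in \<open>f\<close>, and \<open>h\<close> is the primitive of \<open>f\<close> that the separability idempotent
  \<open>\<Sum>u\<in>B. u \<otimes> b u\<close> supplies. So the defect of the corrected map \<open>s - h\<close> is a sum of products of
  two terms each of which lies in the ideal generated by the values of \<open>f\<close>.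
\<close>

lemma newton_defect:
  fixes s :: "'d::ring_1 \<Rightarrow> 'r::ring"
  assumes add: "\<And>a c. s (a + c) = s a + s c"
    and one: "\<And>a. s 1 * s a = s a"
    and unit: "(\<Sum>u\<in>B. u * b u) = 1"
    and f: "\<And>a c. f a c = s a * s c - s (a * c)"
    and balanced: "\<And>a c. (\<Sum>u\<in>B. s (a * u) * f (b u) c) = (\<Sum>u\<in>B. s u * f (b u * a) c)"
    and h: "\<And>a. h a = (\<Sum>u\<in>B. s u * f (b u) a)"
  shows "(s a - h a) * (s c - h c) - (s (a * c) - h (a * c)) =
    h a * h c - (\<Sum>u\<in>B. f a u * f (b u) c) - (\<Sum>u\<in>B. f u (b u) * f a c)"
proof -
  have s_sum: "s (sum g A) = (\<Sum>u\<in>A. s (g u))" for g :: "'d \<Rightarrow> 'd" and A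
    using additive.sum[of s] add by (simp add: additive_def)
  have "s a * h c = (\<Sum>u\<in>B. f a u * f (b u) c) + (\<Sum>u\<in>B. s (a * u) * f (b u) c)"
    unfolding h sum_distrib_left sum.distrib[symmetric]
    by (rule sum.cong) (simp_all add: f algebra_simps)
  moreover have "h a * s c - h (a * c) = (\<Sum>u\<in>B. f u (b u) * f a c)
      + (\<Sum>u\<in>B. s (u * b u) * f a c) - (\<Sum>u\<in>B. s u * f (b u * a) c)"
    unfolding h sum_distrib_right sum.distrib[symmetric] sum_subtractf[symmetric]
    by (rule sum.cong) (simp_all add: f algebra_simps)
  moreover have "(\<Sum>u\<in>B. s (u * b u) * f a c) = f a c"
  proof -
    have "(\<Sum>u\<in>B. s (u * b u) * f a c) = s 1 * f a c"
      by (simp add: sum_distrib_right[symmetric] s_sum[symmetric] unit)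
    then show ?thesis by (simp add: f right_diff_distrib one mult.assoc[symmetric])
  qed
  ultimately have "s a * h c + (h a * s c - h (a * c)) =
      (\<Sum>u\<in>B. f a u * f (b u) c) + (\<Sum>u\<in>B. f u (b u) * f a c) + f a c"
    using balanced by simp
  moreover have "(s a - h a) * (s c - h c) - (s (a * c) - h (a * c)) =
      f a c - (s a * h c + (h a * s c - h (a * c))) + h a * h c"
    by (simp add: f algebra_simps)
  ultimately show ?thesis by simp
qed

lemma power_commute:
  fixes x z :: "'r::monoid_mult"
  assumes "z * x = x * z" shows "z * x ^ n = x ^ n * z"
  using assms by (induction n) (simp_all, metis mult.assoc)

section \<open>Operator algebras with linearly ordered submodules\<close>

definition homothety :: "('k \<Rightarrow> 'c::ab_group_add \<Rightarrow> 'c) \<Rightarrow> 'k \<Rightarrow> 'c endo" where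
  "homothety s a = Endo (s a)"

lemma (in vector_space) ap_homothety: "ap (homothety scale a) c = scale a c"
  unfolding homothety_def by (subst ap_Endo) (simp_all add: scale_right_distrib)

definition operator_submodule ::
    "('k::field \<Rightarrow> 'c::ab_group_add \<Rightarrow> 'c) \<Rightarrow> 'c set \<Rightarrow> 'c endo set \<Rightarrow> 'c set \<Rightarrow> bool" where
  "operator_submodule s V R N \<longleftrightarrow>
     module.subspace s N \<and> N \<subseteq> V \<and> (\<forall>r\<in>R. \<forall>c\<in>N. ap r c \<in> N)"

text \<open>
  An abstraction of the left action of a convolution algebra on a coalgebra \<open>V\<close>: \<open>R\<close> is the
  image of the convolution algebra, \<open>eps\<close> is the counit, and \<open>r \<mapsto> eps (ap r -)\<close> identifies \<open>R\<close> with
  the space of functionals on \<open>V\<close>. The operators live on the ambient group, where they and \<open>eps\<close>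
  factor through a projection onto \<open>V\<close>; this is why the identity \<open>e\<close> of \<open>R\<close> differs from the
  identity operator, and why \<open>eps\<close> is linear on the whole ambient space.
\<close>

locale chain_operators = vector_space s
  for s :: "'k::field \<Rightarrow> 'c::ab_group_add \<Rightarrow> 'c" +
  fixes V :: "'c set" and R :: "'c endo set" and e :: "'c endo" and eps :: "'c \<Rightarrow> 'k"
  assumes V: "subspace V"
    and R_add: "r \<in> R \<Longrightarrow> r' \<in> R \<Longrightarrow> r + r' \<in> R"
    and R_mult: "r \<in> R \<Longrightarrow> r' \<in> R \<Longrightarrow> r * r' \<in> R"
    and R_scale: "r \<in> R \<Longrightarrow> homothety s a * r \<in> R"
    and R_commute: "r \<in> R \<Longrightarrow> r * homothety s a = homothety s a * r"
    and e: "e \<in> R" "r \<in> R \<Longrightarrow> e * r = r" "r \<in> R \<Longrightarrow> r * e = r" "c \<in> V \<Longrightarrow> ap e c = c"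
    and R_into: "r \<in> R \<Longrightarrow> ap r c \<in> V"
    and eps: "Vector_Spaces.linear s (*) eps"
    and functional: "Vector_Spaces.linear s (*) g \<Longrightarrow> \<exists>r\<in>R. \<forall>c\<in>V. eps (ap r c) = g c"
    and finitely_determined: "c \<in> V \<Longrightarrow>
      \<exists>F. finite F \<and> F \<subseteq> V \<and> (\<forall>r\<in>R. (\<forall>u\<in>F. eps (ap r u) = 0) \<longrightarrow> ap r c = 0)"
    and locally_finite: "c \<in> V \<Longrightarrow> \<exists>B. finite B \<and> (\<forall>r\<in>R. ap r c \<in> span B)"
    and chain: "operator_submodule s V R M \<Longrightarrow> operator_submodule s V R N \<Longrightarrow> M \<subseteq> N \<or> N \<subseteq> M"
begin

lemma ap_scale: "r \<in> R \<Longrightarrow> ap r (s a c) = s a (ap r c)"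
  using R_commute[of r a] by (metis ap_homothety endo_ap(6))

lemma R_uminus: "r \<in> R \<Longrightarrow> - r \<in> R"
proof -
  assume r: "r \<in> R"
  have "homothety s (- 1) * r = - r" by (rule endo_eqI) (simp add: ap_homothety)
  then show ?thesis using R_scale[OF r, of "-1"] by simp
qed

lemma R_diff: "r \<in> R \<Longrightarrow> r' \<in> R \<Longrightarrow> r - r' \<in> R"
  using R_add[OF _ R_uminus, of r r'] by simp

lemma R_zero: "0 \<in> R"
  using R_diff[OF e(1) e(1)] by simp

lemma R_sum: "(\<And>i. i \<in> A \<Longrightarrow> g i \<in> R) \<Longrightarrow> sum g A \<in> R"
  by (induction A rule: infinite_finite_induct) (auto intro: R_add R_zero)

lemma R_power: "r \<in> R \<Longrightarrow> g \<in> R \<Longrightarrow> r ^ n * g \<in> R"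
  by (induction n) (auto intro: R_mult simp: mult.assoc)

lemma R_power_right: "r \<in> R \<Longrightarrow> g \<in> R \<Longrightarrow> g * r ^ n \<in> R"
  by (induction n arbitrary: g) (auto intro: R_mult simp: mult.assoc[symmetric])

lemma R_eqI:
  assumes "r \<in> R" "r' \<in> R" "\<And>c. c \<in> V \<Longrightarrow> ap r c = ap r' c"
  shows "r = r'"
proof (rule endo_eqI)
  fix x
  have "ap r (ap e x) = ap r' (ap e x)" using assms(3) R_into e(1) by blast
  then show "ap r x = ap r' x"
    using e(3)[OF assms(1)] e(3)[OF assms(2)] endo_ap(6) by metis
qed

sublocale eps: Vector_Spaces.linear s "(*)" eps by (rule eps)

abbreviation "submod \<equiv> operator_submodule s V R"

lemma submod_ap: "submod M \<Longrightarrow> r \<in> R \<Longrightarrow> c \<in> M \<Longrightarrow> ap r c \<in> M"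
  by (simp add: operator_submodule_def)

lemma submod_cyclic:
  assumes "c \<in> V" shows "submod ((\<lambda>r. ap r c) ` R)"
  unfolding operator_submodule_def
proof (intro conjI ballI)
  show "subspace ((\<lambda>r. ap r c) ` R)"
  proof (rule subspaceI)
    show "0 \<in> (\<lambda>r. ap r c) ` R" using R_zero by (force intro: image_eqI[of _ _ 0])
  next
    fix x y assume "x \<in> (\<lambda>r. ap r c) ` R" "y \<in> (\<lambda>r. ap r c) ` R"
    then obtain r r' where "x = ap r c" "y = ap r' c" "r \<in> R" "r' \<in> R" by auto
    then show "x + y \<in> (\<lambda>r. ap r c) ` R" using R_add by (intro image_eqI[of _ _ "r + r'"]) auto
  next
    fix a x assume "x \<in> (\<lambda>r. ap r c) ` R"
    then obtain r where "x = ap r c" "r \<in> R" by auto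
    then show "s a x \<in> (\<lambda>r. ap r c) ` R"
      using R_scale by (intro image_eqI[of _ _ "homothety s a * r"]) (auto simp: ap_homothety)
  qed
  show "(\<lambda>r. ap r c) ` R \<subseteq> V" using R_into by auto
  fix r x assume "r \<in> R" "x \<in> (\<lambda>r. ap r c) ` R"
  then obtain r' where "x = ap r' c" "r' \<in> R" by auto
  then show "ap r x \<in> (\<lambda>r. ap r c) ` R"
    using R_mult \<open>r \<in> R\<close> by (intro image_eqI[of _ _ "r * r'"]) auto
qed

lemma self_in_cyclic: "c \<in> V \<Longrightarrow> c \<in> (\<lambda>r. ap r c) ` R"
  using e by (intro image_eqI[of _ _ e]) auto

text \<open>
  The largest submodule on which the functional \<open>eps (ap x -)\<close> vanishes, that is, the orthogonal
  complement of the right ideal generated by \<open>x\<close>.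
\<close>

definition max_kernel where "max_kernel x = {c \<in> V. \<forall>g\<in>R. eps (ap (x * g) c) = 0}"

lemma submod_max_kernel: "x \<in> R \<Longrightarrow> submod (max_kernel x)"
  unfolding operator_submodule_def max_kernel_def
proof (intro conjI ballI)
  assume x: "x \<in> R"
  show "subspace {c \<in> V. \<forall>g\<in>R. eps (ap (x * g) c) = 0}"
  proof (rule subspaceI)
    fix a c assume "c \<in> {c \<in> V. \<forall>g\<in>R. eps (ap (x * g) c) = 0}"
    then show "s a c \<in> {c \<in> V. \<forall>g\<in>R. eps (ap (x * g) c) = 0}"
      using subspace_scale[OF V] ap_scale x by (simp add: eps.scale)
  qed (use subspace_0[OF V] subspace_add[OF V] in \<open>simp_all add: eps.add eps.zero\<close>)
  show "{c \<in> V. \<forall>g\<in>R. eps (ap (x * g) c) = 0} \<subseteq> V" by auto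
  fix r c assume r: "r \<in> R" and c: "c \<in> {c \<in> V. \<forall>g\<in>R. eps (ap (x * g) c) = 0}"
  have "eps (ap (x * g) (ap r c)) = 0" if "g \<in> R" for g
    using c R_mult[OF that r] by auto
  then show "ap r c \<in> {c \<in> V. \<forall>g\<in>R. eps (ap (x * g) c) = 0}" using R_into r by auto
qed

text \<open>
  \<open>R\<close> is complete for pointwise stabilisation: the limit of the functionals \<open>eps (ap (t n) -)\<close> is
  a functional, and the operator that belongs to it agrees at \<open>c\<close> with those \<open>t n\<close> that have reached
  their limit on the finitely many vectors that determine the value at \<open>c\<close>.
\<close>

lemma pointwise_limit:
  fixes t :: "nat \<Rightarrow> 'c endo"
  assumes t: "\<And>n. t n \<in> R" and ev: "\<And>c. c \<in> V \<Longrightarrow> \<exists>N. \<forall>n\<ge>N. ap (t n) c = ap (t N) c"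
  shows "\<exists>r\<in>R. \<forall>c\<in>V. \<exists>N. \<forall>n\<ge>N. ap r c = ap (t n) c"
proof -
  have "\<exists>N. \<forall>n\<ge>N. ap (t n) c = ap (t N) c" for c
  proof -
    have "ap (t n) c = ap (t n) (ap e c)" for n using e(3)[OF t, of n] endo_ap(6) by metis
    then show ?thesis using ev[OF R_into[OF e(1)], of c] by simp
  qed
  then obtain N where N: "\<And>c n. n \<ge> N c \<Longrightarrow> ap (t n) c = ap (t (N c)) c" by metis
  define g where "g c = eps (ap (t (N c)) c)" for c
  have g: "g c = eps (ap (t n) c)" if "n \<ge> N c" for c n using N[OF that] by (simp add: g_def)
  have "Vector_Spaces.linear s (*) g"
  proof (unfold_locales)
    fix x y a
    define n where "n = max (N (x + y)) (max (N (s a x)) (max (N x) (N y)))"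
    have "n \<ge> N (x + y)" "n \<ge> N (s a x)" "n \<ge> N x" "n \<ge> N y" by (auto simp: n_def)
    then show "g (x + y) = g x + g y" "g (s a x) = a * g x"
      using g t by (simp_all add: eps.add eps.scale ap_scale)
  qed
  then obtain r where r: "r \<in> R" "\<And>c. c \<in> V \<Longrightarrow> eps (ap r c) = g c" using functional by metis
  have "\<exists>N. \<forall>n\<ge>N. ap r c = ap (t n) c" if c: "c \<in> V" for c
  proof -
    obtain F where F: "finite F" "F \<subseteq> V"
        "\<And>r. r \<in> R \<Longrightarrow> (\<And>u. u \<in> F \<Longrightarrow> eps (ap r u) = 0) \<Longrightarrow> ap r c = 0"
      using finitely_determined[OF c] by metis
    have "ap r c = ap (t n) c" if n: "n \<ge> Max (insert 0 (N ` F))" for n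
    proof -
      have "ap (r - t n) c = 0"
      proof (rule F(3))
        show "r - t n \<in> R" using r t R_diff by auto
        fix u assume u: "u \<in> F"
        then have "N u \<le> Max (insert 0 (N ` F))" using F(1) by (intro Max_ge) auto
        then have "g u = eps (ap (t n) u)" using g n by (meson order_trans)
        then show "eps (ap (r - t n) u) = 0" using r(2) u F(2) by (auto simp: eps.diff)
      qed
      then show ?thesis by simp
    qed
    then show ?thesis by blast
  qed
  then show ?thesis using r(1) by blast
qed

definition simple_submod where
  "simple_submod N \<longleftrightarrow> submod N \<and> N \<noteq> {0} \<and> (\<forall>M. submod M \<and> M \<subseteq> N \<longrightarrow> M = {0} \<or> M = N)"

lemma simple_submod_below:
  assumes M: "submod M" "M \<noteq> {0}"
  shows "\<exists>N. simple_submod N \<and> N \<subseteq> M"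
proof -
  define P where "P N \<longleftrightarrow> submod N \<and> N \<noteq> {0} \<and> N \<subseteq> M \<and> (\<exists>B. finite B \<and> N \<subseteq> span B)" for N
  obtain c where c: "c \<in> M" "c \<noteq> 0"
    using M subspace_0 by (auto simp: operator_submodule_def)
  have cV: "c \<in> V" using c M by (auto simp: operator_submodule_def)
  obtain B where B: "finite B" "\<And>r. r \<in> R \<Longrightarrow> ap r c \<in> span B" using locally_finite[OF cV] by blast
  have "(\<lambda>r. ap r c) ` R \<noteq> {0}" using self_in_cyclic[OF cV] c(2) by auto
  moreover have "(\<lambda>r. ap r c) ` R \<subseteq> M" using submod_ap[OF M(1) _ c(1)] by auto
  ultimately have "P ((\<lambda>r. ap r c) ` R)"
    using submod_cyclic[OF cV] B by (auto simp: P_def)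
  then obtain N where N: "P N" and least: "\<And>N'. P N' \<Longrightarrow> dim N \<le> dim N'"
    using ex_has_least_nat[of P _ dim] by blast
  obtain B' where B': "finite B'" "N \<subseteq> span B'" using N by (auto simp: P_def)
  have "N' = {0} \<or> N' = N" if N': "submod N'" "N' \<subseteq> N" for N'
  proof (rule ccontr)
    assume ne: "\<not> (N' = {0} \<or> N' = N)"
    have "N' \<subseteq> span B'" using N'(2) B'(2) by (rule subset_trans)
    then have "P N'" using N' N ne B'(1) unfolding P_def by blast
    moreover have "dim N' < dim N"
      using dim_less_of_proper_subspace[OF _ _ _ B'(2,1), of N'] N' N ne
      by (auto simp: P_def operator_submodule_def)
    ultimately show False using least by force
  qed
  then have "simple_submod N" using N by (simp add: simple_submod_def P_def)
  then show ?thesis using N by (auto simp: P_def)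
qed

lemma simple_submod_unique: "simple_submod M \<Longrightarrow> simple_submod N \<Longrightarrow> M = N"
  using chain[of M N] unfolding simple_submod_def by metis

lemma simple_submod_least: "simple_submod S \<Longrightarrow> submod M \<Longrightarrow> M \<noteq> {0} \<Longrightarrow> S \<subseteq> M"
  using simple_submod_below simple_submod_unique by metis

end

text \<open>
  Here \<open>C0\<close> stands for the coradical and \<open>pi\<close> for the restriction of functionals to \<open>C0\<close>,
  followed by an isomorphism of the dual of \<open>C0\<close> with the division algebra.
\<close>

locale uniserial_operators =
  chain_operators s V R e eps + D: findim_central_division_algebra scaleD
  for s :: "'k::field \<Rightarrow> 'c::ab_group_add \<Rightarrow> 'c" and V R e eps
    and scaleD :: "'k \<Rightarrow> 'd::division_ring \<Rightarrow> 'd" +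
  fixes C0 :: "'c set" and pi :: "'c endo \<Rightarrow> 'd"
  assumes C0: "operator_submodule s V R C0" "C0 \<noteq> {0}"
    and C0_least: "operator_submodule s V R M \<Longrightarrow> M \<noteq> {0} \<Longrightarrow> C0 \<subseteq> M"
    and C0_annihilator: "r \<in> R \<Longrightarrow> (\<And>c. c \<in> C0 \<Longrightarrow> eps (ap r c) = 0) \<Longrightarrow> c \<in> C0 \<Longrightarrow> ap r c = 0"
    and pi_add: "r \<in> R \<Longrightarrow> r' \<in> R \<Longrightarrow> pi (r + r') = pi r + pi r'"
    and pi_mult: "r \<in> R \<Longrightarrow> r' \<in> R \<Longrightarrow> pi (r * r') = pi r * pi r'"
    and pi_scale: "r \<in> R \<Longrightarrow> pi (homothety s a * r) = scaleD a (pi r)"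
    and pi_e: "pi e = 1"
    and pi_surj: "\<exists>r\<in>R. pi r = d"
    and pi_kernel: "r \<in> R \<Longrightarrow> pi r = 0 \<longleftrightarrow> (\<forall>c\<in>C0. ap r c = 0)"
begin

lemma pi_zero: "pi 0 = 0"
  using pi_add[OF R_zero R_zero] by simp

lemma pi_diff: "r \<in> R \<Longrightarrow> r' \<in> R \<Longrightarrow> pi (r - r') = pi r - pi r'"
  using pi_add[OF R_diff, of r r' r'] by (simp add: algebra_simps)

text \<open>
  The Jacobson radical of \<open>R\<close>, the orthogonal complement of \<open>C0\<close>.
\<close>

definition J where "J = {r \<in> R. \<forall>c\<in>C0. ap r c = 0}"

lemma J_iff: "r \<in> J \<longleftrightarrow> r \<in> R \<and> pi r = 0"
  using pi_kernel by (auto simp: J_def)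

lemma J_R: "r \<in> J \<Longrightarrow> r \<in> R" by (simp add: J_def)

lemma J_mult_left: "r \<in> R \<Longrightarrow> j \<in> J \<Longrightarrow> r * j \<in> J"
  by (simp add: J_iff R_mult pi_mult)

lemma J_mult_right: "r \<in> R \<Longrightarrow> j \<in> J \<Longrightarrow> j * r \<in> J"
  by (simp add: J_iff R_mult pi_mult)

lemma J_add: "r \<in> J \<Longrightarrow> j \<in> J \<Longrightarrow> r + j \<in> J"
  by (simp add: J_iff R_add pi_add)

lemma J_zero: "0 \<in> J"
  by (simp add: J_iff R_zero pi_zero)

lemma J_sum: "(\<And>i. i \<in> A \<Longrightarrow> g i \<in> J) \<Longrightarrow> sum g A \<in> J"
  by (induction A rule: infinite_finite_induct) (auto intro: J_add J_zero)

text \<open>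
  If the orthogonal complement of \<open>y R\<close> is contained in \<open>C0\<close>, then \<open>y R\<close> is dense in \<open>J\<close>: on
  every finite set of vectors each \<open>h\<close> in \<open>J\<close> agrees, as a functional, with some \<open>y * g\<close>. Since the
  value of an operator at \<open>c\<close> depends on finitely many values of its functional, this gives
  \<open>J c = y R c\<close> at every single vector. The proof is duality in a finite-dimensional space: a
  functional that separates \<open>h\<close> from \<open>y R\<close> on the finite set \<open>F\<close> is evaluation at a
  combination \<open>w\<close> of \<open>F\<close>, and \<open>w\<close> must lie in \<open>C0\<close>, where \<open>h\<close> vanishes.
\<close>

lemma locally_principal:
  assumes y: "y \<in> J" "max_kernel y \<subseteq> C0" and h: "h \<in> J" and c: "c \<in> V"
  shows "\<exists>g\<in>R. ap h c = ap (y * g) c"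
proof -
  obtain F where F: "finite F" "F \<subseteq> V"
      "\<And>r. r \<in> R \<Longrightarrow> (\<And>u. u \<in> F \<Longrightarrow> eps (ap r u) = 0) \<Longrightarrow> ap r c = 0"
    using finitely_determined[OF c] by metis
  define fs where "fs = (\<lambda>r (f :: 'c \<Rightarrow> 'k) x. r * f x)"
  interpret F: vector_space fs
    unfolding fs_def by (rule vector_space_fun) (rule vector_space_field)
  define rs where "rs r u = (if u \<in> F then eps (ap r u) else 0)" for r u
  define W where "W = (\<lambda>g. rs (y * g)) ` R"
  have subW: "F.subspace W"
  proof (rule F.subspaceI)
    have "rs (y * 0) = 0" by (auto simp: rs_def eps.zero)
    then show "0 \<in> W" unfolding W_def using R_zero by (metis image_eqI)
  next
    fix p q assume "p \<in> W" "q \<in> W"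
    then obtain g g' where "p = rs (y * g)" "q = rs (y * g')" "g \<in> R" "g' \<in> R" by (auto simp: W_def)
    then show "p + q \<in> W" unfolding W_def
      by (intro image_eqI[of _ _ "g + g'"]) (auto simp: rs_def eps.add R_add)
  next
    fix a p assume "p \<in> W"
    then obtain g where g: "p = rs (y * g)" "g \<in> R" by (auto simp: W_def)
    have "ap y (ap (homothety s a) z) = s a (ap y z)" for z
      using ap_scale[OF J_R[OF y(1)]] by (simp add: ap_homothety)
    then have "fs a p = rs (y * (homothety s a * g))"
      using g by (auto simp: rs_def fs_def eps.scale)
    then show "fs a p \<in> W" unfolding W_def using R_scale[OF g(2)] by blast
  qed
  have "rs h \<in> F.span W"
  proof (rule ccontr)
    assume "rs h \<notin> F.span W"
    then obtain L where L: "Vector_Spaces.linear fs (*) L" "\<And>p. p \<in> F.span W \<Longrightarrow> L p = 0" "L (rs h) = 1"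
      by (rule F.separating_functional) blast
    interpret L: Vector_Spaces.linear fs "(*)" L by (rule L(1))
    define al where "al u = L (\<lambda>v. if v = u then 1 else 0)" for u
    define w where "w = (\<Sum>u\<in>F. s (al u) u)"
    have w: "w \<in> V" unfolding w_def using F(2) V by (intro subspace_sum) (auto intro: subspace_scale)
    have Lrs: "L (rs q) = eps (ap q w)" if q: "q \<in> R" for q
    proof -
      have "rs q = (\<Sum>u\<in>F. fs (eps (ap q u)) (\<lambda>v. if v = u then 1 else 0))"
        (is "_ = ?S")
      proof
        fix v
        have "?S v = (\<Sum>u\<in>F. if u = v then eps (ap q u) else 0)"
        proof -
          have "(\<Sum>u\<in>A. fs (g u) (\<lambda>v. if v = u then 1 else 0)) v = (\<Sum>u\<in>A. if u = v then g u else 0)"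
            for A g by (induction A rule: infinite_finite_induct) (auto simp: fs_def)
          then show ?thesis .
        qed
        then show "rs q v = ?S v" using F(1) by (simp add: rs_def)
      qed
      then have "L (rs q) = (\<Sum>u\<in>F. eps (ap q u) * al u)" by (simp add: L.sum L.scale al_def)
      also have "\<dots> = eps (ap q w)"
        by (simp add: w_def ap_sum eps.sum ap_scale[OF q] eps.scale mult.commute)
      finally show ?thesis .
    qed
    have "eps (ap (y * g) w) = 0" if "g \<in> R" for g
    proof -
      have "rs (y * g) \<in> F.span W" using that by (intro F.span_base) (auto simp: W_def)
      then show ?thesis using L(2) Lrs[OF R_mult[OF J_R[OF y(1)] that]] by simp
    qed
    then have "w \<in> max_kernel y" using w by (simp add: max_kernel_def)
    then have "w \<in> C0" using y by auto
    then have "ap h w = 0" using h by (simp add: J_def)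
    then show False using Lrs[OF J_R[OF h]] L(3) eps.zero by simp
  qed
  then have "rs h \<in> W" using subW F.span_eq_iff by blast
  then obtain g where g: "g \<in> R" "rs h = rs (y * g)" by (auto simp: W_def)
  have "ap (h - y * g) c = 0"
  proof (rule F(3))
    show "h - y * g \<in> R" using R_diff R_mult J_R y h g by auto
    fix u assume "u \<in> F"
    then show "eps (ap (h - y * g) u) = 0" using fun_cong[OF g(2), of u] by (simp add: rs_def eps.diff)
  qed
  then show ?thesis using g by auto
qed

text \<open>
  By \<open>locally_principal\<close> the image of a submodule \<open>M\<close> under \<open>y\<close> is again a submodule. If \<open>M\<close> is
  nonzero it contains \<open>C0\<close>, which \<open>y\<close> kills, so \<open>y\<close> is not injective on \<open>M\<close> and the image is
  smaller.
\<close>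

lemma nilpotent_on_submod:
  assumes y: "y \<in> J" "max_kernel y \<subseteq> C0" and M: "submod M" "M \<subseteq> span B" "finite B"
  shows "\<exists>n. \<forall>m\<in>M. ap (y ^ n) m = 0"
  using M
proof (induction "dim M" arbitrary: M rule: less_induct)
  case less
  have subM: "subspace M" "M \<subseteq> V" using less.prems by (auto simp: operator_submodule_def)
  have yR: "y \<in> R" using J_R y by auto
  show ?case
  proof (cases "M = {0}")
    case True
    then show ?thesis by (intro exI[of _ 0]) simp
  next
    case False
    define M' where "M' = ap y ` M"
    have "submod M'"
      unfolding operator_submodule_def
    proof (intro conjI ballI)
      show "subspace M'"
      proof (rule subspaceI)
        show "0 \<in> M'" using subspace_0[OF subM(1)] by (force simp: M'_def intro: image_eqI[of _ _ 0])
      next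
        fix p q assume "p \<in> M'" "q \<in> M'"
        then obtain a b where "p = ap y a" "q = ap y b" "a \<in> M" "b \<in> M" by (auto simp: M'_def)
        then show "p + q \<in> M'" unfolding M'_def
          using subspace_add[OF subM(1)] by (intro image_eqI[of _ _ "a + b"]) auto
      next
        fix a p assume "p \<in> M'"
        then obtain b where "p = ap y b" "b \<in> M" by (auto simp: M'_def)
        then show "s a p \<in> M'" unfolding M'_def
          using subspace_scale[OF subM(1)] ap_scale[OF yR] by (intro image_eqI[of _ _ "s a b"]) auto
      qed
      show "M' \<subseteq> V" using R_into yR by (auto simp: M'_def)
      fix r p assume r: "r \<in> R" and "p \<in> M'"
      then obtain b where b: "p = ap y b" "b \<in> M" by (auto simp: M'_def)
      obtain g where g: "g \<in> R" "ap (r * y) b = ap (y * g) b"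
        using locally_principal[OF y J_mult_left[OF r y(1)]] b subM by blast
      then show "ap r p \<in> M'" unfolding M'_def
        using b submod_ap[OF less.prems(1) g(1) b(2)] by (intro image_eqI[of _ _ "ap g b"]) auto
    qed
    have "M' \<subseteq> M" using submod_ap[OF less.prems(1) yR] by (auto simp: M'_def)
    have "C0 \<subseteq> M" using C0_least less.prems(1) False by blast
    obtain c0 where c0: "c0 \<in> C0" "c0 \<noteq> 0"
      using C0 subspace_0 by (auto simp: operator_submodule_def)
    have "ap y c0 = 0" using y c0 by (simp add: J_def)
    then have "M' \<noteq> M" unfolding M'_def
      using noninjective_not_onto[OF subM(1) less.prems(2,3), of "ap y" c0] ap_scale[OF yR] c0
        \<open>C0 \<subseteq> M\<close> by auto
    have "dim M' < dim M"
      using dim_less_of_proper_subspace[OF _ subM(1) _ less.prems(2,3)] \<open>submod M'\<close> \<open>M' \<subseteq> M\<close> \<open>M' \<noteq> M\<close>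
      by (auto simp: operator_submodule_def)
    then obtain n where n: "\<forall>m\<in>M'. ap (y ^ n) m = 0"
      using less.hyps[of M'] \<open>submod M'\<close> \<open>M' \<subseteq> M\<close> less.prems by auto
    have "\<forall>m\<in>M. ap (y ^ Suc n) m = 0"
      using n by (auto simp: M'_def power_Suc2 simp del: power_Suc)
    then show ?thesis by blast
  qed
qed

lemma nilpotent_at:
  assumes y: "y \<in> J" "max_kernel y \<subseteq> C0" and c: "c \<in> V"
  shows "\<exists>n. \<forall>m\<ge>n. \<forall>g\<in>R. ap (y ^ m * g) c = 0"
proof -
  obtain B where B: "finite B" "\<And>r. r \<in> R \<Longrightarrow> ap r c \<in> span B" using locally_finite[OF c] by blast
  then obtain n where n: "\<forall>m\<in>(\<lambda>r. ap r c) ` R. ap (y ^ n) m = 0"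
    using nilpotent_on_submod[OF y submod_cyclic[OF c], of B] by blast
  have "ap (y ^ m * g) c = 0" if "m \<ge> n" "g \<in> R" for m g
  proof -
    have "y ^ m = y ^ (m - n) * y ^ n" using that by (simp flip: power_add)
    then show ?thesis using n that by simp
  qed
  then show ?thesis by blast
qed

text \<open>
  The submodule \<open>C1\<close> is minimal among the finite-dimensional ones that are not inside \<open>C0\<close>. If \<open>x\<close>
  does not vanish on it, then the submodule \<open>max_kernel x\<close> does not contain \<open>C1\<close>; by the chain
  condition it is strictly smaller than \<open>C1\<close>, and by minimality it lies in \<open>C0\<close>. So a functional
  generates \<open>J\<close> topologically as soon as it is nonzero on \<open>C1\<close>. If \<open>V = C0\<close>, there is
  no such \<open>C1\<close>, and \<open>0\<close> is a generator.
\<close>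

lemma second_layer:
  obtains "V \<subseteq> C0" |
    C1 y where "submod C1" "y \<in> J" "\<exists>c\<in>C1. eps (ap y c) \<noteq> 0"
      "\<And>x. x \<in> J \<Longrightarrow> \<exists>c\<in>C1. eps (ap x c) \<noteq> 0 \<Longrightarrow> max_kernel x \<subseteq> C0"
proof (cases "V \<subseteq> C0")
  case True
  then show thesis using that(1) by blast
next
  case False
  then obtain c where c: "c \<in> V" "c \<notin> C0" by auto
  define P where "P M \<longleftrightarrow> submod M \<and> (\<exists>B. finite B \<and> M \<subseteq> span B) \<and> \<not> M \<subseteq> C0" for M
  have "P ((\<lambda>r. ap r c) ` R)"
    unfolding P_def using submod_cyclic[OF c(1)] locally_finite[OF c(1)] self_in_cyclic[OF c(1)] c(2)
    by blast
  then obtain C1 where C1: "P C1" and least: "\<And>M. P M \<Longrightarrow> dim C1 \<le> dim M"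
    using ex_has_least_nat[of P _ dim] by blast
  have s1: "submod C1" using C1 by (simp add: P_def)
  obtain B where B: "finite B" "C1 \<subseteq> span B" using C1 by (auto simp: P_def)
  obtain c1 where c1: "c1 \<in> C1" "c1 \<notin> C0" using C1 by (auto simp: P_def)
  have sub0: "span C0 = C0" using C0 by (simp add: operator_submodule_def)
  then obtain g where g: "Vector_Spaces.linear s (*) g" "\<And>x. x \<in> C0 \<Longrightarrow> g x = 0" "g c1 = 1"
    using separating_functional[of c1 C0] c1 by metis
  obtain y where y: "y \<in> R" "\<And>c. c \<in> V \<Longrightarrow> eps (ap y c) = g c" using functional[OF g(1)] by blast
  have "c1 \<in> V" using c1 s1 by (auto simp: operator_submodule_def)
  have "C0 \<subseteq> V" using C0 by (auto simp: operator_submodule_def)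
  then have "eps (ap y c) = 0" if "c \<in> C0" for c using y(2) g(2) that by auto
  then have "y \<in> J" using C0_annihilator[OF y(1)] y(1) by (simp add: J_def)
  moreover have "\<exists>c\<in>C1. eps (ap y c) \<noteq> 0" using c1 y(2)[OF \<open>c1 \<in> V\<close>] g(3) by force
  moreover have "max_kernel x \<subseteq> C0" if x: "x \<in> J" "\<exists>c\<in>C1. eps (ap x c) \<noteq> 0" for x
  proof (rule ccontr)
    assume no: "\<not> max_kernel x \<subseteq> C0"
    have sK: "submod (max_kernel x)" using submod_max_kernel J_R x by auto
    obtain c where c: "c \<in> C1" "eps (ap x c) \<noteq> 0" using x by blast
    have "c \<notin> max_kernel x"
    proof
      assume "c \<in> max_kernel x"
      then have "eps (ap (x * e) c) = 0" using e(1) by (auto simp: max_kernel_def)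
      then show False using c e(3)[OF J_R[OF x(1)]] by simp
    qed
    then have "max_kernel x \<subset> C1" using chain[OF sK s1] c by auto
    then have "max_kernel x \<subseteq> span B" using B(2) by auto
    then have "P (max_kernel x)" using sK no B(1) by (auto simp: P_def)
    moreover have "dim (max_kernel x) < dim C1"
      using dim_less_of_proper_subspace[OF _ _ \<open>max_kernel x \<subset> C1\<close> B(2,1)] sK s1
      by (auto simp: operator_submodule_def)
    ultimately show False using least by force
  qed
  ultimately show thesis using that(2) s1 by blast
qed

section \<open>Lifting the division algebra\<close>

text \<open>
  A local substitute for the powers of \<open>J\<close>. Defined through the vectors \<open>y\<^sup>n R c\<close>, it annihilates \<open>c\<close>
  once \<open>y\<^sup>n R c = 0\<close>, and no topological closure has to be taken.
\<close>

definition power_ideal where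
  "power_ideal y n = {r \<in> R. \<forall>c\<in>V. \<exists>g\<in>R. ap r c = ap (y ^ n * g) c}"

lemma power_ideal_R: "r \<in> power_ideal y n \<Longrightarrow> r \<in> R"
  by (simp add: power_ideal_def)

lemma power_ideal_diff: "r \<in> power_ideal y n \<Longrightarrow> r' \<in> power_ideal y n \<Longrightarrow> r - r' \<in> power_ideal y n"
  unfolding power_ideal_def
proof (clarsimp, intro conjI ballI)
  fix c assume r: "\<forall>c\<in>V. \<exists>g\<in>R. ap r c = ap (y ^ n) (ap g c)"
    and r': "\<forall>c\<in>V. \<exists>g\<in>R. ap r' c = ap (y ^ n) (ap g c)" and c: "c \<in> V"
  obtain g g' where "g \<in> R" "g' \<in> R" "ap r c = ap (y ^ n) (ap g c)" "ap r' c = ap (y ^ n) (ap g' c)"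
    using r r' c by metis
  then show "\<exists>g\<in>R. ap r c - ap r' c = ap (y ^ n) (ap g c)"
    using R_diff by (intro bexI[of _ "g - g'"]) auto
qed (rule R_diff)

lemma power_ideal_zero: "y \<in> R \<Longrightarrow> 0 \<in> power_ideal y n"
  using R_zero by (auto simp: power_ideal_def intro!: bexI[of _ 0])

lemma power_ideal_add: "y \<in> R \<Longrightarrow> r \<in> power_ideal y n \<Longrightarrow> r' \<in> power_ideal y n \<Longrightarrow> r + r' \<in> power_ideal y n"
  using power_ideal_diff[of r y n "0 - r'"] power_ideal_diff[of 0 y n r'] power_ideal_zero[of y n] by simp

lemma power_ideal_sum: "y \<in> R \<Longrightarrow> (\<And>i. i \<in> A \<Longrightarrow> g i \<in> power_ideal y n) \<Longrightarrow> sum g A \<in> power_ideal y n"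
  by (induction A rule: infinite_finite_induct) (auto intro: power_ideal_add power_ideal_zero)

text \<open>
  From \<open>J c = y R c\<close> one gets \<open>R y\<^sup>n R c \<subseteq> y\<^sup>n R c\<close> and \<open>J y\<^sup>n R c \<subseteq> y\<^bsup>n+1\<^esup> R c\<close>, the second
  for \<open>n\<close> from the first for \<open>n\<close>, and the first for \<open>n + 1\<close> from the second for \<open>n\<close>.
\<close>

lemma power_absorbs:
  assumes y: "y \<in> J" "max_kernel y \<subseteq> C0"
  shows absorb_R: "r \<in> R \<Longrightarrow> g \<in> R \<Longrightarrow> c \<in> V \<Longrightarrow> \<exists>g'\<in>R. ap (r * (y ^ n * g)) c = ap (y ^ n * g') c"
    and absorb_J: "j \<in> J \<Longrightarrow> g \<in> R \<Longrightarrow> c \<in> V \<Longrightarrow> \<exists>g'\<in>R. ap (j * (y ^ n * g)) c = ap (y ^ Suc n * g') c"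
proof -
  have step: "\<exists>g'\<in>R. ap (j * (y ^ n * g)) c = ap (y ^ Suc n * g') c"
    if IH: "\<And>r g c. r \<in> R \<Longrightarrow> g \<in> R \<Longrightarrow> c \<in> V \<Longrightarrow> \<exists>g'\<in>R. ap (r * (y ^ n * g)) c = ap (y ^ n * g') c"
      and j: "j \<in> J" and g: "g \<in> R" and c: "c \<in> V" for n j g c
  proof -
    have "ap (y ^ n * g) c \<in> V" using R_into R_power J_R y g by blast
    from locally_principal[OF y j this] obtain g1 where
      g1: "g1 \<in> R" "ap j (ap (y ^ n * g) c) = ap (y * g1) (ap (y ^ n * g) c)" by blast
    obtain g2 where g2: "g2 \<in> R" "ap (g1 * (y ^ n * g)) c = ap (y ^ n * g2) c"
      using IH[OF g1(1) g c] by blast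
    have "ap (j * (y ^ n * g)) c = ap y (ap (g1 * (y ^ n * g)) c)" using g1(2) by simp
    also have "\<dots> = ap (y ^ Suc n * g2) c" using g2 by simp
    finally show ?thesis using g2 by blast
  qed
  have R: "\<exists>g'\<in>R. ap (r * (y ^ n * g)) c = ap (y ^ n * g') c"
    if "r \<in> R" "g \<in> R" "c \<in> V" for r g c n
    using that
  proof (induction n arbitrary: r g c)
    case 0
    then show ?case using R_mult by (intro bexI[of _ "r * g"]) auto
  next
    case (Suc n)
    have "ap (r * (y ^ Suc n * g)) c = ap ((r * y) * (y ^ n * g)) c" by simp
    then show ?case using step[OF Suc.IH, of "r * y" g c] J_mult_left[OF Suc.prems(1) y(1)] Suc.prems
      by simp
  qed
  then show "r \<in> R \<Longrightarrow> g \<in> R \<Longrightarrow> c \<in> V \<Longrightarrow> \<exists>g'\<in>R. ap (r * (y ^ n * g)) c = ap (y ^ n * g') c" .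
  show "j \<in> J \<Longrightarrow> g \<in> R \<Longrightarrow> c \<in> V \<Longrightarrow> \<exists>g'\<in>R. ap (j * (y ^ n * g)) c = ap (y ^ Suc n * g') c"
    using step[OF R] by blast
qed

lemma power_ideal_mult_R:
  assumes y: "y \<in> J" "max_kernel y \<subseteq> C0" and r: "r \<in> R" and q: "q \<in> power_ideal y n"
  shows "r * q \<in> power_ideal y n"
  unfolding power_ideal_def
proof (intro CollectI conjI ballI)
  show "r * q \<in> R" using R_mult r power_ideal_R q by blast
  fix c assume c: "c \<in> V"
  obtain g where "g \<in> R" "ap q c = ap (y ^ n * g) c" using q c by (auto simp: power_ideal_def)
  then show "\<exists>g\<in>R. ap (r * q) c = ap (y ^ n * g) c" using absorb_R[OF y r _ c, of g n] by simp
qed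

lemma power_ideal_mult_J:
  assumes y: "y \<in> J" "max_kernel y \<subseteq> C0" and r: "r \<in> J" and q: "q \<in> power_ideal y n"
  shows "r * q \<in> power_ideal y (Suc n)"
  unfolding power_ideal_def
proof (intro CollectI conjI ballI)
  show "r * q \<in> R" using R_mult J_R r power_ideal_R q by blast
  fix c assume c: "c \<in> V"
  obtain g where "g \<in> R" "ap q c = ap (y ^ n * g) c" using q c by (auto simp: power_ideal_def)
  then show "\<exists>g\<in>R. ap (r * q) c = ap (y ^ Suc n * g) c" using absorb_J[OF y r _ c, of g n] by simp
qed

text \<open>
  A linear unital section of \<open>pi\<close> that is multiplicative up to an error in \<open>power_ideal y n\<close>.
\<close>

definition lifts_to_order where
  "lifts_to_order y n t \<longleftrightarrow> (\<forall>a. t a \<in> R) \<and> (\<forall>a c. t (a + c) = t a + t c) \<and>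
     (\<forall>r a. t (scaleD r a) = homothety s r * t a) \<and> t 1 = e \<and> (\<forall>a. pi (t a) = a) \<and>
     (\<forall>a c. t a * t c - t (a * c) \<in> power_ideal y n)"

lemma linear_section:
  obtains t where "\<And>a. t a \<in> R" "\<And>a c. t (a + c) = t a + t c"
    "\<And>r a. t (scaleD r a) = homothety s r * t a" "t 1 = e" "\<And>a. pi (t a) = a"
proof -
  obtain B where B: "finite B" "D.independent B" "D.span B = UNIV" by (rule D.finite_basis_exists)
  obtain p where p: "\<And>d. p d \<in> R" "\<And>d. pi (p d) = d" using pi_surj by metis
  define rep where "rep = D.representation B"
  define t0 where "t0 a = (\<Sum>u\<in>B. homothety s (rep a u) * p u)" for a
  have "(1::'d) \<notin> D.span {}" by simp
  then obtain m where m: "Vector_Spaces.linear scaleD (*) m" "m 1 = 1"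
    by (rule D.separating_functional) blast
  interpret m: Vector_Spaces.linear scaleD "(*)" m by (rule m(1))
  have hadd: "homothety s (a + c) = homothety s a + homothety s c" for a c
    by (rule endo_eqI) (simp add: ap_homothety scale_left_distrib)
  have hmult: "homothety s (a * c) = homothety s a * homothety s c" for a c
    by (rule endo_eqI) (simp add: ap_homothety)
  have inB: "a \<in> D.span B" for a using B by simp
  have t0R: "t0 a \<in> R" for a unfolding t0_def by (intro R_sum R_scale p)
  have t0_add: "t0 (a + c) = t0 a + t0 c" for a c
    by (simp add: t0_def rep_def D.representation_add[OF B(2) inB inB] hadd distrib_right sum.distrib)
  have t0_scale: "t0 (scaleD r a) = homothety s r * t0 a" for r a
    by (simp add: t0_def rep_def D.representation_scale[OF B(2) inB] hmult sum_distrib_left mult.assoc)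
  have pi_sum: "pi (sum g A) = (\<Sum>i\<in>A. pi (g i))" if "\<And>i. g i \<in> R" for A and g :: "'d \<Rightarrow> 'c endo"
    by (induction A rule: infinite_finite_induct) (auto simp: pi_zero pi_add that R_sum)
  have t0_pi: "pi (t0 a) = a" for a
    unfolding t0_def by (subst pi_sum)
      (use R_scale p in \<open>simp_all add: pi_scale D.sum_representation_eq[OF B(2)] B rep_def\<close>)
  \<comment> \<open>As \<open>m 1 = 1\<close> and \<open>e - t0 1\<close> lies in the kernel of \<open>pi\<close>, this makes the section unital and keeps it a section.\<close>
  define t where "t a = t0 a + homothety s (m a) * (e - t0 1)" for a
  have d: "e - t0 1 \<in> R" "pi (e - t0 1) = 0"
    using R_diff e(1) t0R by (auto simp: pi_diff pi_e t0_pi)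
  show thesis
  proof
    show "t a \<in> R" for a unfolding t_def by (intro R_add R_scale t0R d)
    show "t (a + c) = t a + t c" for a c
      by (simp add: t_def t0_add m.add hadd algebra_simps)
    show "t (scaleD r a) = homothety s r * t a" for r a
      by (simp add: t_def t0_scale m.scale hmult distrib_left mult.assoc)
    have "homothety s 1 = 1" by (rule endo_eqI) (simp add: ap_homothety)
    then show "t 1 = e" by (simp add: t_def m)
    show "pi (t a) = a" for a
      by (simp add: t_def pi_add pi_scale d R_scale t0R t0_pi)
  qed
qed

text \<open>
  The values of the defect \<open>f\<close> lie in \<open>J\<close> and in \<open>power_ideal y (n + 1)\<close>, so their products lie in
  \<open>power_ideal y (n + 2)\<close>, and \<open>newton_defect\<close> applies.
\<close>

lemma lifts_to_next_order:
  assumes y: "y \<in> J" "max_kernel y \<subseteq> C0" and t: "lifts_to_order y (Suc n) t"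
  shows "\<exists>t'. lifts_to_order y (Suc (Suc n)) t' \<and> (\<forall>a. t' a - t a \<in> power_ideal y (Suc n))"
proof -
  have tR: "t a \<in> R" and t_add: "t (a + c) = t a + t c" and t_scale: "t (scaleD r a) = homothety s r * t a"
    and t_one: "t 1 = e" and t_pi: "pi (t a) = a" and t_mult: "t a * t c - t (a * c) \<in> power_ideal y (Suc n)"
    for a c r using t by (auto simp: lifts_to_order_def)
  obtain B b \<mu> where B: "(\<Sum>u\<in>B. u * b u) = (1::'d)"
    and scalar: "\<And>x. (\<Sum>u\<in>B. u * x * b u) = scaleD (\<mu> x) 1"
    by (rule D.separability_idempotent) blast
  define f where "f a c = t a * t c - t (a * c)" for a c
  define h where "h a = (\<Sum>u\<in>B. t u * f (b u) a)" for a
  have fI: "f a c \<in> power_ideal y (Suc n)" for a c using t_mult by (simp add: f_def)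
  have fJ: "f a c \<in> J" for a c
    by (simp add: J_iff f_def R_diff R_mult tR pi_diff pi_mult t_pi)
  have yR: "y \<in> R" using J_R y by simp
  have hI: "h a \<in> power_ideal y (Suc n)" for a unfolding h_def by (intro power_ideal_sum power_ideal_mult_R y yR tR fI)
  have hJ: "h a \<in> J" for a unfolding h_def by (intro J_sum J_mult_left tR fJ)
  have f_add: "f (a + a') c = f a c + f a' c" "f a (c + c') = f a c + f a c'" for a a' c c'
    by (simp_all add: f_def t_add algebra_simps)
  have comm: "t a * homothety s r = homothety s r * t a" for a r by (rule R_commute) (rule tR)
  have f_scale: "f (scaleD r a) c = homothety s r * f a c" "f a (scaleD r c) = homothety s r * f a c" for r a c
    by (simp_all add: f_def t_scale D.scale_mult_left D.scale_mult_right right_diff_distrib mult.assoc[symmetric] comm)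
  have "(\<Sum>u\<in>B. t (a * u) * f (b u) c) = (\<Sum>u\<in>B. t u * f (b u * a) c)" for a c
    by (rule D.two_sided_multiplication_balanced[of "\<lambda>p q. t p * f q c", OF _ _ _ scalar])
      (simp_all add: f_add t_add distrib_left distrib_right f_scale t_scale mult.assoc[symmetric] comm)
  then have defect: "(t a - h a) * (t c - h c) - (t (a * c) - h (a * c)) =
      h a * h c - (\<Sum>u\<in>B. f a u * f (b u) c) - (\<Sum>u\<in>B. f u (b u) * f a c)" for a c
    using B by (intro newton_defect) (auto simp: t_add t_one e tR f_def h_def)
  have "lifts_to_order y (Suc (Suc n)) (\<lambda>a. t a - h a)"
    unfolding lifts_to_order_def
  proof (intro conjI allI)
    fix a c r
    show "t a - h a \<in> R" using R_diff tR J_R hJ by blast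
    show "t (a + c) - h (a + c) = t a - h a + (t c - h c)"
      by (simp add: t_add h_def f_add distrib_left sum.distrib)
    show "t (scaleD r a) - h (scaleD r a) = homothety s r * (t a - h a)"
      by (simp add: t_scale h_def f_scale right_diff_distrib sum_distrib_left mult.assoc[symmetric] comm)
    \<comment> \<open>Since \<open>t\<close> is unital, the correction \<open>h\<close> vanishes at \<open>1\<close> and the new section is unital again.\<close>
    have "f x 1 = 0" for x by (simp add: f_def t_one e tR)
    then show "t 1 - h 1 = e" by (simp add: h_def t_one)
    show "pi (t a - h a) = a" using hJ[of a] by (simp add: pi_diff tR t_pi J_iff)
    show "(t a - h a) * (t c - h c) - (t (a * c) - h (a * c)) \<in> power_ideal y (Suc (Suc n))"
      unfolding defect by (intro power_ideal_diff power_ideal_sum power_ideal_mult_J y yR hJ hI fJ fI)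
  qed
  moreover have "\<forall>a. (t a - h a) - t a \<in> power_ideal y (Suc n)"
    using power_ideal_diff[OF power_ideal_zero[OF yR] hI] by simp
  ultimately show ?thesis by blast
qed

lemma generator_exists: obtains y where "y \<in> J" "max_kernel y \<subseteq> C0"
proof (rule second_layer)
  assume "V \<subseteq> C0"
  then have "max_kernel 0 \<subseteq> C0" by (auto simp: max_kernel_def)
  then show thesis using that J_zero by blast
next
  fix C1 y
  assume "y \<in> J" "\<exists>c\<in>C1. eps (ap y c) \<noteq> 0"
    "\<And>x. x \<in> J \<Longrightarrow> \<exists>c\<in>C1. eps (ap x c) \<noteq> 0 \<Longrightarrow> max_kernel x \<subseteq> C0"
  then show thesis using that by blast
qed

lemma J_subset_power_ideal:
  assumes "y \<in> J" "max_kernel y \<subseteq> C0" "j \<in> J"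
  shows "j \<in> power_ideal y (Suc 0)"
  using locally_principal[OF assms] J_R[OF assms(3)] by (simp add: power_ideal_def)

text \<open>
  The Wedderburn-Malcev theorem for \<open>R\<close>: the successive corrections lie in deeper and deeper
  \<open>power_ideal\<close>s, which annihilate any given vector from some point on, so the approximate sections
  stabilise pointwise, and the limit is multiplicative.
\<close>

lemma lifting_exists:
  obtains \<delta> where "\<And>a. \<delta> a \<in> R" "\<And>a c. \<delta> (a + c) = \<delta> a + \<delta> c"
    "\<And>r a. \<delta> (scaleD r a) = homothety s r * \<delta> a" "\<delta> 1 = e" "\<And>a. pi (\<delta> a) = a"
    "\<And>a c. \<delta> (a * c) = \<delta> a * \<delta> c"
proof -
  obtain y where y: "y \<in> J" "max_kernel y \<subseteq> C0" by (rule generator_exists)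
  obtain t1 where t1: "\<And>a. t1 a \<in> R" "\<And>a c. t1 (a + c) = t1 a + t1 c"
    "\<And>r a. t1 (scaleD r a) = homothety s r * t1 a" "t1 1 = e" "\<And>a. pi (t1 a) = a"
    by (rule linear_section) blast
  have "t1 a * t1 c - t1 (a * c) \<in> power_ideal y (Suc 0)" for a c
    by (rule J_subset_power_ideal[OF y]) (simp add: J_iff R_diff R_mult t1 pi_diff pi_mult)
  then have "lifts_to_order y (Suc 0) t1" using t1 by (simp add: lifts_to_order_def)
  then have "\<exists>T. \<forall>n. lifts_to_order y (Suc n) (T n) \<and> (\<forall>a. T (Suc n) a - T n a \<in> power_ideal y (Suc n))"
    using dependent_nat_choice[of "\<lambda>n. lifts_to_order y (Suc n)"
        "\<lambda>n t t'. \<forall>a. t' a - t a \<in> power_ideal y (Suc n)"] lifts_to_next_order[OF y] by blast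
  then obtain T where T: "\<And>n. lifts_to_order y (Suc n) (T n)"
    and T_step: "\<And>n a. T (Suc n) a - T n a \<in> power_ideal y (Suc n)" by blast
  have TR: "T n a \<in> R" and T_add: "T n (a + c) = T n a + T n c"
    and T_scale: "T n (scaleD r a) = homothety s r * T n a"
    and T_one: "T n 1 = e" and T_pi: "pi (T n a) = a" and T_mult: "T n a * T n c - T n (a * c) \<in> power_ideal y (Suc n)"
    for n a c r using T by (auto simp: lifts_to_order_def)
  have "\<exists>N. \<forall>c\<in>V. \<forall>n\<ge>N c. \<forall>r\<in>power_ideal y n. ap r c = 0"
  proof -
    have "\<exists>N. \<forall>n\<ge>N. \<forall>r\<in>power_ideal y n. ap r c = 0" if c: "c \<in> V" for c
    proof -
      obtain N where N: "\<And>n g. n \<ge> N \<Longrightarrow> g \<in> R \<Longrightarrow> ap (y ^ n * g) c = 0"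
        using nilpotent_at[OF y c] by blast
      have "ap r c = 0" if "n \<ge> N" "r \<in> power_ideal y n" for n r
      proof -
        obtain g where "g \<in> R" "ap r c = ap (y ^ n * g) c" using \<open>r \<in> power_ideal y n\<close> c by (auto simp: power_ideal_def)
        then show ?thesis using N[OF \<open>n \<ge> N\<close>] by simp
      qed
      then show ?thesis by blast
    qed
    then show ?thesis by metis
  qed
  then obtain N where N: "\<And>c n r. c \<in> V \<Longrightarrow> n \<ge> N c \<Longrightarrow> r \<in> power_ideal y n \<Longrightarrow> ap r c = 0" by blast
  have const: "ap (T n a) c = ap (T (N c) a) c" if "c \<in> V" "n \<ge> N c" for n a c
    using that(2)
  proof (induction n rule: dec_induct)
    case (step n)
    have "ap (T (Suc n) a - T n a) c = 0"
      using N[OF that(1) _ T_step] step.hyps by simp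
    then show ?case using step by simp
  qed simp
  have "\<exists>r\<in>R. \<forall>c\<in>V. \<exists>N. \<forall>n\<ge>N. ap r c = ap (T n a) c" for a
    by (rule pointwise_limit) (use TR const in blast)+
  then obtain \<delta> where \<delta>: "\<And>a. \<delta> a \<in> R"
    and lim: "\<And>a c. c \<in> V \<Longrightarrow> \<exists>N. \<forall>n\<ge>N. ap (\<delta> a) c = ap (T n a) c" by metis
  have ap_\<delta>: "ap (\<delta> a) c = ap (T n a) c" if c: "c \<in> V" "n \<ge> N c" for a c n
  proof -
    obtain M where "\<forall>n\<ge>M. ap (\<delta> a) c = ap (T n a) c" using lim[OF c(1)] by blast
    then have "ap (\<delta> a) c = ap (T (max M (N c)) a) c" by simp
    then show ?thesis using const[OF c] const[OF c(1), of "max M (N c)"] by simp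
  qed
  show thesis
  proof
    fix a c r
    show "\<delta> a \<in> R" by fact
    show "\<delta> (a + c) = \<delta> a + \<delta> c"
      by (rule R_eqI) (simp_all add: \<delta> R_add ap_\<delta>[OF _ order_refl] T_add)
    show "\<delta> (scaleD r a) = homothety s r * \<delta> a"
      by (rule R_eqI) (simp_all add: \<delta> R_scale ap_\<delta>[OF _ order_refl] T_scale)
    show "\<delta> 1 = e"
      by (rule R_eqI) (simp_all add: \<delta> e(1) ap_\<delta>[OF _ order_refl] T_one)
    show "pi (\<delta> a) = a"
    proof -
      have "\<delta> a - T 0 a \<in> J"
        unfolding J_def
      proof (intro CollectI conjI ballI)
        show "\<delta> a - T 0 a \<in> R" using R_diff \<delta> TR by blast
        fix c assume c: "c \<in> C0"
        then have cV: "c \<in> V" using C0 by (auto simp: operator_submodule_def)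
        have "T (N c) a - T 0 a \<in> J" by (simp add: J_iff R_diff TR pi_diff T_pi)
        then have "ap (T (N c) a - T 0 a) c = 0" using c by (simp add: J_def)
        then show "ap (\<delta> a - T 0 a) c = 0" by (simp add: ap_\<delta>[OF cV order_refl])
      qed
      then show ?thesis by (simp add: J_iff pi_diff \<delta> TR T_pi)
    qed
    show "\<delta> (a * c) = \<delta> a * \<delta> c"
    proof (rule R_eqI)
      fix v assume v: "v \<in> V"
      define w where "w = ap (\<delta> c) v"
      have w: "w \<in> V" using R_into \<delta> by (simp add: w_def)
      define n where "n = max (N v) (N w)"
      have "ap (T n a * T n c - T n (a * c)) v = 0"
        by (rule N[OF v _ T_mult]) (simp add: n_def)
      then have "ap (T n (a * c)) v = ap (T n a) (ap (T n c) v)" by simp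
      also have "ap (T n c) v = w" unfolding w_def by (rule ap_\<delta>[symmetric]) (simp_all add: v n_def)
      also have "ap (T n a) w = ap (\<delta> a) w" by (rule ap_\<delta>[symmetric]) (simp_all add: w n_def)
      finally have "ap (T n (a * c)) v = ap (\<delta> a) w" .
      then show "ap (\<delta> (a * c)) v = ap (\<delta> a * \<delta> c) v"
        using ap_\<delta>[OF v, of n "a * c"] by (simp add: w_def n_def)
    qed (simp_all add: \<delta> R_mult)
  qed
qed

section \<open>A central generator of the radical\<close>

text \<open>
  Let \<open>y\<close> be nonzero on the second layer \<open>C1\<close>. Write the coordinate functions of a basis of \<open>D\<close> as
  two-sided multiplications. Applied to \<open>y\<close> in the \<open>D\<close>-bimodule \<open>R\<close>, they yield elements \<open>E k\<close>
  that commute with \<open>\<delta>\<close>, because coordinates are scalars, and the expansion of the elements of \<open>D\<close>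
  in the basis becomes \<open>y = (\<Sum>k\<in>B. \<delta> k * E k)\<close>. Hence some \<open>E k\<close> is nonzero on \<open>C1\<close> as well.
\<close>

lemma central_generator_exists:
  assumes \<delta>R: "\<And>a. \<delta> a \<in> R" and \<delta>_add: "\<And>a c. \<delta> (a + c) = \<delta> a + \<delta> c"
    and \<delta>_scale: "\<And>r a. \<delta> (scaleD r a) = homothety s r * \<delta> a"
    and \<delta>_one: "\<delta> 1 = e" and \<delta>_mult: "\<And>a c. \<delta> (a * c) = \<delta> a * \<delta> c"
  obtains x where "x \<in> J" "max_kernel x \<subseteq> C0" "\<And>a. \<delta> a * x = x * \<delta> a"
proof (rule second_layer)
  assume "V \<subseteq> C0"
  then have "max_kernel 0 \<subseteq> C0" by (auto simp: max_kernel_def)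
  then show thesis using that[of 0] J_zero by simp
next
  fix C1 y
  assume C1: "submod C1" and y: "y \<in> J" "\<exists>c\<in>C1. eps (ap y c) \<noteq> 0"
    and Kx: "\<And>x. x \<in> J \<Longrightarrow> \<exists>c\<in>C1. eps (ap x c) \<noteq> 0 \<Longrightarrow> max_kernel x \<subseteq> C0"
  obtain B where B: "finite B" "D.independent B" "D.span B = UNIV" by (rule D.finite_basis_exists)
  define rep where "rep x k = D.representation B x k" for x k
  have inB: "a \<in> D.span B" for a using B by simp
  have lin: "Vector_Spaces.linear scaleD (*) (\<lambda>x. rep x k)" for k
  proof -
    interpret F: vector_space "(*) :: 'k \<Rightarrow> 'k \<Rightarrow> 'k" by (rule vector_space_field)
    show ?thesis
      by unfold_locales
        (simp_all add: rep_def D.representation_add[OF B(2) inB inB] D.representation_scale[OF B(2) inB])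
  qed
  have "\<exists>b. \<forall>x. (\<Sum>u\<in>B. u * x * b u) = scaleD (rep x k) 1" for k
    using D.functional_as_two_sided_multiplications[OF B lin] by metis
  then obtain b where b: "\<And>k x. (\<Sum>u\<in>B. u * x * b k u) = scaleD (rep x k) 1" by metis
  have comm: "\<delta> a * homothety s r = homothety s r * \<delta> a" for a r by (rule R_commute) (rule \<delta>R)
  have yR: "y \<in> R" using J_R y by simp
  have ycomm: "y * homothety s r = homothety s r * y" for r by (rule R_commute) (rule yR)
  define \<beta> where "\<beta> p q = \<delta> p * y * \<delta> q" for p q
  have bil: "\<beta> (a + a') c = \<beta> a c + \<beta> a' c" "\<beta> a (c + c') = \<beta> a c + \<beta> a c'"
    "\<beta> (scaleD r a) c = \<beta> a (scaleD r c)" for a a' c c' r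
  proof -
    show "\<beta> (a + a') c = \<beta> a c + \<beta> a' c" "\<beta> a (c + c') = \<beta> a c + \<beta> a c'"
      by (simp_all add: \<beta>_def \<delta>_add distrib_left distrib_right)
    show "\<beta> (scaleD r a) c = \<beta> a (scaleD r c)"
      unfolding \<beta>_def \<delta>_scale by (metis comm ycomm mult.assoc)
  qed
  define E where "E k = (\<Sum>u\<in>B. \<beta> u (b k u))" for k
  have EJ: "E k \<in> J" for k
    unfolding E_def \<beta>_def by (intro J_sum J_mult_right J_mult_left \<delta>R y)
  have E_comm: "\<delta> a * E k = E k * \<delta> a" for a k
  proof -
    have "\<delta> a * E k = (\<Sum>u\<in>B. \<beta> (a * u) (b k u))"
      by (simp add: E_def \<beta>_def sum_distrib_left \<delta>_mult mult.assoc)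
    also have "\<dots> = (\<Sum>u\<in>B. \<beta> u (b k u * a))"
      by (rule D.two_sided_multiplication_balanced[OF bil b])
    also have "\<dots> = E k * \<delta> a"
      by (simp add: E_def \<beta>_def sum_distrib_right \<delta>_mult mult.assoc)
    finally show ?thesis .
  qed
  have "y = (\<Sum>k\<in>B. \<delta> k * E k)"
  proof -
    have "(\<Sum>k\<in>B. \<delta> k * E k) = (\<Sum>p\<in>B \<times> B. \<beta> (fst p * snd p) (b (fst p) (snd p)))"
      by (simp add: E_def \<beta>_def sum_distrib_left sum.cartesian_product split_def \<delta>_mult mult.assoc)
    also have "\<dots> = (\<Sum>p\<in>{()}. \<beta> 1 1)"
    proof (rule D.balanced_sum_eqI[OF bil])
      fix x
      have "(\<Sum>p\<in>B \<times> B. fst p * snd p * x * b (fst p) (snd p)) = (\<Sum>k\<in>B. k * (\<Sum>u\<in>B. u * x * b k u))"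
        by (simp add: sum_distrib_left sum.cartesian_product split_def mult.assoc)
      also have "\<dots> = x"
        by (simp add: b D.scale_mult_right rep_def D.sum_representation_eq[OF B(2)] B)
      finally show "(\<Sum>p\<in>B \<times> B. fst p * snd p * x * b (fst p) (snd p)) = (\<Sum>p\<in>{()}. 1 * x * 1)"
        by simp
    qed
    also have "\<dots> = y" by (simp add: \<beta>_def \<delta>_one e yR)
    finally show ?thesis by simp
  qed
  moreover obtain c where c: "c \<in> C1" "eps (ap y c) \<noteq> 0" using y by blast
  ultimately have "(\<Sum>k\<in>B. eps (ap (\<delta> k * E k) c)) \<noteq> 0"
    by (metis ap_sum_left eps.sum)
  then obtain k where k: "eps (ap (\<delta> k * E k) c) \<noteq> 0" by (meson sum.neutral)
  then have "eps (ap (E k) (ap (\<delta> k) c)) \<noteq> 0" unfolding E_comm by simp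
  moreover have "ap (\<delta> k) c \<in> C1" using submod_ap[OF C1 \<delta>R c(1)] .
  ultimately have "max_kernel (E k) \<subseteq> C0" using Kx[OF EJ] by blast
  then show thesis using that EJ E_comm by blast
qed

text \<open>
  Modulo \<open>J\<close> every \<open>h\<close> in \<open>R\<close> is some \<open>\<delta> d\<close>, and the rest acts on \<open>c\<close> as \<open>x g\<close> for some
  \<open>g\<close> in \<open>R\<close>. Repeating this with \<open>g\<close> expands \<open>h c\<close> in powers of \<open>x\<close> with coefficients
  in the image of \<open>\<delta>\<close>; the expansion stops because \<open>x\<close> is nilpotent on \<open>R c\<close>.
\<close>

lemma power_series_generation:
  obtains \<delta> x where "\<And>a. \<delta> a \<in> R" "\<And>a c. \<delta> (a + c) = \<delta> a + \<delta> c"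
    "\<And>r a. \<delta> (scaleD r a) = homothety s r * \<delta> a" "\<delta> 1 = e"
    "\<And>a c. \<delta> (a * c) = \<delta> a * \<delta> c" "x \<in> R" "\<And>a. \<delta> a * x = x * \<delta> a"
    "\<And>c. c \<in> V \<Longrightarrow> \<exists>n. \<forall>m\<ge>n. \<forall>g\<in>R. ap (x ^ m * g) c = 0"
    "\<And>h c. h \<in> R \<Longrightarrow> c \<in> V \<Longrightarrow> \<exists>n d. ap h c = (\<Sum>i<n. ap (\<delta> (d i) * x ^ i) c)"
proof -
  obtain \<delta> where \<delta>: "\<And>a. \<delta> a \<in> R" "\<And>a c. \<delta> (a + c) = \<delta> a + \<delta> c"
    "\<And>r a. \<delta> (scaleD r a) = homothety s r * \<delta> a" "\<delta> 1 = e"  "\<And>a. pi (\<delta> a) = a"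
    "\<And>a c. \<delta> (a * c) = \<delta> a * \<delta> c"
    by (rule lifting_exists) blast
  obtain x where x: "x \<in> J" "max_kernel x \<subseteq> C0" "\<And>a. \<delta> a * x = x * \<delta> a"
    by (rule central_generator_exists[of \<delta>]) (use \<delta> in blast)+
  have expand: "\<exists>d. \<exists>g\<in>R. ap h c = (\<Sum>i<n. ap (\<delta> (d i) * x ^ i) c) + ap (x ^ n * g) c"
    if h: "h \<in> R" and c: "c \<in> V" for h c n
  proof (induction n)
    case 0
    then show ?case using h by (auto intro!: bexI[of _ h])
  next
    case (Suc n)
    then obtain d g where g: "g \<in> R" "ap h c = (\<Sum>i<n. ap (\<delta> (d i) * x ^ i) c) + ap (x ^ n * g) c"
      by blast
    have "g - \<delta> (pi g) \<in> J" by (simp add: J_iff R_diff pi_diff g \<delta>)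
    from locally_principal[OF x(1,2) this c] obtain g' where
      g': "g' \<in> R" "ap (g - \<delta> (pi g)) c = ap (x * g') c" by blast
    have "ap (x ^ n * g) c = ap (x ^ n * \<delta> (pi g)) c + ap (x ^ n) (ap (g - \<delta> (pi g)) c)" by simp
    also have "\<dots> = ap (\<delta> (pi g) * x ^ n) c + ap (x ^ Suc n * g') c"
      using power_commute[OF x(3), of "pi g" n] g'(2) by (simp add: power_Suc2 del: power_Suc)
    finally have "ap h c = (\<Sum>i<Suc n. ap (\<delta> ((d(n := pi g)) i) * x ^ i) c) + ap (x ^ Suc n * g') c"
      using g(2) by simp
    then show ?case using g'(1) by blast
  qed
  have nil: "\<exists>n. \<forall>m\<ge>n. \<forall>g\<in>R. ap (x ^ m * g) c = 0" if "c \<in> V" for c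
    using nilpotent_at[OF x(1,2) that] .
  have "\<exists>n d. ap h c = (\<Sum>i<n. ap (\<delta> (d i) * x ^ i) c)" if h: "h \<in> R" and c: "c \<in> V" for h c
  proof -
    obtain n where "\<forall>g\<in>R. ap (x ^ n * g) c = 0" using nil[OF c] by blast
    then show ?thesis using expand[OF h c, of n] by (metis add.right_neutral)
  qed
  then show thesis using that[of \<delta> x] \<delta> x J_R nil by blast
qed

end

section \<open>Tensors\<close>

lemma lookup_free_scale: "Poly_Mapping.lookup (free_scale a t) p = a * Poly_Mapping.lookup t p"
  by (simp add: free_scale_def Poly_Mapping.map.rep_eq when_def)

lemma vector_space_free: "vector_space (free_scale :: 'k::field \<Rightarrow> ('b \<Rightarrow>\<^sub>0 'k) \<Rightarrow> 'b \<Rightarrow>\<^sub>0 'k)"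
  by unfold_locales
    (auto intro!: poly_mapping_eqI simp: lookup_free_scale lookup_add algebra_simps)

interpretation free: vector_space "free_scale :: 'k::field \<Rightarrow> ('b \<Rightarrow>\<^sub>0 'k) \<Rightarrow> 'b \<Rightarrow>\<^sub>0 'k"
  by (rule vector_space_free)

lemma free_scale_single: "free_scale a (Poly_Mapping.single p b) = Poly_Mapping.single p (a * b)"
  by (rule poly_mapping_eqI) (simp add: lookup_free_scale lookup_single when_def)

lemma sum_of_singles:
  "(\<Sum>p\<in>Poly_Mapping.keys t. Poly_Mapping.single p (Poly_Mapping.lookup t p)) = t"
  by (rule poly_mapping_eqI)
    (auto simp: lookup_sum lookup_single when_def in_keys_iff if_distrib
      cong: if_cong intro!: trans[OF sum.cong])

lemma keys_diff:
  "Poly_Mapping.keys (t - u) \<subseteq> Poly_Mapping.keys t \<union> Poly_Mapping.keys u"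
  by (auto simp: in_keys_iff lookup_minus)

context vector_space
begin

lemma lin_ext_superset:
  assumes "finite A" "Poly_Mapping.keys t \<subseteq> A"
  shows "lin_ext scale F t = (\<Sum>p\<in>A. scale (Poly_Mapping.lookup t p) (F p))"
  unfolding lin_ext_def by (rule sum.mono_neutral_left) (use assms in \<open>auto simp: in_keys_iff\<close>)

lemma linear_lin_ext:
  fixes F :: "'e \<Rightarrow> 'b"
  shows "Vector_Spaces.linear free_scale scale (lin_ext scale F)"
proof (unfold_locales)
  fix t u :: "'e \<Rightarrow>\<^sub>0 'a"
  let ?A = "Poly_Mapping.keys t \<union> Poly_Mapping.keys u"
  have "Poly_Mapping.keys (t + u) \<subseteq> ?A" by (rule keys_add)
  then show "lin_ext scale F (t + u) = lin_ext scale F t + lin_ext scale F u"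
    by (simp add: lin_ext_superset[of ?A] lookup_add scale_left_distrib sum.distrib)
next
  fix a and t :: "'e \<Rightarrow>\<^sub>0 'a"
  have "Poly_Mapping.keys (free_scale a t) \<subseteq> Poly_Mapping.keys t"
    by (auto simp: in_keys_iff lookup_free_scale)
  then show "lin_ext scale F (free_scale a t) = scale a (lin_ext scale F t)"
    by (simp add: lin_ext_superset[of "Poly_Mapping.keys t"] lookup_free_scale scale_sum_right)
qed

lemma lin_ext_single: "lin_ext scale F (Poly_Mapping.single p a) = scale a (F p)"
  by (cases "a = 0") (simp_all add: lin_ext_def)

lemma lin_ext_cong:
  "(\<And>p. p \<in> Poly_Mapping.keys t \<Longrightarrow> F p = G p) \<Longrightarrow> lin_ext scale F t = lin_ext scale G t"
  unfolding lin_ext_def by (rule sum.cong) auto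

lemma lin_ext_add: "lin_ext scale F (t + u) = lin_ext scale F t + lin_ext scale F u"
  and lin_ext_diff: "lin_ext scale F (t - u) = lin_ext scale F t - lin_ext scale F u"
  and lin_ext_scale: "lin_ext scale F (free_scale a t) = scale a (lin_ext scale F t)"
  and lin_ext_sum: "lin_ext scale F (\<Sum>i\<in>A. g i) = (\<Sum>i\<in>A. lin_ext scale F (g i))"
proof -
  interpret L: Vector_Spaces.linear free_scale scale "lin_ext scale F" by (rule linear_lin_ext)
  show "lin_ext scale F (t + u) = lin_ext scale F t + lin_ext scale F u"
    "lin_ext scale F (t - u) = lin_ext scale F t - lin_ext scale F u"
    "lin_ext scale F (free_scale a t) = scale a (lin_ext scale F t)"
    "lin_ext scale F (\<Sum>i\<in>A. g i) = (\<Sum>i\<in>A. lin_ext scale F (g i))"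
    by (rule L.add L.diff L.scale L.sum)+
qed

lemma lin_ext_lin_ext:
  "lin_ext scale F (lin_ext free_scale G t) = lin_ext scale (\<lambda>p. lin_ext scale F (G p)) t"
proof -
  have "lin_ext scale F (lin_ext free_scale G t) =
      lin_ext scale F (\<Sum>p\<in>Poly_Mapping.keys t. free_scale (Poly_Mapping.lookup t p) (G p))"
    by (simp add: lin_ext_def[of free_scale])
  also have "\<dots> = lin_ext scale (\<lambda>p. lin_ext scale F (G p)) t"
    by (simp only: lin_ext_sum lin_ext_scale lin_ext_def[of scale "\<lambda>p. lin_ext scale F (G p)"])
  finally show ?thesis .
qed

lemma lin_ext_in_subspace:
  "subspace U \<Longrightarrow> (\<And>p. p \<in> Poly_Mapping.keys t \<Longrightarrow> F p \<in> U) \<Longrightarrow> lin_ext scale F t \<in> U"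
  unfolding lin_ext_def by (intro subspace_sum subspace_scale)

lemma lin_ext_image:
  assumes V: "subspace V" and f: "linear_on scale s' V f" and "vector_space s'"
    and F: "\<And>p. p \<in> Poly_Mapping.keys t \<Longrightarrow> F p \<in> V"
  shows "f (lin_ext scale F t) = lin_ext s' (\<lambda>p. f (F p)) t"
proof -
  interpret s': vector_space s' by fact
  have f0: "f 0 = 0" using f subspace_0[OF V] unfolding linear_on_def by (metis add_cancel_right_left)
  have "f (\<Sum>p\<in>A. scale (c p) (F p)) = (\<Sum>p\<in>A. s' (c p) (f (F p))) \<and> (\<Sum>p\<in>A. scale (c p) (F p)) \<in> V"
    if "finite A" "A \<subseteq> Poly_Mapping.keys t" for A c
    using that
  proof (induction A rule: finite_induct)
    case empty
    then show ?case using f0 subspace_0[OF V] by simp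
  next
    case (insert p A)
    then show ?case using f F[of p] V
      by (auto simp: linear_on_def subspace_add subspace_scale)
  qed
  then show ?thesis by (simp add: lin_ext_def)
qed

end

definition bilinear_on where
  "bilinear_on s s' V \<beta> \<longleftrightarrow>
     (\<forall>y\<in>V. linear_on s s' V (\<lambda>x. \<beta> x y)) \<and> (\<forall>x\<in>V. linear_on s s' V (\<beta> x))"

definition trilinear_on where
  "trilinear_on s s' V \<tau> \<longleftrightarrow> (\<forall>y\<in>V. \<forall>z\<in>V. linear_on s s' V (\<lambda>x. \<tau> x y z) \<and>
     linear_on s s' V (\<lambda>x. \<tau> y x z) \<and> linear_on s s' V (\<lambda>x. \<tau> y z x))"

lemma lin_ext_slot_rels:
  assumes s': "vector_space s'" and F: "linear_on s s' V (\<lambda>x. F (\<iota> x))" and t: "t \<in> slot_rels s V \<iota>"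
  shows "lin_ext s' F t = 0"
proof -
  interpret s': vector_space s' by fact
  show ?thesis
    using t F by (auto simp: slot_rels_def linear_on_def s'.lin_ext_diff s'.lin_ext_single
        s'.lin_ext_scale)
qed

lemma lin_ext_tensor2_eq:
  assumes s': "vector_space s'" and \<beta>: "bilinear_on s s' V \<beta>" and eq: "tensor2_eq s V t u"
  shows "lin_ext s' (\<lambda>(x, y). \<beta> x y) t = lin_ext s' (\<lambda>(x, y). \<beta> x y) u"
proof -
  interpret s': vector_space s' by fact
  interpret L: Vector_Spaces.linear free_scale s' "lin_ext s' (\<lambda>(x, y). \<beta> x y)"
    by (rule s'.linear_lin_ext)
  have "lin_ext s' (\<lambda>(x, y). \<beta> x y) (t - u) = 0"
  proof (rule L.eq_0_on_span)
    show "t - u \<in> free.span (\<Union>y\<in>V. slot_rels s V (\<lambda>x. (x, y)) \<union> slot_rels s V (\<lambda>x. (y, x)))"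
      using eq by (simp add: tensor2_eq_def)
    fix r assume "r \<in> (\<Union>y\<in>V. slot_rels s V (\<lambda>x. (x, y)) \<union> slot_rels s V (\<lambda>x. (y, x)))"
    then obtain y where "y \<in> V" "r \<in> slot_rels s V (\<lambda>x. (x, y)) \<or> r \<in> slot_rels s V (\<lambda>x. (y, x))" by auto
    then show "lin_ext s' (\<lambda>(x, y). \<beta> x y) r = 0"
      using \<beta> by (elim disjE) (rule lin_ext_slot_rels[OF s'], auto simp: bilinear_on_def)+
  qed
  then show ?thesis by (simp add: L.diff)
qed

lemma lin_ext_tensor3_eq:
  assumes s': "vector_space s'" and \<tau>: "trilinear_on s s' V \<tau>" and eq: "tensor3_eq s V t u"
  shows "lin_ext s' (\<lambda>(x, y, z). \<tau> x y z) t = lin_ext s' (\<lambda>(x, y, z). \<tau> x y z) u"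
proof -
  interpret s': vector_space s' by fact
  interpret L: Vector_Spaces.linear free_scale s' "lin_ext s' (\<lambda>(x, y, z). \<tau> x y z)"
    by (rule s'.linear_lin_ext)
  have "lin_ext s' (\<lambda>(x, y, z). \<tau> x y z) (t - u) = 0"
  proof (rule L.eq_0_on_span)
    show "t - u \<in> free.span (\<Union>y\<in>V. \<Union>z\<in>V. slot_rels s V (\<lambda>x. (x, y, z)) \<union> slot_rels s V (\<lambda>x. (y, x, z))
                        \<union> slot_rels s V (\<lambda>x. (y, z, x)))"
      using eq by (simp add: tensor3_eq_def)
    fix r assume "r \<in> (\<Union>y\<in>V. \<Union>z\<in>V. slot_rels s V (\<lambda>x. (x, y, z)) \<union> slot_rels s V (\<lambda>x. (y, x, z))
                        \<union> slot_rels s V (\<lambda>x. (y, z, x)))"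
    then obtain y z where "y \<in> V" "z \<in> V" "r \<in> slot_rels s V (\<lambda>x. (x, y, z)) \<or>
        r \<in> slot_rels s V (\<lambda>x. (y, x, z)) \<or> r \<in> slot_rels s V (\<lambda>x. (y, z, x))" by auto
    then show "lin_ext s' (\<lambda>(x, y, z). \<tau> x y z) r = 0"
      using \<tau> by (elim disjE) (rule lin_ext_slot_rels[OF s'], auto simp: trilinear_on_def)+
  qed
  then show ?thesis by (simp add: L.diff)
qed

lemma tensor2_eq_refl: "tensor2_eq s V t t"
  by (simp add: tensor2_eq_def free.span_zero)

lemma tensor2_eq_sym: "tensor2_eq s V t u \<Longrightarrow> tensor2_eq s V u t"
  using free.span_neg[of "t - u"] by (simp add: tensor2_eq_def)

lemma tensor2_eq_trans: "tensor2_eq s V t u \<Longrightarrow> tensor2_eq s V u v \<Longrightarrow> tensor2_eq s V t v"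
  using free.span_add[of "t - u" _ "u - v"] by (simp add: tensor2_eq_def)

lemma tensor2_eq_add: "tensor2_eq s V t u \<Longrightarrow> tensor2_eq s V t' u' \<Longrightarrow> tensor2_eq s V (t + t') (u + u')"
  using free.span_add[of "t - u" _ "t' - u'"] by (simp add: tensor2_eq_def algebra_simps)

lemma tensor2_eq_sum:
  "(\<And>i. i \<in> A \<Longrightarrow> tensor2_eq s V (f i) (g i)) \<Longrightarrow> tensor2_eq s V (sum f A) (sum g A)"
  by (induction A rule: infinite_finite_induct) (auto intro: tensor2_eq_refl tensor2_eq_add)

abbreviation pure :: "'v \<Rightarrow> 'v \<Rightarrow> ('v \<times> 'v \<Rightarrow>\<^sub>0 'k::field)" where
  "pure x y \<equiv> Poly_Mapping.single (x, y) 1"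

lemma tensor2_eq_slot:
  assumes "y \<in> V" "t - u \<in> slot_rels s V (\<lambda>x. (x, y)) \<or> t - u \<in> slot_rels s V (\<lambda>x. (y, x))"
  shows "tensor2_eq s V t u"
  unfolding tensor2_eq_def using assms by (intro free.span_base) blast

lemma slot_rels_add: "x \<in> V \<Longrightarrow> x' \<in> V \<Longrightarrow>
    Poly_Mapping.single (\<iota> (x + x')) 1 - (Poly_Mapping.single (\<iota> x) 1 + Poly_Mapping.single (\<iota> x') 1)
      \<in> slot_rels s V \<iota>"
  unfolding slot_rels_def by (rule UnI1) (force simp: algebra_simps)

lemma slot_rels_scale: "x \<in> V \<Longrightarrow>
    Poly_Mapping.single (\<iota> (s a x)) 1 - free_scale a (Poly_Mapping.single (\<iota> x) 1) \<in> slot_rels s V \<iota>"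
  unfolding slot_rels_def by (rule UnI2) blast

lemma tensor2_eq_add_left:
  "x \<in> V \<Longrightarrow> x' \<in> V \<Longrightarrow> y \<in> V \<Longrightarrow> tensor2_eq s V (pure (x + x') y) (pure x y + pure x' y)"
  using slot_rels_add[of x V x' "\<lambda>x. (x, y)" s] by (intro tensor2_eq_slot[of y]) auto

lemma tensor2_eq_add_right:
  "x \<in> V \<Longrightarrow> y \<in> V \<Longrightarrow> y' \<in> V \<Longrightarrow> tensor2_eq s V (pure x (y + y')) (pure x y + pure x y')"
  using slot_rels_add[of y V y' "\<lambda>y. (x, y)" s] by (intro tensor2_eq_slot[of x]) auto

lemma tensor2_eq_scale_left:
  "x \<in> V \<Longrightarrow> y \<in> V \<Longrightarrow> tensor2_eq s V (pure (s a x) y) (free_scale a (pure x y))"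
  using slot_rels_scale[of x V "\<lambda>x. (x, y)" s a] by (intro tensor2_eq_slot[of y]) auto

lemma tensor2_eq_scale_right:
  "x \<in> V \<Longrightarrow> y \<in> V \<Longrightarrow> tensor2_eq s V (pure x (s a y)) (free_scale a (pure x y))"
  using slot_rels_scale[of y V "\<lambda>y. (x, y)" s a] by (intro tensor2_eq_slot[of x]) auto

context vector_space
begin

lemma span_image_coefficients:
  assumes "finite A" "x \<in> span (w ` A)"
  shows "\<exists>b. x = (\<Sum>i\<in>A. scale (b i) (w i))"
  using assms
proof (induction A arbitrary: x rule: finite_induct)
  case empty
  then show ?case by simp
next
  case (insert j A)
  then obtain k where "x - scale k (w j) \<in> span (w ` A)" by (auto simp: span_breakdown_eq)
  from insert.IH[OF this] obtain b where b: "x - scale k (w j) = (\<Sum>i\<in>A. scale (b i) (w i))" by blast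
  have "(\<Sum>i\<in>A. scale ((b(j := k)) i) (w i)) = (\<Sum>i\<in>A. scale (b i) (w i))"
    using insert.hyps by (intro sum.cong) auto
  then have "x = (\<Sum>i\<in>insert j A. scale ((b(j := k)) i) (w i))"
    using insert.hyps b by (simp add: algebra_simps)
  then show ?case by blast
qed

lemma tensor_sum_right:
  assumes V: "subspace V" and x: "x \<in> V" and w: "\<And>i. i \<in> A \<Longrightarrow> w i \<in> V" and "finite A"
  shows "tensor2_eq scale V (pure x (\<Sum>i\<in>A. scale (b i) (w i))) (\<Sum>i\<in>A. pure (scale (b i) x) (w i))"
  using \<open>finite A\<close> w
proof (induction A rule: finite_induct)
  case empty
  have "tensor2_eq scale V (pure x (scale 0 0)) (free_scale 0 (pure x 0))"
    using V x by (intro tensor2_eq_scale_right) (auto intro: subspace_0)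
  then show ?case by simp
next
  case (insert j A)
  have sV: "(\<Sum>i\<in>A. scale (b i) (w i)) \<in> V"
    using V insert.prems by (intro subspace_sum) (auto intro: subspace_scale)
  have "tensor2_eq scale V (pure x (scale (b j) (w j))) (pure (scale (b j) x) (w j))"
    using x insert.prems by (blast intro: tensor2_eq_trans tensor2_eq_scale_right
        tensor2_eq_sym[OF tensor2_eq_scale_left])
  moreover have "tensor2_eq scale V (pure x (scale (b j) (w j) + (\<Sum>i\<in>A. scale (b i) (w i))))
      (pure x (scale (b j) (w j)) + pure x (\<Sum>i\<in>A. scale (b i) (w i)))"
    using V x insert.prems sV by (intro tensor2_eq_add_right) (auto intro: subspace_scale)
  ultimately show ?case
    using insert by (simp, blast intro: tensor2_eq_trans tensor2_eq_add)
qed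

lemma tensor_sum_left:
  assumes V: "subspace V" and y: "y \<in> V" and v: "\<And>i. i \<in> A \<Longrightarrow> v i \<in> V" and "finite A"
  shows "tensor2_eq scale V (pure (\<Sum>i\<in>A. scale (b i) (v i)) y) (\<Sum>i\<in>A. pure (v i) (scale (b i) y))"
  using \<open>finite A\<close> v
proof (induction A rule: finite_induct)
  case empty
  have "tensor2_eq scale V (pure (scale 0 0) y) (free_scale 0 (pure 0 y))"
    using V y by (intro tensor2_eq_scale_left) (auto intro: subspace_0)
  then show ?case by simp
next
  case (insert j A)
  have sV: "(\<Sum>i\<in>A. scale (b i) (v i)) \<in> V"
    using V insert.prems by (intro subspace_sum) (auto intro: subspace_scale)
  have "tensor2_eq scale V (pure (scale (b j) (v j)) y) (pure (v j) (scale (b j) y))"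
    using y insert.prems by (blast intro: tensor2_eq_trans tensor2_eq_scale_left
        tensor2_eq_sym[OF tensor2_eq_scale_right])
  moreover have "tensor2_eq scale V (pure (scale (b j) (v j) + (\<Sum>i\<in>A. scale (b i) (v i))) y)
      (pure (scale (b j) (v j)) y + pure (\<Sum>i\<in>A. scale (b i) (v i)) y)"
    using V y insert.prems sV by (intro tensor2_eq_add_left) (auto intro: subspace_scale)
  ultimately show ?case
    using insert by (simp, blast intro: tensor2_eq_trans tensor2_eq_add)
qed

text \<open>
  In a representation with as few terms as possible each side is linearly independent: a vector that
  is a combination of the others on its side can be eliminated by moving scalars across the tensor sign.
\<close>

lemma minimal_tensor_representation:
  assumes V: "subspace V" and t: "Poly_Mapping.keys t \<subseteq> V \<times> V"
  obtains I :: "nat set" and v w where "finite I" "\<And>i. i \<in> I \<Longrightarrow> v i \<in> V" "\<And>i. i \<in> I \<Longrightarrow> w i \<in> V"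
    "tensor2_eq scale V t (\<Sum>i\<in>I. pure (v i) (w i))"
    "\<And>j. j \<in> I \<Longrightarrow> v j \<notin> span (v ` (I - {j}))" "\<And>j. j \<in> I \<Longrightarrow> w j \<notin> span (w ` (I - {j}))"
proof -
  define P where "P = (\<lambda>(I :: nat set, v, w). finite I \<and> (\<forall>i\<in>I. v i \<in> V \<and> w i \<in> V) \<and>
    tensor2_eq scale V t (\<Sum>i\<in>I. pure (v i) (w i)))"
  obtain h where h: "bij_betw h {0..<card (Poly_Mapping.keys t)} (Poly_Mapping.keys t)"
    using ex_bij_betw_nat_finite[OF finite_keys] by (rule exE)
  let ?I = "{0..<card (Poly_Mapping.keys t)}"
  have hV: "fst (h i) \<in> V" "snd (h i) \<in> V" if "i \<in> ?I" for i
  proof -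
    have "h i \<in> V \<times> V" using bij_betwE[OF h] that t by blast
    then show "fst (h i) \<in> V" "snd (h i) \<in> V" by (auto simp: mem_Times_iff)
  qed
  have "t = (\<Sum>p\<in>Poly_Mapping.keys t. Poly_Mapping.single p (Poly_Mapping.lookup t p))"
    by (simp only: sum_of_singles)
  also have "\<dots> = (\<Sum>i\<in>?I. free_scale (Poly_Mapping.lookup t (h i)) (pure (fst (h i)) (snd (h i))))"
    by (subst sum.reindex_bij_betw[OF h, symmetric]) (simp add: free_scale_single)
  finally have teq: "t = (\<Sum>i\<in>?I. free_scale (Poly_Mapping.lookup t (h i)) (pure (fst (h i)) (snd (h i))))" .
  have "tensor2_eq scale V t (\<Sum>i\<in>?I. pure (scale (Poly_Mapping.lookup t (h i)) (fst (h i))) (snd (h i)))"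
    by (subst teq) (intro tensor2_eq_sum tensor2_eq_sym[OF tensor2_eq_scale_left] hV)
  then have "P (?I, \<lambda>i. scale (Poly_Mapping.lookup t (h i)) (fst (h i)), \<lambda>i. snd (h i))"
    using hV subspace_scale[OF V] unfolding P_def by (simp del: atLeastLessThan_iff)
  then obtain p where p: "P p" "\<And>q. P q \<Longrightarrow> card (fst p) \<le> card (fst q)"
    using ex_has_least_nat[of P _ "\<lambda>p. card (fst p)"] by blast
  obtain I v w where Ivw: "p = (I, v, w)" by (cases p)
  have I: "finite I" "\<And>i. i \<in> I \<Longrightarrow> v i \<in> V" "\<And>i. i \<in> I \<Longrightarrow> w i \<in> V"
    and eq: "tensor2_eq scale V t (\<Sum>i\<in>I. pure (v i) (w i))"
    using p(1) by (auto simp: P_def Ivw)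
  have smaller: False if j: "j \<in> I" and vw: "\<And>i. i \<in> I - {j} \<Longrightarrow> v' i \<in> V" "\<And>i. i \<in> I - {j} \<Longrightarrow> w' i \<in> V"
    and tq: "tensor2_eq scale V (pure (v j) (w j) + (\<Sum>i\<in>I - {j}. pure (v i) (w i))) (\<Sum>i\<in>I - {j}. pure (v' i) (w' i))"
    for j v' w'
  proof -
    have "(\<Sum>i\<in>I. pure (v i) (w i) :: 'b \<times> 'b \<Rightarrow>\<^sub>0 'a) = pure (v j) (w j) + (\<Sum>i\<in>I - {j}. pure (v i) (w i))"
      using I(1) j by (rule sum.remove)
    with tq have "tensor2_eq scale V (\<Sum>i\<in>I. pure (v i) (w i)) (\<Sum>i\<in>I - {j}. pure (v' i) (w' i))"
      by (simp only:)
    then have "tensor2_eq scale V t (\<Sum>i\<in>I - {j}. pure (v' i) (w' i))"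
      by (rule tensor2_eq_trans[OF eq])
    then have "P (I - {j}, v', w')" using vw I(1) by (simp add: P_def)
    from p(2)[OF this] show False using I(1) j card_Diff1_less[of I j] by (simp add: Ivw)
  qed
  show thesis
  proof (rule that[OF I eq])
    fix j assume j: "j \<in> I"
    show "w j \<notin> span (w ` (I - {j}))"
    proof
      assume "w j \<in> span (w ` (I - {j}))"
      then obtain b where b: "w j = (\<Sum>i\<in>I - {j}. scale (b i) (w i))"
        using span_image_coefficients[of "I - {j}"] I(1) by blast
      have "tensor2_eq scale V (pure (v j) (w j)) (\<Sum>i\<in>I - {j}. pure (scale (b i) (v j)) (w i))"
        unfolding b by (rule tensor_sum_right) (use V I j in auto)
      then have "tensor2_eq scale V (pure (v j) (w j) + (\<Sum>i\<in>I - {j}. pure (v i) (w i)))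
          (\<Sum>i\<in>I - {j}. pure (scale (b i) (v j)) (w i) + pure (v i) (w i))"
        unfolding sum.distrib by (rule tensor2_eq_add[OF _ tensor2_eq_refl])
      moreover have "tensor2_eq scale V (\<Sum>i\<in>I - {j}. pure (scale (b i) (v j)) (w i) + pure (v i) (w i))
          (\<Sum>i\<in>I - {j}. pure (scale (b i) (v j) + v i) (w i))"
        using V I j by (intro tensor2_eq_sum tensor2_eq_sym[OF tensor2_eq_add_left]) (auto intro: subspace_scale)
      ultimately show False
        by (intro smaller[OF j, of "\<lambda>i. scale (b i) (v j) + v i" w])
          (use V I j in \<open>auto intro: subspace_add subspace_scale tensor2_eq_trans\<close>)
    qed
    show "v j \<notin> span (v ` (I - {j}))"
    proof
      assume "v j \<in> span (v ` (I - {j}))"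
      then obtain b where b: "v j = (\<Sum>i\<in>I - {j}. scale (b i) (v i))"
        using span_image_coefficients[of "I - {j}"] I(1) by blast
      have "tensor2_eq scale V (pure (v j) (w j)) (\<Sum>i\<in>I - {j}. pure (v i) (scale (b i) (w j)))"
        unfolding b by (rule tensor_sum_left) (use V I j in auto)
      then have "tensor2_eq scale V (pure (v j) (w j) + (\<Sum>i\<in>I - {j}. pure (v i) (w i)))
          (\<Sum>i\<in>I - {j}. pure (v i) (scale (b i) (w j)) + pure (v i) (w i))"
        unfolding sum.distrib by (rule tensor2_eq_add[OF _ tensor2_eq_refl])
      moreover have "tensor2_eq scale V (\<Sum>i\<in>I - {j}. pure (v i) (scale (b i) (w j)) + pure (v i) (w i))
          (\<Sum>i\<in>I - {j}. pure (v i) (scale (b i) (w j) + w i))"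
        using V I j by (intro tensor2_eq_sum tensor2_eq_sym[OF tensor2_eq_add_right]) (auto intro: subspace_scale)
      ultimately show False
        by (intro smaller[OF j, of v "\<lambda>i. scale (b i) (w j) + w i"])
          (use V I j in \<open>auto intro: subspace_add subspace_scale tensor2_eq_trans\<close>)
    qed
  qed
qed

end

lemma vector_space_fun_scale: "vector_space (fun_scale :: 'k::field \<Rightarrow> ('a \<Rightarrow> 'k) \<Rightarrow> _)"
  unfolding fun_scale_def by (rule vector_space_fun) (rule vector_space_field)

text \<open>
  For a space \<open>V\<close> of functions, \<open>V \<otimes> V\<close> embeds into the functions of two variables. If a minimal
  representation of \<open>t - u\<close> had a term, then evaluating the second variable where \<open>w j\<close> is nonzero
  would give a linear relation among the \<open>v i\<close>.
\<close>

lemma tensor2_eq_if_pointwise_eq: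
  fixes t u :: "('a \<Rightarrow> 'k::field) \<times> ('a \<Rightarrow> 'k) \<Rightarrow>\<^sub>0 'k"
  assumes V: "module.subspace fun_scale V"
    and t: "Poly_Mapping.keys t \<subseteq> V \<times> V" and u: "Poly_Mapping.keys u \<subseteq> V \<times> V"
    and eq: "\<And>a b. lin_ext (*) (\<lambda>(g, h). g a * h b) t = lin_ext (*) (\<lambda>(g, h). g a * h b) u"
  shows "tensor2_eq fun_scale V t u"
proof -
  interpret F: vector_space "fun_scale :: 'k \<Rightarrow> ('a \<Rightarrow> 'k) \<Rightarrow> _" by (rule vector_space_fun_scale)
  interpret k: vector_space "(*) :: 'k \<Rightarrow> 'k \<Rightarrow> 'k" by (rule vector_space_field)
  have "Poly_Mapping.keys (t - u) \<subseteq> V \<times> V"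
    using t u keys_diff[of t u] by blast
  then obtain I :: "nat set" and v w where I: "finite I" "\<And>i. i \<in> I \<Longrightarrow> v i \<in> V" "\<And>i. i \<in> I \<Longrightarrow> w i \<in> V"
    and rep: "tensor2_eq fun_scale V (t - u) (\<Sum>i\<in>I. pure (v i) (w i))"
    and v: "\<And>j. j \<in> I \<Longrightarrow> v j \<notin> F.span (v ` (I - {j}))"
    and w: "\<And>j. j \<in> I \<Longrightarrow> w j \<notin> F.span (w ` (I - {j}))"
    by (rule F.minimal_tensor_representation[OF V]) (rule that)
  have bil: "bilinear_on fun_scale (*) V (\<lambda>g h. g a * h b)" for a b
    unfolding bilinear_on_def linear_on_def
    by (intro conjI ballI allI) (simp_all only: fun_scale_def plus_fun_apply distrib_left distrib_right mult_ac)
  have zero: "(\<Sum>i\<in>I. v i a * w i b) = 0" for a b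
    using lin_ext_tensor2_eq[OF vector_space_field bil rep, of a b] eq[of a b]
    by (simp add: k.lin_ext_diff k.lin_ext_sum k.lin_ext_single)
  have "I = {}"
  proof (rule ccontr)
    assume "I \<noteq> {}"
    then obtain j where j: "j \<in> I" by auto
    have "w j \<noteq> 0" using w[OF j] F.span_zero by metis
    then obtain b where b: "w j b \<noteq> 0" by (auto simp: fun_eq_iff)
    have "v j = (\<Sum>i\<in>I - {j}. fun_scale (- w i b / w j b) (v i))"
    proof
      fix a
      have "v j a * w j b + (\<Sum>i\<in>I - {j}. v i a * w i b) = 0"
        using zero[of a b] sum.remove[OF I(1) j, of "\<lambda>i. v i a * w i b"] by simp
      then have "v j a = (\<Sum>i\<in>I - {j}. (- w i b / w j b) * v i a)"
        using b by (simp add: sum_divide_distrib[symmetric] sum_negf field_simps eq_neg_iff_add_eq_0)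
      moreover have "(\<Sum>i\<in>A. fun_scale (c i) (v i)) a = (\<Sum>i\<in>A. c i * v i a)" for A c
        by (induction A rule: infinite_finite_induct) (auto simp: fun_scale_def)
      ultimately show "v j a = (\<Sum>i\<in>I - {j}. fun_scale (- w i b / w j b) (v i)) a" by (simp only:)
    qed
    also have "\<dots> \<in> F.span (v ` (I - {j}))" by (intro F.span_sum F.span_scale F.span_base) auto
    finally show False using v[OF j] by blast
  qed
  then show ?thesis using rep by (simp add: tensor2_eq_def)
qed

section \<open>The two actions of the convolution algebra\<close>

lemma linear_on_imp_eq: "linear_on s s' V f \<Longrightarrow> x \<in> V \<Longrightarrow> y \<in> V \<Longrightarrow> f (x + y) = f x + f y"
  "linear_on s s' V f \<Longrightarrow> x \<in> V \<Longrightarrow> f (s a x) = s' a (f x)"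
  by (auto simp: linear_on_def)

lemma keys_sum_pure: "Poly_Mapping.keys (\<Sum>i\<in>I. pure (v i) (w i) :: 'v \<times> 'v \<Rightarrow>\<^sub>0 'k::field) \<subseteq> {(v i, w i) | i. i \<in> I}"
proof
  fix p assume "p \<in> Poly_Mapping.keys (\<Sum>i\<in>I. pure (v i) (w i) :: 'v \<times> 'v \<Rightarrow>\<^sub>0 'k::field)"
  then have "(\<Sum>i\<in>I. Poly_Mapping.lookup (pure (v i) (w i) :: 'v \<times> 'v \<Rightarrow>\<^sub>0 'k) p) \<noteq> 0"
    by (simp add: in_keys_iff lookup_sum)
  then obtain i where "i \<in> I" "Poly_Mapping.lookup (pure (v i) (w i) :: 'v \<times> 'v \<Rightarrow>\<^sub>0 'k) p \<noteq> 0"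
    by (meson sum.neutral)
  then show "p \<in> {(v i, w i) | i. i \<in> I}" by (auto simp: lookup_single when_def split: if_splits)
qed

context vector_space
begin

lemma projection_exists:
  assumes "subspace V"
  shows "\<exists>P. Vector_Spaces.linear scale scale P \<and> (\<forall>x. P x \<in> V) \<and> (\<forall>x\<in>V. P x = x)"
proof -
  interpret vector_space_pair scale scale by unfold_locales
  obtain B where B: "B \<subseteq> V" "independent B" "V \<subseteq> span B"
    using maximal_independent_subset by blast
  have sp: "span B = V" using span_subspace[OF B(1,3) assms] .
  obtain P where P: "Vector_Spaces.linear scale scale P" "\<forall>x\<in>B. P x = id x" "range P = span (id ` B)"
    using linear_independent_extend_subspace[OF B(2), of id] by blast
  interpret P: Vector_Spaces.linear scale scale P by (rule P(1))
  have "P x = x" if "x \<in> V" for x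
    using P(2) module_hom_eq_on_span[OF P(1) linear_id, of B x] that B(3) by auto
  then show ?thesis using P(1,3) sp by (intro exI[of _ P]) auto
qed

lemma scale_lin_ext: "scale a (lin_ext scale F t) = lin_ext scale (\<lambda>p. scale a (F p)) t"
  by (simp add: lin_ext_def scale_sum_right mult.commute)

lemma lin_ext_field_scale: "scale (lin_ext (*) F t) x = lin_ext scale (\<lambda>p. scale (F p) x) t"
  by (simp add: lin_ext_def scale_sum_left)

end

lemma linear_onI:
  "(\<And>x y. x \<in> V \<Longrightarrow> y \<in> V \<Longrightarrow> f (x + y) = f x + f y) \<Longrightarrow> (\<And>a x. x \<in> V \<Longrightarrow> f (s a x) = s' a (f x))
    \<Longrightarrow> linear_on s s' V f"
  by (simp add: linear_on_def)

context coalgebra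
begin

abbreviation s where "s \<equiv> smul C"
abbreviation V where "V \<equiv> carr C"

sublocale vs: vector_space s by (rule vector_space)

text \<open>
  The sum \<open>\<Sum> \<beta>(c\<^sub>1, c\<^sub>2)\<close> in Sweedler notation. It is meaningful for bilinear \<open>\<beta>\<close>, where it
  depends only on the tensor that \<open>comult C c\<close> represents.
\<close>

definition sweedler where "sweedler s' \<beta> c = lin_ext s' (\<lambda>(x, y). \<beta> x y) (comult C c)"

lemma keys_in: "c \<in> V \<Longrightarrow> p \<in> Poly_Mapping.keys (comult C c) \<Longrightarrow> fst p \<in> V \<and> snd p \<in> V"
  using comult_closed[of c] by (auto simp: mem_Times_iff)

lemma sweedler_cong:
  assumes "vector_space s'" "c \<in> V" "\<And>x y. x \<in> V \<Longrightarrow> y \<in> V \<Longrightarrow> \<beta> x y = \<beta>' x y"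
  shows "sweedler s' \<beta> c = sweedler s' \<beta>' c"
proof -
  interpret s': vector_space s' by fact
  show ?thesis unfolding sweedler_def
    by (rule s'.lin_ext_cong) (use keys_in[OF assms(2)] assms(3) in \<open>auto simp: split_def\<close>)
qed

lemma sweedler_linear:
  assumes s': "vector_space s'" and \<beta>: "bilinear_on s s' V \<beta>"
  shows "linear_on s s' V (sweedler s' \<beta>)"
proof -
  interpret s': vector_space s' by fact
  show ?thesis
  proof (rule linear_onI)
    fix x y assume xy: "x \<in> V" "y \<in> V"
    show "sweedler s' \<beta> (x + y) = sweedler s' \<beta> x + sweedler s' \<beta> y"
      using lin_ext_tensor2_eq[OF s' \<beta> comult_add[OF xy]] by (simp add: sweedler_def s'.lin_ext_add)
  next
    fix a x assume x: "x \<in> V"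
    show "sweedler s' \<beta> (s a x) = s' a (sweedler s' \<beta> x)"
      using lin_ext_tensor2_eq[OF s' \<beta> comult_smul[OF x]] by (simp add: sweedler_def s'.lin_ext_scale)
  qed
qed

lemma sweedler_image:
  assumes "vector_space s'" "c \<in> V" "linear_on s s' V f" "\<And>x y. x \<in> V \<Longrightarrow> y \<in> V \<Longrightarrow> \<beta> x y \<in> V"
  shows "f (sweedler s \<beta> c) = sweedler s' (\<lambda>x y. f (\<beta> x y)) c"
  unfolding sweedler_def
  by (subst vs.lin_ext_image[OF subspace assms(3,1)])
    (use keys_in[OF assms(2)] assms(4) in \<open>auto simp: split_def\<close>)

lemma sweedler_in: "c \<in> V \<Longrightarrow> (\<And>x y. x \<in> V \<Longrightarrow> y \<in> V \<Longrightarrow> \<beta> x y \<in> V) \<Longrightarrow> sweedler s \<beta> c \<in> V"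
  unfolding sweedler_def
  by (rule vs.lin_ext_in_subspace[OF subspace]) (use keys_in in \<open>auto simp: split_def\<close>)

lemma sweedler_coassoc:
  assumes s': "vector_space s'" and \<tau>: "trilinear_on s s' V \<tau>" and c: "c \<in> V"
  shows "sweedler s' (\<lambda>x y. sweedler s' (\<lambda>p q. \<tau> p q y) x) c = sweedler s' (\<lambda>x y. sweedler s' (\<lambda>p q. \<tau> x p q) y) c"
proof -
  interpret s': vector_space s' by fact
  have "lin_ext s' (\<lambda>(x, y, z). \<tau> x y z) (comult_id C (comult C c)) =
      sweedler s' (\<lambda>x y. sweedler s' (\<lambda>p q. \<tau> p q y) x) c"
    by (simp add: comult_id_def sweedler_def s'.lin_ext_lin_ext s'.lin_ext_single split_def)
  moreover have "lin_ext s' (\<lambda>(x, y, z). \<tau> x y z) (id_comult C (comult C c)) =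
      sweedler s' (\<lambda>x y. sweedler s' (\<lambda>p q. \<tau> x p q) y) c"
    by (simp add: id_comult_def sweedler_def s'.lin_ext_lin_ext s'.lin_ext_single split_def)
  ultimately show ?thesis using lin_ext_tensor3_eq[OF s' \<tau> coassoc[OF c]] by simp
qed

abbreviation functional where "functional f \<equiv> linear_on s (*) V f"

lemma linear_imp_functional: "Vector_Spaces.linear s (*) f \<Longrightarrow> functional f"
proof -
  assume "Vector_Spaces.linear s (*) f"
  then interpret f: Vector_Spaces.linear s "(*)" f .
  show ?thesis by (simp add: linear_on_def f.add f.scale)
qed

definition lact where "lact f c = sweedler s (\<lambda>x y. s (f y) x) c"
definition ract where "ract f c = sweedler s (\<lambda>x y. s (f x) y) c"

lemma dual_act_eq: "dual_act C f c = lact f c"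
  by (simp add: dual_act_def lact_def sweedler_def)

lemma functional_counit: "functional (counit C)" by (rule counit_linear)

lemma bilinear_lact: "functional f \<Longrightarrow> bilinear_on s s V (\<lambda>x y. s (f y) x)"
  by (auto simp: bilinear_on_def linear_on_def vs.scale_right_distrib vs.scale_left_distrib mult.commute)

lemma bilinear_ract: "functional f \<Longrightarrow> bilinear_on s s V (\<lambda>x y. s (f x) y)"
  by (auto simp: bilinear_on_def linear_on_def vs.scale_right_distrib vs.scale_left_distrib mult.commute)

lemma bilinear_product: "functional f \<Longrightarrow> functional g \<Longrightarrow> bilinear_on s (*) V (\<lambda>x y. f x * g y)"
  by (auto simp: bilinear_on_def linear_on_def algebra_simps)

lemma lact_linear: "functional f \<Longrightarrow> linear_on s s V (lact f)"
  using sweedler_linear[OF vector_space bilinear_lact] by (simp add: lact_def[abs_def])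

lemma ract_linear: "functional f \<Longrightarrow> linear_on s s V (ract f)"
  using sweedler_linear[OF vector_space bilinear_ract] by (simp add: ract_def[abs_def])

lemma scale_in: "x \<in> V \<Longrightarrow> s a x \<in> V"
  by (rule vs.subspace_scale[OF subspace])

lemma lact_in: "c \<in> V \<Longrightarrow> lact f c \<in> V"
  unfolding lact_def by (rule sweedler_in) (auto intro: scale_in)

lemma ract_in: "c \<in> V \<Longrightarrow> ract f c \<in> V"
  unfolding ract_def by (rule sweedler_in) (auto intro: scale_in)

lemma lact_counit: "c \<in> V \<Longrightarrow> lact (counit C) c = c"
  using counit_right[of c] by (simp add: lact_def sweedler_def)

lemma ract_counit: "c \<in> V \<Longrightarrow> ract (counit C) c = c"
  using counit_left[of c] by (simp add: ract_def sweedler_def)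

lemma functional_lact:
  assumes "functional f" "c \<in> V"
  shows "f (lact g c) = sweedler (*) (\<lambda>x y. f x * g y) c"
  unfolding lact_def
  by (subst sweedler_image[OF vector_space_field assms(2,1)])
    (use assms in \<open>auto intro!: sweedler_cong[OF vector_space_field] scale_in simp: linear_on_imp_eq(2)[OF assms(1)]\<close>)

lemma functional_ract:
  assumes "functional f" "c \<in> V"
  shows "f (ract g c) = sweedler (*) (\<lambda>x y. g x * f y) c"
  unfolding ract_def
  by (subst sweedler_image[OF vector_space_field assms(2,1)])
    (use assms in \<open>auto intro!: sweedler_cong[OF vector_space_field] scale_in simp: linear_on_imp_eq(2)[OF assms(1)]\<close>)

lemma counit_lact: "functional f \<Longrightarrow> c \<in> V \<Longrightarrow> counit C (lact f c) = f c"
  using functional_lact[OF functional_counit, of c f] functional_ract[of f c "counit C"] ract_counit[of c]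
  by simp

lemma functional_comp_lact: "functional f \<Longrightarrow> functional g \<Longrightarrow> functional (\<lambda>c. f (lact g c))"
  using lact_linear[of g] lact_in by (auto simp: linear_on_def)

lemma scale_sweedler: "s a (sweedler s \<beta> c) = sweedler s (\<lambda>x y. s a (\<beta> x y)) c"
  by (simp add: sweedler_def vs.scale_lin_ext split_def)

lemma sweedler_scale: "s (sweedler (*) \<beta> c) x = sweedler s (\<lambda>p q. s (\<beta> p q) x) c"
  by (simp add: sweedler_def vs.lin_ext_field_scale split_def)

lemma lact_lact:
  assumes f: "functional f" and g: "functional g" and c: "c \<in> V"
  shows "lact f (lact g c) = lact (\<lambda>d. f (lact g d)) c"
proof -
  have tri: "trilinear_on s s V (\<lambda>x p q. s (f p * g q) x)"
    using f g by (auto simp: trilinear_on_def linear_on_def vs.scale_right_distrib vs.scale_left_distrib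
        distrib_left distrib_right mult_ac)
  have "lact f (lact g c) = sweedler s (\<lambda>x y. lact f (s (g y) x)) c"
    unfolding lact_def[of g]
    by (rule sweedler_image[OF vector_space c lact_linear[OF f]]) (rule scale_in)
  also have "\<dots> = sweedler s (\<lambda>x y. sweedler s (\<lambda>p q. s (f q * g y) p) x) c"
    by (rule sweedler_cong[OF vector_space c])
      (simp add: linear_on_imp_eq(2)[OF lact_linear[OF f]], simp add: lact_def scale_sweedler mult.commute)
  also have "\<dots> = sweedler s (\<lambda>x y. sweedler s (\<lambda>p q. s (f p * g q) x) y) c"
    by (rule sweedler_coassoc[OF vector_space tri c])
  also have "\<dots> = sweedler s (\<lambda>x y. s (f (lact g y)) x) c"
    by (rule sweedler_cong[OF vector_space c]) (simp add: functional_lact[OF f] sweedler_scale)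
  finally show ?thesis by (simp add: lact_def[of "\<lambda>d. f (lact g d)"])
qed

lemma lact_ract:
  assumes f: "functional f" and g: "functional g" and c: "c \<in> V"
  shows "lact g (ract f c) = ract f (lact g c)"
proof -
  have tri: "trilinear_on s s V (\<lambda>x p q. s (f x * g q) p)"
    using f g by (auto simp: trilinear_on_def linear_on_def vs.scale_right_distrib vs.scale_left_distrib
        distrib_left distrib_right mult_ac)
  have "lact g (ract f c) = sweedler s (\<lambda>x y. lact g (s (f x) y)) c"
    unfolding ract_def
    by (rule sweedler_image[OF vector_space c lact_linear[OF g]]) (rule scale_in)
  also have "\<dots> = sweedler s (\<lambda>x y. sweedler s (\<lambda>p q. s (f x * g q) p) y) c"
    by (rule sweedler_cong[OF vector_space c])
      (simp add: linear_on_imp_eq(2)[OF lact_linear[OF g]], simp add: lact_def scale_sweedler)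
  also have "\<dots> = sweedler s (\<lambda>x y. sweedler s (\<lambda>p q. s (f p * g y) q) x) c"
    by (rule sweedler_coassoc[OF vector_space tri c, symmetric])
  also have "\<dots> = sweedler s (\<lambda>x y. ract f (s (g y) x)) c"
    by (rule sweedler_cong[OF vector_space c])
      (simp add: linear_on_imp_eq(2)[OF ract_linear[OF f]], simp add: ract_def scale_sweedler mult.commute)
  also have "\<dots> = ract f (lact g c)"
    unfolding lact_def
    by (rule sweedler_image[OF vector_space c ract_linear[OF f], symmetric]) (rule scale_in)
  finally show ?thesis .
qed

lemma lact_cong: "(\<And>y. y \<in> V \<Longrightarrow> f y = g y) \<Longrightarrow> c \<in> V \<Longrightarrow> lact f c = lact g c"
  unfolding lact_def by (rule sweedler_cong[OF vector_space]) auto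

lemma lact_depends_finitely:
  assumes "c \<in> V"
  obtains F where "finite F" "F \<subseteq> V" "\<And>f g. (\<And>u. u \<in> F \<Longrightarrow> f u = g u) \<Longrightarrow> lact f c = lact g c"
proof (rule that[of "snd ` Poly_Mapping.keys (comult C c)"])
  show "snd ` Poly_Mapping.keys (comult C c) \<subseteq> V" using keys_in[OF assms] by auto
  show "lact f c = lact g c" if "\<And>u. u \<in> snd ` Poly_Mapping.keys (comult C c) \<Longrightarrow> f u = g u" for f g
    unfolding lact_def sweedler_def by (rule vs.lin_ext_cong) (use that in \<open>auto simp: split_def\<close>)
qed simp

lemma lact_locally_finite: "lact f c \<in> vs.span (fst ` Poly_Mapping.keys (comult C c))"
  unfolding lact_def sweedler_def
proof (rule vs.lin_ext_in_subspace[OF vs.subspace_span])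
  fix p assume "p \<in> Poly_Mapping.keys (comult C c)"
  then show "(case p of (x, y) \<Rightarrow> s (f y) x) \<in> vs.span (fst ` Poly_Mapping.keys (comult C c))"
    by (cases p) (force intro: vs.span_scale vs.span_base)
qed

text \<open>
  A functional that is \<open>1\<close> on one vector of one side of a minimal representation and \<open>0\<close> on the
  others extracts the corresponding vector of the other side. So the vectors of the
  representation are obtained from \<open>c\<close> by the two actions, and a subspace that is stable under an
  action contains the vectors of the corresponding side.
\<close>

lemma comult_representation:
  assumes c: "c \<in> V"
  obtains I :: "nat set" and v w where "finite I" "\<And>i. i \<in> I \<Longrightarrow> v i \<in> V" "\<And>i. i \<in> I \<Longrightarrow> w i \<in> V"
    "teq2 C (comult C c) (\<Sum>i\<in>I. pure (v i) (w i))"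
    "\<And>j. j \<in> I \<Longrightarrow> \<exists>f. functional f \<and> v j = lact f c"
    "\<And>j. j \<in> I \<Longrightarrow> \<exists>f. functional f \<and> w j = ract f c"
proof (rule vs.minimal_tensor_representation[OF subspace comult_closed[OF c]])
  fix I :: "nat set" and v w
  assume I: "finite I" "\<And>i. i \<in> I \<Longrightarrow> v i \<in> V" "\<And>i. i \<in> I \<Longrightarrow> w i \<in> V"
    and eq: "teq2 C (comult C c) (\<Sum>i\<in>I. pure (v i) (w i))"
    and v: "\<And>j. j \<in> I \<Longrightarrow> v j \<notin> vs.span (v ` (I - {j}))"
    and w: "\<And>j. j \<in> I \<Longrightarrow> w j \<notin> vs.span (w ` (I - {j}))"
  have pick: "(\<Sum>i\<in>I. s (f (u i)) (z i)) = z j"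
    if "j \<in> I" "f (u j) = 1" "\<And>x. x \<in> vs.span (u ` (I - {j})) \<Longrightarrow> f x = 0" for f u z j
  proof -
    have "(\<Sum>i\<in>I. s (f (u i)) (z i)) = s (f (u j)) (z j) + (\<Sum>i\<in>I - {j}. s (f (u i)) (z i))"
      using I(1) that(1) by (rule sum.remove)
    also have "(\<Sum>i\<in>I - {j}. s (f (u i)) (z i)) = 0"
      using that(3) vs.span_base by (intro sum.neutral) auto
    finally show ?thesis using that(2) by simp
  qed
  show thesis
  proof (rule that[OF I eq])
    fix j assume j: "j \<in> I"
    obtain f where f: "Vector_Spaces.linear s (*) f" "\<And>x. x \<in> vs.span (w ` (I - {j})) \<Longrightarrow> f x = 0" "f (w j) = 1"
      using vs.separating_functional[OF w[OF j]] by blast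
    have "lact f c = (\<Sum>i\<in>I. s (f (w i)) (v i))"
      using lin_ext_tensor2_eq[OF vector_space bilinear_lact[OF linear_imp_functional[OF f(1)]] eq]
      by (simp add: lact_def sweedler_def vs.lin_ext_sum vs.lin_ext_single)
    then show "\<exists>f. functional f \<and> v j = lact f c"
      using pick[of j f w v, OF j f(3,2)] linear_imp_functional[OF f(1)] by metis
  next
    fix j assume j: "j \<in> I"
    obtain f where f: "Vector_Spaces.linear s (*) f" "\<And>x. x \<in> vs.span (v ` (I - {j})) \<Longrightarrow> f x = 0" "f (v j) = 1"
      using vs.separating_functional[OF v[OF j]] by blast
    have "ract f c = (\<Sum>i\<in>I. s (f (v i)) (w i))"
      using lin_ext_tensor2_eq[OF vector_space bilinear_ract[OF linear_imp_functional[OF f(1)]] eq]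
      by (simp add: ract_def sweedler_def vs.lin_ext_sum vs.lin_ext_single)
    then show "\<exists>f. functional f \<and> w j = ract f c"
      using pick[of j f v w, OF j f(3,2)] linear_imp_functional[OF f(1)] by metis
  qed
qed

lemma dual_submodule_iff:
  "dual_submodule C N \<longleftrightarrow> vs.subspace N \<and> N \<subseteq> V \<and> (\<forall>f c. functional f \<longrightarrow> c \<in> N \<longrightarrow> lact f c \<in> N)"
proof -
  have "lact f c \<in> N" if N: "N \<subseteq> V" "\<forall>f\<in>dual_space C. \<forall>c\<in>N. lact f c \<in> N"
    and f: "functional f" and c: "c \<in> N" for f c
  proof -
    define f' where "f' c = (if c \<in> V then f c else 0)" for c
    have "f' \<in> dual_space C"
      using f vs.subspace_add[OF subspace] scale_in by (auto simp: dual_space_def linear_on_def f'_def)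
    moreover have "lact f' c = lact f c" using N c by (intro lact_cong) (auto simp: f'_def)
    ultimately show ?thesis using N c by metis
  qed
  then show ?thesis unfolding dual_submodule_def dual_act_eq
    by (auto simp: dual_space_def)
qed

lemma dual_submodule_imp_right_coideal:
  assumes "dual_submodule C N" shows "right_coideal C N"
  unfolding right_coideal_def
proof (intro conjI ballI)
  have N: "vs.subspace N" "N \<subseteq> V" "\<And>f c. functional f \<Longrightarrow> c \<in> N \<Longrightarrow> lact f c \<in> N"
    using assms by (auto simp: dual_submodule_iff)
  show "vs.subspace N" "N \<subseteq> V" by fact+
  fix c assume c: "c \<in> N"
  then have cV: "c \<in> V" using N by auto
  obtain I :: "nat set" and v w where I: "finite I" "\<And>i. i \<in> I \<Longrightarrow> v i \<in> V" "\<And>i. i \<in> I \<Longrightarrow> w i \<in> V"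
    and eq: "teq2 C (comult C c) (\<Sum>i\<in>I. pure (v i) (w i))"
    and v: "\<And>j. j \<in> I \<Longrightarrow> \<exists>f. functional f \<and> v j = lact f c"
    by (rule comult_representation[OF cV]) blast
  have "v j \<in> N" if "j \<in> I" for j using v[OF that] N(3) c by auto
  then have "Poly_Mapping.keys (\<Sum>i\<in>I. pure (v i) (w i) :: _ \<Rightarrow>\<^sub>0 'k) \<subseteq> N \<times> V"
    using keys_sum_pure[of v w I] I by blast
  then show "\<exists>t. Poly_Mapping.keys t \<subseteq> N \<times> V \<and> teq2 C (comult C c) t" using eq by blast
qed

section \<open>Functionals as operators\<close>

text \<open>
  Operators have to be additive on the whole ambient group, so the action is extended along a
  projection onto the carrier.
\<close>

definition proj where
  "proj = (SOME P. Vector_Spaces.linear s s P \<and> (\<forall>x. P x \<in> V) \<and> (\<forall>x\<in>V. P x = x))"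

lemma proj: "Vector_Spaces.linear s s proj" "proj x \<in> V" "x \<in> V \<Longrightarrow> proj x = x"
  using someI_ex[OF vs.projection_exists[OF subspace]] unfolding proj_def by blast+

sublocale proj: Vector_Spaces.linear s s proj by (rule proj(1))

definition opr where "opr f = Endo (\<lambda>c. lact f (proj c))"
definition operators where "operators = opr ` {f. functional f}"
definition aug where "aug c = counit C (proj c)"

lemma ap_opr: "functional f \<Longrightarrow> ap (opr f) c = lact f (proj c)"
  unfolding opr_def
  by (subst ap_Endo) (simp_all add: proj.add linear_on_imp_eq(1)[OF lact_linear] proj(2))

lemma opr_in: "functional f \<Longrightarrow> opr f \<in> operators"
  by (simp add: operators_def)

lemma operators_cases:
  assumes "r \<in> operators"
  obtains f where "functional f" "r = opr f" "\<And>c. ap r c = lact f (proj c)"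
  using assms ap_opr by (auto simp: operators_def)

lemma aug_linear: "Vector_Spaces.linear s (*) aug"
proof -
  interpret k: vector_space "(*) :: 'k \<Rightarrow> 'k \<Rightarrow> 'k" by (rule vector_space_field)
  show ?thesis
    by unfold_locales
      (simp_all add: aug_def proj.add proj.scale proj(2) linear_on_imp_eq[OF functional_counit])
qed

lemma aug_opr: "functional f \<Longrightarrow> aug (ap (opr f) c) = f (proj c)"
  by (simp add: ap_opr aug_def proj lact_in counit_lact)

lemma functional_add: "functional f \<Longrightarrow> functional g \<Longrightarrow> functional (\<lambda>c. f c + g c)"
  by (auto simp: linear_on_def algebra_simps)

lemma functional_scale: "functional f \<Longrightarrow> functional (\<lambda>c. a * f c)"
  by (auto simp: linear_on_def algebra_simps)

lemma lact_add_left: "functional f \<Longrightarrow> functional g \<Longrightarrow> c \<in> V \<Longrightarrow> lact (\<lambda>x. f x + g x) c = lact f c + lact g c"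
  by (simp add: lact_def sweedler_def lin_ext_def vs.scale_left_distrib split_def
      vs.scale_right_distrib sum.distrib)

lemma lact_scale_left: "c \<in> V \<Longrightarrow> lact (\<lambda>x. a * f x) c = s a (lact f c)"
  by (simp add: lact_def scale_sweedler)

lemma opr_add: "functional f \<Longrightarrow> functional g \<Longrightarrow> opr f + opr g = opr (\<lambda>x. f x + g x)"
  by (rule endo_eqI) (simp add: ap_opr functional_add lact_add_left proj(2))

lemma opr_mult: "functional f \<Longrightarrow> functional g \<Longrightarrow> opr f * opr g = opr (\<lambda>c. f (lact g c))"
  by (rule endo_eqI) (simp add: ap_opr functional_comp_lact lact_lact proj lact_in)

lemma opr_scale: "functional f \<Longrightarrow> homothety s a * opr f = opr (\<lambda>x. a * f x)"
  by (rule endo_eqI) (simp add: ap_opr vs.ap_homothety functional_scale lact_scale_left proj)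

lemma submod_iff: "operator_submodule s V operators N \<longleftrightarrow> dual_submodule C N"
proof -
  have "(\<forall>r\<in>operators. \<forall>c\<in>N. ap r c \<in> N) \<longleftrightarrow> (\<forall>f c. functional f \<longrightarrow> c \<in> N \<longrightarrow> lact f c \<in> N)"
    if N: "N \<subseteq> V"
  proof -
    have "ap (opr f) c = lact f c" if "functional f" "c \<in> N" for f c
      using that N proj(3)[of c] by (auto simp: ap_opr)
    then show ?thesis unfolding operators_def by auto
  qed
  then show ?thesis unfolding operator_submodule_def dual_submodule_iff by blast
qed

lemma chain_operators:
  assumes "chain_coalgebra C"
  shows "chain_operators s V operators (opr (counit C)) aug"
proof (intro chain_operators.intro chain_operators_axioms.intro vector_space)
  show "vs.subspace V" by (rule subspace)
  fix r r' assume r: "r \<in> operators"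
  obtain f where f: "functional f" "r = opr f" using r by (rule operators_cases)
  show "r + r' \<in> operators" "r * r' \<in> operators" if r': "r' \<in> operators"
  proof -
    obtain g where g: "functional g" "r' = opr g" using r' by (rule operators_cases)
    show "r + r' \<in> operators" "r * r' \<in> operators"
      by (simp_all add: f g opr_add opr_mult opr_in functional_add functional_comp_lact)
  qed
  show "homothety s a * r \<in> operators" for a
    by (simp add: f opr_scale opr_in functional_scale)
  show "r * homothety s a = homothety s a * r" for a
    by (rule endo_eqI) (simp add: f ap_opr vs.ap_homothety proj.scale proj(2)
        linear_on_imp_eq(2)[OF lact_linear])
  show "opr (counit C) * r = r" "r * opr (counit C) = r"
    by (rule endo_eqI, simp add: f ap_opr functional_counit lact_counit proj lact_in)+
  show "ap r c \<in> V" for c by (simp add: f ap_opr lact_in proj)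
next
  show "opr (counit C) \<in> operators" by (simp add: opr_in functional_counit)
  show "ap (opr (counit C)) c = c" if "c \<in> V" for c
    by (simp add: ap_opr functional_counit lact_counit proj that)
  show "Vector_Spaces.linear s (*) aug" by (rule aug_linear)
  show "\<exists>r\<in>operators. \<forall>c\<in>V. aug (ap r c) = g c" if g: "Vector_Spaces.linear s (*) g" for g
    using opr_in[OF linear_imp_functional[OF g]] aug_opr[OF linear_imp_functional[OF g]] proj(3)
    by metis
next
  fix c assume c: "c \<in> V"
  obtain F where F: "finite F" "F \<subseteq> V" "\<And>f g. (\<And>u. u \<in> F \<Longrightarrow> f u = g u) \<Longrightarrow> lact f c = lact g c"
    by (rule lact_depends_finitely[OF c]) blast
  have "ap r c = 0" if r: "r \<in> operators" "\<forall>u\<in>F. aug (ap r u) = 0" for r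
  proof -
    obtain f where f: "functional f" "r = opr f" using r(1) by (rule operators_cases)
    have "f u = 0" if "u \<in> F" for u
    proof -
      have "u \<in> V" using that F(2) by blast
      then show ?thesis using r(2) that aug_opr[OF f(1), of u] by (simp add: f(2) proj(3))
    qed
    then have "lact f c = lact (\<lambda>_. 0) c" by (intro F(3)) auto
    also have "\<dots> = 0" by (simp add: lact_def sweedler_def lin_ext_def split_def)
    finally show ?thesis by (simp add: f ap_opr proj(3)[OF c])
  qed
  then show "\<exists>F. finite F \<and> F \<subseteq> V \<and> (\<forall>r\<in>operators. (\<forall>u\<in>F. aug (ap r u) = 0) \<longrightarrow> ap r c = 0)"
    using F by blast
  show "\<exists>B. finite B \<and> (\<forall>r\<in>operators. ap r c \<in> vs.span B)"
    using lact_locally_finite[of _ c] by (intro exI[of _ "fst ` Poly_Mapping.keys (comult C c)"])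
      (auto elim!: operators_cases simp: proj(3)[OF c])
next
  show "M \<subseteq> N \<or> N \<subseteq> M" if "operator_submodule s V operators M" "operator_submodule s V operators N" for M N
    using assms that dual_submodule_imp_right_coideal
    by (simp add: chain_coalgebra_def submod_iff)
qed

end

section \<open>The coradical of a chain coalgebra\<close>

locale chain_coalgebra_of_type =
  coalgebra C + D: findim_central_division_algebra scaleD
  for C :: "('c::ab_group_add, 'k::field) coalg"
    and scaleD :: "'k \<Rightarrow> 'd::division_ring \<Rightarrow> 'd" +
  fixes \<Phi> :: "('c \<Rightarrow> 'k) \<Rightarrow> 'd"
  assumes chain_coalgebra: "chain_coalgebra C"
    and \<Phi>: "dual_algebra_iso (coradical_coalg C) scaleD \<Phi>"
begin

abbreviation e where "e \<equiv> opr (counit C)"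

sublocale ops: chain_operators s V operators e aug
  by (rule chain_operators[OF chain_coalgebra])

abbreviation C0 where "C0 \<equiv> coradical C"

lemma coradical_carr: "carr (coradical_coalg C) = C0" "smul (coradical_coalg C) = s"
    "counit (coradical_coalg C) = counit C"
  by (simp_all add: coradical_coalg_def restrict_coalg_def)

lemma dual_space_coradical:
  "dual_space (coradical_coalg C) = {f. linear_on s (*) C0 f \<and> (\<forall>c. c \<notin> C0 \<longrightarrow> f c = 0)}"
  by (simp add: dual_space_def coradical_carr)

lemma simple_iff: "ops.simple_submod N \<longleftrightarrow> simple_dual_submodule C N"
  by (simp add: ops.simple_submod_def simple_dual_submodule_def submod_iff)

lemma coradical_nonzero: "C0 \<noteq> {0}"
proof
  assume C0: "C0 = {0}"
  have "f = g" if "f \<in> dual_space (coradical_coalg C)" "g \<in> dual_space (coradical_coalg C)" for f g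
  proof
    have z: "f 0 = 0" if "f \<in> dual_space (coradical_coalg C)" for f
    proof -
      have "linear_on s (*) C0 f" using that by (simp add: dual_space_coradical)
      then have "f (s 0 0) = 0 * f 0" by (rule linear_on_imp_eq(2)) (simp add: C0)
      then show ?thesis by simp
    qed
    fix x show "f x = g x"
      using that z[OF that(1)] z[OF that(2)] C0 by (cases "x = 0") (auto simp: dual_space_coradical)
  qed
  moreover have "\<Phi> ` dual_space (coradical_coalg C) = UNIV"
    using \<Phi> by (auto simp: dual_algebra_iso_def bij_betw_def)
  ultimately have "(0::'d) = 1" by (metis UNIV_I imageE)
  then show False by simp
qed

text \<open>
  By the chain condition there is at most one simple submodule, so the sum of all of them is simple.
\<close>

lemma coradical_simple: "ops.simple_submod C0"
proof -
  have "\<exists>S. ops.simple_submod S"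
  proof (rule ccontr)
    assume "\<nexists>S. ops.simple_submod S"
    then have "C0 = {0}" by (simp add: coradical_def simple_iff)
    then show False using coradical_nonzero by simp
  qed
  then obtain S where S: "ops.simple_submod S" by blast
  have "{N. simple_dual_submodule C N} = {S}"
    using S ops.simple_submod_unique by (auto simp: simple_iff)
  then have "C0 = vs.span S" by (simp add: coradical_def)
  moreover have "vs.subspace S" using S by (simp add: ops.simple_submod_def operator_submodule_def)
  ultimately have "C0 = S" by (simp only: vs.span_eq_iff)
  then show ?thesis using S by simp
qed

lemma coradical_submod: "ops.submod C0"
  using coradical_simple by (simp add: ops.simple_submod_def)

lemma coradical_subset: "C0 \<subseteq> V" and coradical_subspace: "vs.subspace C0"
  using coradical_submod by (auto simp: operator_submodule_def)

lemma coradical_lact: "functional f \<Longrightarrow> c \<in> C0 \<Longrightarrow> lact f c \<in> C0"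
  using coradical_submod by (simp add: submod_iff dual_submodule_iff)

text \<open>
  Acting by \<open>f\<close> on the right commutes with the left action, so it maps \<open>C0\<close> onto a submodule \<open>T\<close>. If \<open>T\<close>
  is not inside \<open>C0\<close>, then by the chain condition it contains \<open>C0\<close>; the vectors of \<open>C0\<close> that are
  mapped into \<open>C0\<close> then form a nonzero submodule of the simple \<open>C0\<close>, hence all of it.
\<close>

lemma coradical_ract:
  assumes f: "functional f" and c: "c \<in> C0"
  shows "ract f c \<in> C0"
proof -
  have cV: "\<And>c. c \<in> C0 \<Longrightarrow> c \<in> V" using coradical_subset by auto
  note lin = linear_on_imp_eq[OF ract_linear[OF f]]
  have r0: "ract f 0 = 0" using lin(2)[of 0 0] vs.subspace_0[OF subspace] by simp
  have T: "ops.submod (ract f ` C0)"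
    unfolding submod_iff dual_submodule_iff
  proof (intro conjI allI impI)
    show "vs.subspace (ract f ` C0)"
    proof (rule vs.subspaceI)
      show "0 \<in> ract f ` C0" using r0 vs.subspace_0[OF coradical_subspace] by (metis imageI)
      show "x + y \<in> ract f ` C0" if "x \<in> ract f ` C0" "y \<in> ract f ` C0" for x y
        using that lin(1) cV vs.subspace_add[OF coradical_subspace] by (auto simp flip: lin(1))
      show "s a x \<in> ract f ` C0" if "x \<in> ract f ` C0" for a x
        using that cV vs.subspace_scale[OF coradical_subspace] by (auto simp flip: lin(2))
    qed
    show "ract f ` C0 \<subseteq> V" using ract_in cV by auto
    show "lact g x \<in> ract f ` C0" if "functional g" "x \<in> ract f ` C0" for g x
      using that lact_ract[OF f] cV coradical_lact by auto
  qed
  have S: "ops.submod {c \<in> C0. ract f c \<in> C0}"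
    unfolding submod_iff dual_submodule_iff
  proof (intro conjI allI impI)
    show "vs.subspace {c \<in> C0. ract f c \<in> C0}"
      using vs.subspace_0[OF coradical_subspace] vs.subspace_add[OF coradical_subspace]
        vs.subspace_scale[OF coradical_subspace] lin cV r0
      by (intro vs.subspaceI) auto
    show "{c \<in> C0. ract f c \<in> C0} \<subseteq> V" using cV by auto
    show "lact g x \<in> {c \<in> C0. ract f c \<in> C0}" if "functional g" "x \<in> {c \<in> C0. ract f c \<in> C0}" for g x
      using that coradical_lact cV lact_ract[OF f, of g x, symmetric] by auto
  qed
  consider "ract f ` C0 \<subseteq> C0" | "C0 \<subseteq> ract f ` C0" using ops.chain[OF T coradical_submod] by blast
  then show ?thesis
  proof cases
    case 1 then show ?thesis using c by blast
  next
    case 2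
    obtain z where z: "z \<in> C0" "z \<noteq> 0"
      using coradical_nonzero vs.subspace_0[OF coradical_subspace] by blast
    then obtain d where d: "d \<in> C0" "z = ract f d" using 2 by blast
    then have "d \<in> {c \<in> C0. ract f c \<in> C0}" "d \<noteq> 0" using z r0 by auto
    then have "{c \<in> C0. ract f c \<in> C0} \<noteq> {0}" by blast
    then have "C0 \<subseteq> {c \<in> C0. ract f c \<in> C0}"
      using ops.simple_submod_least[OF coradical_simple S] by blast
    then show ?thesis using c by blast
  qed
qed

text \<open>
  Stability under both actions makes \<open>C0\<close> a subcoalgebra. This is what makes the comultiplication of
  \<open>coradical_coalg C\<close> a representative of that of \<open>C\<close>, so that convolution over the
  coradical is the restriction of convolution over \<open>C\<close>.
\<close>

lemma comult_coradical:
  assumes c: "c \<in> C0"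
  shows "\<exists>t. Poly_Mapping.keys t \<subseteq> C0 \<times> C0 \<and> teq2 C (comult C c) t"
proof -
  have cV: "c \<in> V" using c coradical_subset by auto
  obtain I :: "nat set" and v w where
    eq: "teq2 C (comult C c) (\<Sum>i\<in>I. pure (v i) (w i))"
    and v: "\<And>j. j \<in> I \<Longrightarrow> \<exists>f. functional f \<and> v j = lact f c"
    and w: "\<And>j. j \<in> I \<Longrightarrow> \<exists>f. functional f \<and> w j = ract f c"
    by (rule comult_representation[OF cV]) blast
  have "v j \<in> C0" "w j \<in> C0" if "j \<in> I" for j
    using v[OF that] w[OF that] coradical_lact coradical_ract c by auto
  then have "Poly_Mapping.keys (\<Sum>i\<in>I. pure (v i) (w i) :: _ \<Rightarrow>\<^sub>0 'k) \<subseteq> C0 \<times> C0"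
    using keys_sum_pure[of v w I] by blast
  then show ?thesis using eq by blast
qed

lemma comult_coradical_coalg:
  assumes "c \<in> C0"
  shows "Poly_Mapping.keys (comult (coradical_coalg C) c) \<subseteq> C0 \<times> C0"
    and "teq2 C (comult C c) (comult (coradical_coalg C) c)"
  using someI_ex[OF comult_coradical[OF assms]]
  by (simp_all add: coradical_coalg_def restrict_coalg_def)

definition res where "res f c = (if c \<in> C0 then f c else 0)"

lemma res_in:
  assumes "functional f" shows "res f \<in> dual_space (coradical_coalg C)"
proof -
  have cV: "c \<in> C0 \<Longrightarrow> c \<in> V" for c using coradical_subset by auto
  then have "linear_on s (*) C0 (res f)"
    using vs.subspace_add[OF coradical_subspace] vs.subspace_scale[OF coradical_subspace]
    by (intro linear_onI) (simp_all add: res_def linear_on_imp_eq[OF assms] cV)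
  then show ?thesis by (simp add: dual_space_coradical res_def)
qed

lemma convolution_res:
  assumes f: "functional f" and g: "functional g"
  shows "convolution (coradical_coalg C) (res f) (res g) = res (\<lambda>c. f (lact g c))"
proof
  fix c
  show "convolution (coradical_coalg C) (res f) (res g) c = res (\<lambda>c. f (lact g c)) c"
  proof (cases "c \<in> C0")
    case True
    then have cV: "c \<in> V" using coradical_subset by auto
    have "convolution (coradical_coalg C) (res f) (res g) c =
        lin_ext (*) (\<lambda>(x, y). res f x * res g y) (comult (coradical_coalg C) c)"
      using True by (simp add: convolution_def coradical_carr)
    also have "\<dots> = lin_ext (*) (\<lambda>(x, y). f x * g y) (comult (coradical_coalg C) c)"
      by (rule vector_space.lin_ext_cong[OF vector_space_field]) (use comult_coradical_coalg(1)[OF True] in \<open>auto simp: res_def\<close>)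
    also have "\<dots> = lin_ext (*) (\<lambda>(x, y). f x * g y) (comult C c)"
      by (rule lin_ext_tensor2_eq[OF vector_space_field bilinear_product[OF f g]
            comult_coradical_coalg(2)[OF True], symmetric])
    also have "\<dots> = f (lact g c)"
      by (simp add: functional_lact[OF f cV] sweedler_def)
    finally show ?thesis using True by (simp add: res_def)
  qed (simp add: convolution_def coradical_carr res_def)
qed

text \<open>
  The functional of \<open>r\<close> is restricted to the coradical and sent to \<open>D\<close> by the given isomorphism.
\<close>

definition pi where "pi r = \<Phi> (res (\<lambda>c. aug (ap r c)))"

lemma pi_opr: "functional f \<Longrightarrow> pi (opr f) = \<Phi> (res f)"
proof -
  assume f: "functional f"
  have "res (\<lambda>c. aug (ap (opr f) c)) = res f"
    using coradical_subset by (auto simp: res_def fun_eq_iff aug_opr[OF f] proj(3))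
  then show ?thesis by (simp add: pi_def)
qed

lemma \<Phi>_facts:
  shows \<Phi>_bij: "bij_betw \<Phi> (dual_space (coradical_coalg C)) UNIV"
    and \<Phi>_lin: "linear_on fun_scale scaleD (dual_space (coradical_coalg C)) \<Phi>"
    and \<Phi>_mult: "f \<in> dual_space (coradical_coalg C) \<Longrightarrow> g \<in> dual_space (coradical_coalg C) \<Longrightarrow>
      \<Phi> (convolution (coradical_coalg C) f g) = \<Phi> f * \<Phi> g"
    and \<Phi>_one: "\<Phi> (dual_one (coradical_coalg C)) = 1"
  using \<Phi> by (auto simp: dual_algebra_iso_def)

lemma functional_zero: "functional (\<lambda>_. 0)"
  by (simp add: linear_on_def)

lemma \<Phi>_zero: "\<Phi> (res (\<lambda>_. 0)) = 0"
proof -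
  have "\<Phi> (fun_scale 0 (res (\<lambda>_. 0))) = scaleD 0 (\<Phi> (res (\<lambda>_. 0)))"
    using linear_on_imp_eq(2)[OF \<Phi>_lin res_in[OF functional_zero]] .
  moreover have "fun_scale 0 (res (\<lambda>_. 0)) = res (\<lambda>_. 0 :: 'k)"
    by (simp add: fun_scale_def res_def fun_eq_iff)
  ultimately show ?thesis by simp
qed

lemma annihilates_coradical:
  assumes f: "functional f" and z: "\<And>c. c \<in> C0 \<Longrightarrow> f c = 0" and c: "c \<in> C0"
  shows "lact f c = 0"
proof -
  have "lact f c = lin_ext s (\<lambda>(x, y). s (f y) x) (comult (coradical_coalg C) c)"
    unfolding lact_def sweedler_def
    by (rule lin_ext_tensor2_eq[OF vector_space bilinear_lact[OF f] comult_coradical_coalg(2)[OF c]])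
  also have "\<dots> = lin_ext s (\<lambda>_. 0) (comult (coradical_coalg C) c)"
    by (rule vs.lin_ext_cong) (use comult_coradical_coalg(1)[OF c] z in auto)
  finally show ?thesis by (simp add: lin_ext_def)
qed

sublocale ops: uniserial_operators s V operators e aug scaleD C0 pi
proof unfold_locales
  show "operator_submodule s V operators C0" by (rule coradical_submod)
  show "C0 \<noteq> {0}" by (rule coradical_nonzero)
  show "C0 \<subseteq> M" if "operator_submodule s V operators M" "M \<noteq> {0}" for M
    using ops.simple_submod_least[OF coradical_simple that] .
next
  fix r c assume r: "r \<in> operators" and z: "\<And>c. c \<in> C0 \<Longrightarrow> aug (ap r c) = 0" and c: "c \<in> C0"
  obtain f where f: "functional f" "r = opr f" using r by (rule operators_cases)
  have "f c = 0" if "c \<in> C0" for c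
    using z[OF that] coradical_subset that by (auto simp: f aug_opr proj(3))
  then have "lact f c = 0" using annihilates_coradical f(1) c by blast
  then show "ap r c = 0" using coradical_subset c by (auto simp: f ap_opr proj(3))
next
  fix r assume r: "r \<in> operators"
  obtain f where f: "functional f" "r = opr f" using r by (rule operators_cases)
  have rV: "c \<in> C0 \<Longrightarrow> proj c = c" for c using coradical_subset proj(3) by auto
  show "pi (r + r') = pi r + pi r'" "pi (r * r') = pi r * pi r'" if r': "r' \<in> operators" for r'
  proof -
    obtain g where g: "functional g" "r' = opr g" using r' by (rule operators_cases)
    have "res (\<lambda>x. f x + g x) = res f + res g" by (auto simp: res_def fun_eq_iff)
    then show "pi (r + r') = pi r + pi r'"
      by (simp add: f g opr_add pi_opr functional_add linear_on_imp_eq(1)[OF \<Phi>_lin] res_in)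
    show "pi (r * r') = pi r * pi r'"
      by (simp add: f g opr_mult pi_opr functional_comp_lact convolution_res[symmetric] \<Phi>_mult res_in)
  qed
  show "pi (homothety s a * r) = scaleD a (pi r)" for a
  proof -
    have "res (\<lambda>x. a * f x) = fun_scale a (res f)" by (auto simp: res_def fun_eq_iff fun_scale_def)
    then show ?thesis
      by (simp add: f opr_scale pi_opr functional_scale linear_on_imp_eq(2)[OF \<Phi>_lin] res_in)
  qed
  show "(pi r = 0) = (\<forall>c\<in>C0. ap r c = 0)"
  proof -
    have "pi r = 0 \<longleftrightarrow> \<Phi> (res f) = \<Phi> (res (\<lambda>_. 0))" by (simp add: f pi_opr \<Phi>_zero)
    also have "\<dots> \<longleftrightarrow> res f = res (\<lambda>_. 0)"
      using \<Phi>_bij res_in[OF f(1)] res_in[OF functional_zero]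
      by (auto simp: bij_betw_def inj_on_eq_iff)
    also have "\<dots> \<longleftrightarrow> (\<forall>c\<in>C0. f c = 0)" by (auto simp: res_def fun_eq_iff)
    also have "\<dots> \<longleftrightarrow> (\<forall>c\<in>C0. ap r c = 0)"
    proof
      assume "\<forall>c\<in>C0. f c = 0"
      then show "\<forall>c\<in>C0. ap r c = 0" using annihilates_coradical[OF f(1)] by (simp add: f ap_opr rV)
    next
      assume z: "\<forall>c\<in>C0. ap r c = 0"
      show "\<forall>c\<in>C0. f c = 0"
        using z aug_opr[OF f(1)] by (metis ops.eps.zero f(2) rV)
    qed
    finally show ?thesis .
  qed
next
  have "dual_one (coradical_coalg C) = res (counit C)"
    by (auto simp: dual_one_def res_def coradical_carr)
  then show "pi e = 1" by (simp add: pi_opr functional_counit \<Phi>_one[symmetric])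
next
  fix d
  obtain f0 where f0: "f0 \<in> dual_space (coradical_coalg C)" "\<Phi> f0 = d"
    using \<Phi>_bij by (metis UNIV_I bij_betw_imp_surj_on imageE)
  obtain P where P: "Vector_Spaces.linear s s P" "\<And>x. P x \<in> C0" "\<And>x. x \<in> C0 \<Longrightarrow> P x = x"
    using vs.projection_exists[OF coradical_subspace] by blast
  interpret P: Vector_Spaces.linear s s P by (rule P(1))
  have "functional (\<lambda>c. f0 (P c))"
    using f0(1) P(2) by (auto simp: dual_space_coradical linear_on_def P.add P.scale)
  moreover have "res (\<lambda>c. f0 (P c)) = f0"
    using f0(1) P(3) by (auto simp: res_def fun_eq_iff dual_space_coradical)
  ultimately show "\<exists>r\<in>operators. pi r = d"
    using f0(2) by (intro bexI[of _ "opr (\<lambda>c. f0 (P c))"]) (simp_all add: pi_opr opr_in)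
qed

end

section \<open>Subcoalgebras of a finite dual\<close>

text \<open>
  A subspace of finite codimension in the whole space has finite codimension in every subspace \<open>U\<close>.
  Adding one vector \<open>b\<close> to \<open>I\<close> enlarges the intersection with \<open>U\<close> by at most one dimension.
\<close>

lemma (in vector_space) finite_codim_relative:
  assumes "finite B" "subspace I" "subspace U" "span (I \<union> B) = UNIV"
  shows "\<exists>B'. finite B' \<and> U \<subseteq> span ((U \<inter> I) \<union> B')"
  using assms(1,2,4)
proof (induction B arbitrary: I rule: finite_induct)
  case empty
  then have "I = UNIV" using span_eq_iff[of I] by (simp del: span_eq_iff)
  then show ?case by (intro exI[of _ "{}"]) (auto intro: span_base)
next
  case (insert b B)
  let ?I = "span (insert b I)"
  have "I \<union> insert b B \<subseteq> span (?I \<union> B)"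
    using span_superset[of "insert b I"] span_superset[of "?I \<union> B"] by auto
  then have "span (?I \<union> B) = UNIV"
    using span_minimal[of "I \<union> insert b B" "span (?I \<union> B)"] insert.prems(2) by auto
  from insert.IH[OF subspace_span this] obtain B' where B': "finite B'" "U \<subseteq> span ((U \<inter> ?I) \<union> B')"
    by blast
  show ?case
  proof (cases "U \<inter> ?I \<subseteq> I")
    case True
    then have "(U \<inter> ?I) \<union> B' \<subseteq> (U \<inter> I) \<union> B'" by auto
    from span_mono[OF this] show ?thesis using B' by (intro exI[of _ B']) auto
  next
    case False
    then obtain u0 where u0: "u0 \<in> U" "u0 \<in> ?I" "u0 \<notin> I" by auto
    have spI: "span I = I" using insert.prems(1) by (rule span_eq_iff[THEN iffD2])
    obtain k0 where k0: "u0 - scale k0 b \<in> I" using u0(2) spI span_breakdown_eq by auto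
    have "k0 \<noteq> 0" using k0 u0(3) by auto
    have "u \<in> span ((U \<inter> I) \<union> insert u0 B')" if u: "u \<in> U" "u \<in> ?I" for u
    proof -
      obtain k where k: "u - scale k b \<in> I" using u(2) spI span_breakdown_eq by auto
      have "u - scale (k / k0) u0 = (u - scale k b) - scale (k / k0) (u0 - scale k0 b)"
        using \<open>k0 \<noteq> 0\<close> by (simp add: scale_right_diff_distrib)
      also have "\<dots> \<in> I" by (intro subspace_diff subspace_scale insert.prems(1) k k0)
      finally have "u - scale (k / k0) u0 \<in> U \<inter> I"
        using u u0 assms(3) by (auto intro: subspace_diff subspace_scale)
      then have "(u - scale (k / k0) u0) + scale (k / k0) u0 \<in> span ((U \<inter> I) \<union> insert u0 B')"
        by (intro span_add span_scale span_base) auto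
      then show ?thesis by simp
    qed
    moreover have "B' \<subseteq> span ((U \<inter> I) \<union> insert u0 B')" by (auto intro: span_base)
    ultimately have "span ((U \<inter> ?I) \<union> B') \<subseteq> span ((U \<inter> I) \<union> insert u0 B')"
      by (intro span_minimal subspace_span) auto
    then show ?thesis using B' by (intro exI[of _ "insert u0 B'"]) auto
  qed
qed

context k_algebra
begin

lemma ideal_subspace:
  assumes "two_sided_ideal I" shows "subspace I"
proof (rule subspaceI)
  fix a x assume "x \<in> I"
  then have "scale a 1 * x \<in> I" using assms by (simp add: two_sided_ideal_def)
  then show "scale a x \<in> I" by (simp add: scale_mult_left)
qed (use assms in \<open>auto simp: two_sided_ideal_def\<close>)

lemma finite_codim_Int:
  assumes "two_sided_ideal I" "two_sided_ideal I'" "finite_codim scale I" "finite_codim scale I'"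
  shows "finite_codim scale (I \<inter> I')"
proof -
  obtain B B' where B: "finite B" "span (I \<union> B) = UNIV" and B': "finite B'" "span (I' \<union> B') = UNIV"
    using assms(3,4) unfolding finite_codim_def by blast
  obtain B'' where B'': "finite B''" "I \<subseteq> span ((I \<inter> I') \<union> B'')"
    using finite_codim_relative[OF B'(1) ideal_subspace[OF assms(2)] ideal_subspace[OF assms(1)] B'(2)]
    by blast
  have "span ((I \<inter> I') \<union> B'') \<subseteq> span ((I \<inter> I') \<union> (B'' \<union> B))" by (rule span_mono) auto
  then have "I \<subseteq> span ((I \<inter> I') \<union> (B'' \<union> B))" using B''(2) by auto
  moreover have "B \<subseteq> span ((I \<inter> I') \<union> (B'' \<union> B))" by (auto intro: span_base)
  ultimately have "span (I \<union> B) \<subseteq> span ((I \<inter> I') \<union> (B'' \<union> B))"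
    by (intro span_minimal) auto
  then show ?thesis using B B'' unfolding finite_codim_def by (intro exI[of _ "B'' \<union> B"]) auto
qed

text \<open>
  Closure under sums rests on the fact that two ideals of finite codimension intersect in one.
\<close>

lemma finite_dual_subspace: "module.subspace fun_scale (finite_dual_carrier scale)"
proof -
  interpret F: vector_space "fun_scale :: 'k \<Rightarrow> ('a \<Rightarrow> 'k) \<Rightarrow> _" by (rule vector_space_fun_scale)
  interpret k: vector_space "(*) :: 'k \<Rightarrow> 'k \<Rightarrow> 'k" by (rule vector_space_field)
  interpret p: vector_space_pair scale "(*) :: 'k \<Rightarrow> 'k \<Rightarrow> 'k" by unfold_locales
  show ?thesis
  proof (rule F.subspaceI)
    have "finite_codim scale UNIV" by (auto simp: finite_codim_def)
    then show "0 \<in> finite_dual_carrier scale"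
      using p.linear_zero by (auto simp: finite_dual_carrier_def two_sided_ideal_def zero_fun_def)
  next
    fix f g assume "f \<in> finite_dual_carrier scale" "g \<in> finite_dual_carrier scale"
    then obtain I I' where I: "Vector_Spaces.linear scale (*) f" "two_sided_ideal I"
        "finite_codim scale I" "\<And>x. x \<in> I \<Longrightarrow> f x = 0"
      and I': "Vector_Spaces.linear scale (*) g" "two_sided_ideal I'"
        "finite_codim scale I'" "\<And>x. x \<in> I' \<Longrightarrow> g x = 0"
      unfolding finite_dual_carrier_def by blast
    have "Vector_Spaces.linear scale (*) (f + g)"
      using p.linear_compose_add[OF I(1) I'(1)] by (simp add: plus_fun_def)
    moreover have "two_sided_ideal (I \<inter> I')" using I(2) I'(2) by (auto simp: two_sided_ideal_def)
    ultimately show "f + g \<in> finite_dual_carrier scale"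
      using finite_codim_Int[OF I(2) I'(2) I(3) I'(3)] I(4) I'(4)
      unfolding finite_dual_carrier_def by (intro CollectI conjI exI[of _ "I \<inter> I'"]) auto
  next
    fix a f assume "f \<in> finite_dual_carrier scale"
    then obtain I where I: "Vector_Spaces.linear scale (*) f" "two_sided_ideal I"
        "finite_codim scale I" "\<And>x. x \<in> I \<Longrightarrow> f x = 0"
      unfolding finite_dual_carrier_def by blast
    have "Vector_Spaces.linear scale (*) (fun_scale a f)"
      using p.linear_compose_scale_right[OF I(1), of a] by (simp add: fun_scale_def)
    then show "fun_scale a f \<in> finite_dual_carrier scale"
      using I unfolding finite_dual_carrier_def
      by (intro CollectI conjI exI[of _ I]) (auto simp: fun_scale_def)
  qed
qed

end

lemma keys_tensor_map:
  fixes t :: "'v \<times> 'v \<Rightarrow>\<^sub>0 'k::field" and f g :: "'v \<Rightarrow> 'w"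
  assumes "Poly_Mapping.keys t \<subseteq> V \<times> V"
  shows "Poly_Mapping.keys (tensor_map f g t) \<subseteq> f ` V \<times> g ` V"
proof -
  have "tensor_map f g t \<in> {u. Poly_Mapping.keys u \<subseteq> f ` V \<times> g ` V}"
    unfolding tensor_map_def
  proof (rule free.lin_ext_in_subspace)
    show "free.subspace {u :: 'w \<times> 'w \<Rightarrow>\<^sub>0 'k. Poly_Mapping.keys u \<subseteq> f ` V \<times> g ` V}"
    proof (rule free.subspaceI)
      fix a and t u :: "'w \<times> 'w \<Rightarrow>\<^sub>0 'k"
      assume t: "t \<in> {u. Poly_Mapping.keys u \<subseteq> f ` V \<times> g ` V}"
      show "t + u \<in> {u. Poly_Mapping.keys u \<subseteq> f ` V \<times> g ` V}"
        if "u \<in> {u. Poly_Mapping.keys u \<subseteq> f ` V \<times> g ` V}"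
        using keys_add[of t u] t that by simp blast
      have "Poly_Mapping.keys (free_scale a t) \<subseteq> Poly_Mapping.keys t"
        by (auto simp: in_keys_iff lookup_free_scale)
      then show "free_scale a t \<in> {u. Poly_Mapping.keys u \<subseteq> f ` V \<times> g ` V}" using t by simp
    qed simp
    fix p assume "p \<in> Poly_Mapping.keys t"
    then show "(case p of (x, y) \<Rightarrow> Poly_Mapping.single (f x, g y) 1) \<in>
        {u :: _ \<Rightarrow>\<^sub>0 'k. Poly_Mapping.keys u \<subseteq> f ` V \<times> g ` V}"
      using assms by (cases p) auto
  qed
  then show ?thesis by simp
qed

lemma (in vector_space) lin_ext_tensor_map:
  "lin_ext scale F (tensor_map f g t) = lin_ext scale (\<lambda>(x, y). F (f x, g y)) t"
  by (simp add: tensor_map_def lin_ext_lin_ext lin_ext_single split_def)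

text \<open>
  An injective linear map into the finite dual whose adjoint is multiplicative and unital is an
  isomorphism onto a subcoalgebra. The chosen representatives of the comultiplications involved
  all define the same function of two variables on \<open>A\<close>, and therefore are equal as tensors, over
  the finite dual as well as over the image.
\<close>

lemma (in coalgebra) subcoalgebra_of_finite_dual:
  fixes scaleA :: "'k \<Rightarrow> 'a::ring_1 \<Rightarrow> 'a"
  assumes "k_algebra scaleA"
    and lin: "linear_on s fun_scale V \<phi>" and inj: "inj_on \<phi> V"
    and fin: "\<And>c. c \<in> V \<Longrightarrow> \<phi> c \<in> finite_dual_carrier scaleA"
    and mult: "\<And>c a b. c \<in> V \<Longrightarrow> \<phi> c (a * b) = sweedler (*) (\<lambda>x y. \<phi> x a * \<phi> y b) c"
    and unit: "\<And>c. c \<in> V \<Longrightarrow> \<phi> c 1 = counit C c"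
  shows "subcoalgebra (finite_dual scaleA) (\<phi> ` V)"
    and "coalg_iso C (restrict_coalg (finite_dual scaleA) (\<phi> ` V)) \<phi>"
proof -
  interpret A: k_algebra scaleA by fact
  interpret F: vector_space "fun_scale :: 'k \<Rightarrow> ('a \<Rightarrow> 'k) \<Rightarrow> _" by (rule vector_space_fun_scale)
  interpret k: vector_space "(*) :: 'k \<Rightarrow> 'k \<Rightarrow> 'k" by (rule vector_space_field)
  let ?FD = "finite_dual_carrier scaleA" and ?S = "\<phi> ` V"
  have S_FD: "?S \<subseteq> ?FD" using fin by auto
  have S: "F.subspace ?S"
  proof (rule F.subspaceI)
    have "\<phi> (s 0 0) = fun_scale 0 (\<phi> 0)" using linear_on_imp_eq(2)[OF lin vs.subspace_0[OF subspace]] .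
    then show "0 \<in> ?S" using vs.subspace_0[OF subspace] by (metis F.scale_zero_left image_eqI vs.scale_zero_left)
    show "f + g \<in> ?S" if "f \<in> ?S" "g \<in> ?S" for f g
      using that vs.subspace_add[OF subspace] by (auto simp flip: linear_on_imp_eq(1)[OF lin])
    show "fun_scale a f \<in> ?S" if "f \<in> ?S" for a f
      using that scale_in by (auto simp flip: linear_on_imp_eq(2)[OF lin])
  qed
  let ?ev = "\<lambda>a b. \<lambda>(g, h). (g :: 'a \<Rightarrow> 'k) a * h b"
  have ev_cong: "lin_ext (*) (?ev a b) t = lin_ext (*) (?ev a b) u" if "tensor2_eq fun_scale U t u" for a b U t u
  proof (rule lin_ext_tensor2_eq[OF vector_space_field _ that])
    show "bilinear_on fun_scale (*) U (\<lambda>g h. g a * h b)"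
      unfolding bilinear_on_def linear_on_def
      by (intro conjI ballI allI) (simp_all only: fun_scale_def plus_fun_apply distrib_left distrib_right mult_ac)
  qed
  have keys_tm: "Poly_Mapping.keys (tensor_map \<phi> \<phi> (comult C c)) \<subseteq> ?S \<times> ?S" if "c \<in> V" for c
    by (rule keys_tensor_map) (rule comult_closed[OF that])
  have ev_tm: "lin_ext (*) (?ev a b) (tensor_map \<phi> \<phi> (comult C c)) = \<phi> c (a * b)" if "c \<in> V" for c a b
    by (simp add: k.lin_ext_tensor_map mult[OF that] sweedler_def)
  have FD_fields: "smul (finite_dual scaleA) = fun_scale" "carr (finite_dual scaleA) = ?FD"
      "counit (finite_dual scaleA) = (\<lambda>f. f 1)"
    by (simp_all add: finite_dual_def)
  have comult_FD: "Poly_Mapping.keys (comult (finite_dual scaleA) (\<phi> c)) \<subseteq> ?FD \<times> ?FD"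
      "\<phi> c (a * b) = lin_ext (*) (?ev a b) (comult (finite_dual scaleA) (\<phi> c))" if "c \<in> V" for c a b
  proof -
    define Q where
      "Q t \<longleftrightarrow> Poly_Mapping.keys t \<subseteq> ?FD \<times> ?FD \<and> (\<forall>a b. \<phi> c (a * b) = lin_ext (*) (?ev a b) t)" for t
    have "Poly_Mapping.keys (tensor_map \<phi> \<phi> (comult C c)) \<subseteq> ?FD \<times> ?FD"
      using keys_tm[OF that] S_FD by blast
    then have "Q (tensor_map \<phi> \<phi> (comult C c))" by (simp add: Q_def ev_tm[OF that])
    then have "Q (SOME t. Q t)" by (rule someI)
    moreover have "comult (finite_dual scaleA) (\<phi> c) = (SOME t. Q t)"
      by (simp add: finite_dual_def Q_def)
    ultimately have "Q (comult (finite_dual scaleA) (\<phi> c))" by (simp only:)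
    then show "Poly_Mapping.keys (comult (finite_dual scaleA) (\<phi> c)) \<subseteq> ?FD \<times> ?FD"
      "\<phi> c (a * b) = lin_ext (*) (?ev a b) (comult (finite_dual scaleA) (\<phi> c))"
      by (simp_all only: Q_def)
  qed
  have teq: "teq2 (finite_dual scaleA) (comult (finite_dual scaleA) (\<phi> c)) (tensor_map \<phi> \<phi> (comult C c))"
    if c: "c \<in> V" for c
    unfolding FD_fields
  proof (rule tensor2_eq_if_pointwise_eq[OF A.finite_dual_subspace comult_FD(1)[OF c]])
    show "Poly_Mapping.keys (tensor_map \<phi> \<phi> (comult C c)) \<subseteq> ?FD \<times> ?FD"
      using keys_tm[OF c] S_FD by blast
    show "lin_ext (*) (?ev a b) (comult (finite_dual scaleA) (\<phi> c)) =
        lin_ext (*) (?ev a b) (tensor_map \<phi> \<phi> (comult C c))" for a b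
      using comult_FD(2)[OF c] ev_tm[OF c] by simp
  qed
  show "subcoalgebra (finite_dual scaleA) ?S"
    unfolding subcoalgebra_def
  proof (intro conjI ballI)
    fix f assume "f \<in> ?S"
    then obtain c where "c \<in> V" "f = \<phi> c" by auto
    then show "\<exists>t. Poly_Mapping.keys t \<subseteq> ?S \<times> ?S \<and> teq2 (finite_dual scaleA) (comult (finite_dual scaleA) f) t"
      using teq keys_tm by blast
  qed (use S S_FD in \<open>simp_all add: FD_fields\<close>)
  let ?E = "restrict_coalg (finite_dual scaleA) ?S"
  have E_fields: "smul ?E = fun_scale" "carr ?E = ?S" "counit ?E = (\<lambda>f. f 1)"
    by (simp_all add: restrict_coalg_def FD_fields)
  have "teq2 ?E (comult ?E (\<phi> c)) (tensor_map \<phi> \<phi> (comult C c))" if c: "c \<in> V" for c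
    unfolding E_fields
  proof (rule tensor2_eq_if_pointwise_eq[OF S _ keys_tm[OF c]])
    have "\<exists>t. Poly_Mapping.keys t \<subseteq> ?S \<times> ?S \<and>
        teq2 (finite_dual scaleA) (comult (finite_dual scaleA) (\<phi> c)) t"
      using keys_tm[OF c] teq[OF c] by blast
    from someI_ex[OF this]
    have E: "Poly_Mapping.keys (comult ?E (\<phi> c)) \<subseteq> ?S \<times> ?S"
      "tensor2_eq fun_scale ?FD (comult (finite_dual scaleA) (\<phi> c)) (comult ?E (\<phi> c))"
      by (simp_all add: restrict_coalg_def FD_fields)
    show "Poly_Mapping.keys (comult ?E (\<phi> c)) \<subseteq> ?S \<times> ?S" by (rule E(1))
    show "lin_ext (*) (?ev a b) (comult ?E (\<phi> c)) =
        lin_ext (*) (?ev a b) (tensor_map \<phi> \<phi> (comult C c))" for a b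
      using ev_cong[OF E(2)] comult_FD(2)[OF c] ev_tm[OF c] by simp
  qed
  then show "coalg_iso C ?E \<phi>"
    unfolding coalg_iso_def using inj lin unit by (auto simp: E_fields bij_betw_def)
qed

section \<open>The embedding into the finite dual of the power series ring\<close>

lemma k_algebra_fps:
  assumes "k_algebra scaleD" shows "k_algebra (fps_scale scaleD)"
proof -
  interpret k_algebra scaleD by fact
  show ?thesis
    by unfold_locales (auto simp: fps_eq_iff fps_scale_def fps_mult_nth scale_right_distrib
        scale_left_distrib scale_sum_right scale_mult_left scale_mult_right)
qed

context chain_coalgebra_of_type
begin

text \<open>
  Substituting \<open>\<delta>\<close> for the coefficients and the central generator for the variable turns a power
  series into an operator, because powers of the generator eventually kill any given vector. The
  functional \<open>\<phi> c\<close> evaluates this operator at \<open>c\<close> and applies the counit. It vanishes on the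
  power series of order at least \<open>N c\<close>, an ideal of finite codimension. It determines \<open>c\<close>, because
  the operators obtained from power series have the same orbits as all of \<open>R\<close>.
\<close>

lemma power_series_embedding:
  obtains \<phi> where "linear_on s fun_scale V \<phi>" "inj_on \<phi> V"
    "\<And>c. c \<in> V \<Longrightarrow> \<phi> c \<in> finite_dual_carrier (fps_scale scaleD)"
    "\<And>c p q. c \<in> V \<Longrightarrow> \<phi> c (p * q) = sweedler (*) (\<lambda>x y. \<phi> x p * \<phi> y q) c"
    "\<And>c. c \<in> V \<Longrightarrow> \<phi> c 1 = counit C c"
proof -
  obtain \<delta> x where \<delta>R: "\<And>a. \<delta> a \<in> operators" and \<delta>_add: "\<And>a c. \<delta> (a + c) = \<delta> a + \<delta> c"
    and \<delta>_scale: "\<And>r a. \<delta> (scaleD r a) = homothety s r * \<delta> a" and \<delta>_one: "\<delta> 1 = e"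
    and \<delta>_mult: "\<And>a c. \<delta> (a * c) = \<delta> a * \<delta> c" and xR: "x \<in> operators"
    and comm: "\<And>a. \<delta> a * x = x * \<delta> a"
    and nil: "\<And>c. c \<in> V \<Longrightarrow> \<exists>n. \<forall>m\<ge>n. \<forall>g\<in>operators. ap (x ^ m * g) c = 0"
    and gen: "\<And>h c. h \<in> operators \<Longrightarrow> c \<in> V \<Longrightarrow> \<exists>n d. ap h c = (\<Sum>i<n. ap (\<delta> (d i) * x ^ i) c)"
    by (rule ops.power_series_generation) blast
  obtain N where N: "\<And>c m g. c \<in> V \<Longrightarrow> m \<ge> N c \<Longrightarrow> g \<in> operators \<Longrightarrow> ap (x ^ m * g) c = 0"
    using nil by metis
  have \<delta>_zero: "\<delta> 0 = 0" using \<delta>_add[of 0 0] by simp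
  have \<delta>_sum: "\<delta> (sum f A) = (\<Sum>i\<in>A. \<delta> (f i))" for f :: "nat \<Rightarrow> 'd" and A
    using additive.sum[of \<delta>] \<delta>_add by (simp add: additive_def)
  have commN: "\<delta> a * x ^ n = x ^ n * \<delta> a" for a n by (rule power_commute) (rule comm)
  have kill: "ap (\<delta> a * x ^ n) c = 0" if "c \<in> V" "n \<ge> N c" for a n c
    unfolding commN by (rule N[OF that \<delta>R])
  \<comment> \<open>The truncation \<open>\<psi> p M\<close> acts on \<open>c\<close> as the whole series does, as soon as \<open>M \<ge> N c\<close>.\<close>
  define \<psi> where "\<psi> p M = (\<Sum>i<M. \<delta> (fps_nth p i) * x ^ i)" for p M
  have \<psi>R: "\<psi> p M \<in> operators" for p M
    unfolding \<psi>_def by (intro ops.R_sum ops.R_power_right xR \<delta>R)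
  have stable: "ap (\<psi> p M) c = ap (\<psi> p (N c)) c" if c: "c \<in> V" "M \<ge> N c" for p M c
    unfolding \<psi>_def ap_sum_left
    by (rule sum.mono_neutral_right) (use kill[OF c(1)] c(2) in auto)
  define \<phi> where "\<phi> c p = aug (ap (\<psi> p (N c)) c)" for c p
  have \<phi>: "\<phi> c p = aug (ap (\<psi> p M) c)" if "c \<in> V" "M \<ge> N c" for c p M
    by (simp add: \<phi>_def stable[OF that])
  have lin: "linear_on s fun_scale V \<phi>"
  proof (rule linear_onI)
    fix c d assume c: "c \<in> V" and d: "d \<in> V"
    have cd: "c + d \<in> V" using vs.subspace_add[OF subspace c d] .
    define M where "M = Max {N c, N d, N (c + d)}"
    have "M \<ge> N c" "M \<ge> N d" "M \<ge> N (c + d)" by (auto simp: M_def)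
    then show "\<phi> (c + d) = \<phi> c + \<phi> d"
      by (intro ext) (simp add: \<phi>[OF c] \<phi>[OF d] \<phi>[OF cd] ops.eps.add)
  next
    fix a c assume c: "c \<in> V"
    define M where "M = max (N c) (N (s a c))"
    have "M \<ge> N c" "M \<ge> N (s a c)" by (auto simp: M_def)
    then show "\<phi> (s a c) = fun_scale a (\<phi> c)"
      by (intro ext)
        (simp add: \<phi>[OF c] \<phi>[OF scale_in[OF c]] ops.eps.scale ops.ap_scale[OF \<psi>R] fun_scale_def)
  qed
  then have functional_\<phi>: "functional (\<lambda>c. \<phi> c p)" for p
    by (auto simp: linear_on_def fun_scale_def)
  have inj: "inj_on \<phi> V"
  proof (rule inj_onI)
    fix c d assume cd: "c \<in> V" "d \<in> V" and eq: "\<phi> c = \<phi> d"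
    define z where "z = c - d"
    have z: "z \<in> V" using cd by (simp add: z_def vs.subspace_diff[OF subspace])
    have "\<phi> (d + z) = \<phi> d + \<phi> z" by (rule linear_on_imp_eq(1)[OF lin cd(2) z])
    then have \<phi>z: "\<phi> z p = 0" for p using eq by (simp add: z_def)
    have aug0: "aug (ap h z) = 0" if h: "h \<in> operators" for h
    proof -
      obtain n f where f: "ap h z = (\<Sum>i<n. ap (\<delta> (f i) * x ^ i) z)" using gen[OF h z] by blast
      let ?p = "Abs_fps (\<lambda>i. if i < n then f i else 0)"
      let ?M = "max n (N z)"
      have "ap (\<psi> ?p ?M) z = (\<Sum>i<n. ap (\<delta> (f i) * x ^ i) z)"
        unfolding \<psi>_def ap_sum_left by (rule sum.mono_neutral_cong_right) (auto simp: \<delta>_zero)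
      then show ?thesis using \<phi>z[of ?p] \<phi>[OF z, of ?M ?p] f by simp
    qed
    have "z = 0"
    proof (rule ccontr)
      assume "z \<noteq> 0"
      then have "z \<notin> vs.span {}" by simp
      then obtain g where g: "Vector_Spaces.linear s (*) g" "g z = 1"
        by (rule vs.separating_functional) blast
      then show False using ops.functional[OF g(1)] aug0 z by force
    qed
    then show "c = d" by (simp add: z_def)
  qed
  have cauchy: "ap (\<psi> p M * \<psi> q M) c = ap (\<psi> (p * q) M) c" if c: "c \<in> V" "M \<ge> N c" for p q M c
  proof -
    define T where "T i j = ap (\<delta> (fps_nth p i * fps_nth q j) * x ^ (i + j)) c" for i j
    have T_zero: "T i j = 0" if "M \<le> i + j" for i j
      unfolding T_def using that c(2) by (intro kill[OF c(1)]) simp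
    have prod: "(\<delta> a * x ^ i) * (\<delta> b * x ^ j) = \<delta> (a * b) * x ^ (i + j)" for a b i j
    proof -
      have "(\<delta> a * x ^ i) * (\<delta> b * x ^ j) = \<delta> a * (x ^ i * \<delta> b) * x ^ j" by (simp add: mult.assoc)
      also have "\<dots> = \<delta> a * (\<delta> b * x ^ i) * x ^ j" by (simp only: commN)
      finally show ?thesis by (simp add: \<delta>_mult power_add mult.assoc)
    qed
    have "\<psi> p M * \<psi> q M = (\<Sum>i<M. \<Sum>j<M. \<delta> (fps_nth p i * fps_nth q j) * x ^ (i + j))"
      by (simp only: \<psi>_def sum_product prod)
    then have "ap (\<psi> p M * \<psi> q M) c = (\<Sum>(i, j)\<in>{..<M} \<times> {..<M}. T i j)"
      by (simp only: ap_sum_left T_def sum.cartesian_product split_def)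
    also have "\<dots> = (\<Sum>(i, j)\<in>{(i, j). i + j < M}. T i j)"
      by (rule sum.mono_neutral_right) (auto intro: T_zero simp: not_less)
    also have "\<dots> = (\<Sum>k<M. \<Sum>i\<le>k. T i (k - i))" by (rule sum.triangle_reindex)
    also have "\<dots> = ap (\<psi> (p * q) M) c"
      by (simp add: \<psi>_def ap_sum_left T_def fps_mult_nth \<delta>_sum sum_distrib_right atLeast0AtMost
          del: endo_ap(6))
    finally show ?thesis .
  qed
  have mult: "\<phi> c (p * q) = sweedler (*) (\<lambda>x y. \<phi> x p * \<phi> y q) c" if c: "c \<in> V" for c p q
  proof -
    obtain F where F: "finite F" "F \<subseteq> V" "\<And>f g. (\<And>u. u \<in> F \<Longrightarrow> f u = g u) \<Longrightarrow> lact f c = lact g c"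
      by (rule lact_depends_finitely[OF c]) blast
    define M where "M = Max (insert (N c) (N ` F))"
    have M: "M \<ge> N c" "\<And>u. u \<in> F \<Longrightarrow> M \<ge> N u" using F(1) by (auto simp: M_def)
    \<comment> \<open>With \<open>M\<close> large for all \<open>u\<close> in \<open>F\<close>, the truncated operator has the same functional as \<open>\<lambda>y. \<phi> y q\<close> on \<open>F\<close>.\<close>
    obtain h where h: "functional h" "\<psi> q M = opr h" using \<psi>R[of q M] by (rule operators_cases)
    have "lact (\<lambda>y. \<phi> y q) c = lact h c"
    proof (rule F(3))
      fix u assume u: "u \<in> F"
      then have uV: "u \<in> V" using F(2) by auto
      show "\<phi> u q = h u" using \<phi>[OF uV M(2)[OF u]] aug_opr[OF h(1), of u] by (simp add: h(2) proj(3)[OF uV])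
    qed
    also have "\<dots> = ap (\<psi> q M) c" by (simp add: h ap_opr proj(3)[OF c])
    finally have l: "lact (\<lambda>y. \<phi> y q) c = ap (\<psi> q M) c" .
    define d where "d = ap (\<psi> q M) c"
    have d: "d \<in> V" unfolding d_def by (rule ops.R_into[OF \<psi>R])
    \<comment> \<open>The bound \<open>M\<close> need not suffice for \<open>d\<close>, so both truncations are raised to a common \<open>M'\<close>.\<close>
    define M' where "M' = max M (N d)"
    have M': "M' \<ge> N c" "M' \<ge> N d" using M(1) by (auto simp: M'_def)
    have dM': "d = ap (\<psi> q M') c" using stable[OF c M(1)] stable[OF c M'(1)] by (simp add: d_def)
    have "sweedler (*) (\<lambda>x y. \<phi> x p * \<phi> y q) c = \<phi> d p"
      using functional_lact[OF functional_\<phi>[of p] c, of "\<lambda>y. \<phi> y q"] l by (simp add: d_def)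
    also have "\<dots> = aug (ap (\<psi> p M' * \<psi> q M') c)"
      using \<phi>[OF d M'(2), of p] dM' by simp
    also have "\<dots> = \<phi> c (p * q)" by (simp only: cauchy[OF c M'(1)] \<phi>[OF c M'(1)])
    finally show ?thesis by simp
  qed
  have unit: "\<phi> c 1 = counit C c" if c: "c \<in> V" for c
  proof -
    have "\<psi> 1 (Suc (N c)) = (\<Sum>i<Suc (N c). if i = 0 then e else 0)"
      unfolding \<psi>_def by (rule sum.cong) (auto simp: \<delta>_one \<delta>_zero)
    also have "\<dots> = e" by simp
    finally show ?thesis
      using \<phi>[OF c, of "Suc (N c)" 1] aug_opr[OF functional_counit, of c] by (simp add: proj(3)[OF c])
  qed
  have fin: "\<phi> c \<in> finite_dual_carrier (fps_scale scaleD)" if c: "c \<in> V" for c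
    unfolding finite_dual_carrier_def
  proof (intro CollectI conjI)
    interpret A: k_algebra "fps_scale scaleD" by (rule k_algebra_fps) unfold_locales
    interpret p: vector_space_pair "fps_scale scaleD" "(*) :: 'k \<Rightarrow> 'k \<Rightarrow> 'k"
      by (intro vector_space_pair.intro A.vector_space_axioms vector_space_field)
    have \<psi>_add: "\<psi> (p + q) M = \<psi> p M + \<psi> q M" for p q M
      by (simp add: \<psi>_def \<delta>_add distrib_right sum.distrib)
    have \<psi>_scale: "\<psi> (fps_scale scaleD a p) M = homothety s a * \<psi> p M" for a p M
      by (simp add: \<psi>_def fps_scale_def \<delta>_scale sum_distrib_left mult.assoc)
    show "Vector_Spaces.linear (fps_scale scaleD) (*) (\<phi> c)"
      by unfold_locales
        (simp_all add: \<phi>_def \<psi>_add \<psi>_scale ops.eps.add ops.eps.scale vs.ap_homothety)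
    define I where "I = {p :: 'd fps. \<forall>i<N c. fps_nth p i = 0}"
    have "two_sided_ideal I"
      unfolding two_sided_ideal_def I_def by (auto simp: fps_mult_nth intro!: sum.neutral)
    moreover have "\<forall>p\<in>I. \<phi> c p = 0"
      by (auto simp: I_def \<phi>_def \<psi>_def \<delta>_zero ap_sum_left ops.eps.zero)
    moreover have "finite_codim (fps_scale scaleD) I"
    proof -
      obtain B where B: "finite B" "D.independent B" "D.span B = UNIV" by (rule D.finite_basis_exists)
      define mon where "mon = (\<lambda>(u :: 'd, i). Abs_fps (\<lambda>k. if k = i then u else 0))"
      let ?B = "mon ` (B \<times> {..<N c})"
      have "p \<in> A.span (I \<union> ?B)" for p
      proof -
        define q where "q = (\<Sum>i<N c. \<Sum>u\<in>B. fps_scale scaleD (D.representation B (fps_nth p i) u) (mon (u, i)))"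
        have "fps_nth q k = fps_nth p k" if k: "k < N c" for k
        proof -
          have "fps_nth q k = (\<Sum>i<N c. \<Sum>u\<in>B. if k = i then scaleD (D.representation B (fps_nth p i) u) u else 0)"
            unfolding q_def by (simp add: fps_sum_nth fps_scale_def mon_def if_distrib cong: if_cong)
          also have "\<dots> = (\<Sum>i<N c. if k = i then fps_nth p i else 0)"
            by (intro sum.cong) (auto simp: D.sum_representation_eq[OF B(2)] B)
          finally show ?thesis using k by simp
        qed
        then have "p - q \<in> I" by (simp add: I_def)
        moreover have "q \<in> A.span (I \<union> ?B)"
          unfolding q_def by (intro A.span_sum A.span_scale A.span_base) auto
        ultimately have "(p - q) + q \<in> A.span (I \<union> ?B)" using A.span_base by (intro A.span_add) auto
        then show ?thesis by simp
      qed
      then show ?thesis unfolding finite_codim_def using B(1) by (intro exI[of _ ?B]) auto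
    qed
    ultimately show "\<exists>I. two_sided_ideal I \<and> finite_codim (fps_scale scaleD) I \<and> (\<forall>x\<in>I. \<phi> c x = 0)"
      by blast
  qed
  show thesis using that[OF lin inj fin mult unit] .
qed

end

theorem corollary5p11:
  fixes scaleD :: "'k::field \<Rightarrow> 'd::division_ring \<Rightarrow> 'd"
    and C :: "('c::ab_group_add, 'k) coalg"
  assumes "findim_central_division_algebra scaleD"
    and "chain_coalgebra C"
    and "coalgebra_of_type scaleD C"
  shows "\<exists>S. subcoalgebra (finite_dual (fps_scale scaleD)) S \<and>
             isomorphic_coalgs C (restrict_coalg (finite_dual (fps_scale scaleD)) S)"
proof -
  interpret D: findim_central_division_algebra scaleD by fact
  obtain \<Phi> where \<Phi>: "dual_algebra_iso (coradical_coalg C) scaleD \<Phi>"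
    using assms(3) by (auto simp: coalgebra_of_type_def)
  have "coalgebra C" using assms(2) by (simp add: chain_coalgebra_def)
  then interpret chain_coalgebra_of_type C scaleD \<Phi>
    using assms(1,2) \<Phi> by (simp add: chain_coalgebra_of_type_def chain_coalgebra_of_type_axioms_def)
  obtain \<phi> where "linear_on s fun_scale V \<phi>" "inj_on \<phi> V"
    "\<And>c. c \<in> V \<Longrightarrow> \<phi> c \<in> finite_dual_carrier (fps_scale scaleD)"
    "\<And>c p q. c \<in> V \<Longrightarrow> \<phi> c (p * q) = sweedler (*) (\<lambda>x y. \<phi> x p * \<phi> y q) c"
    "\<And>c. c \<in> V \<Longrightarrow> \<phi> c 1 = counit C c"
    by (rule power_series_embedding) blast
  from subcoalgebra_of_finite_dual[OF k_algebra_fps[OF D.k_algebra_axioms] this]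
  show ?thesis unfolding isomorphic_coalgs_def by blast
qed

end
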